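(* Let $\lambda_+/\lambda_-$ be a diagonal of $R$ and let $w\in S_n$. The filling $T^{\lambda_+}_w$ of $\lambda_+$ produced by the construction below does not depend on the choices of corner boxes made during the construction; equivalently, $T^U_w$ is the same for all $U\in\mathrm{SYT}(\lambda_-)$.
   Context: Fix integers $m\ge n\ge 1$. Young diagrams are drawn in English convention (row $1$ on top); a box is "above" another if it lies in a row of smaller index, and "to the right" if it lies in a column of larger index. Let $R$ be a rectangular Young diagram that has either $n$ rows and $m$ columns, or $m$ rows and $n$ columns. A diagonal of $R$ is a skew shape $\lambda_+/\lambda_-$, where $\lambda_-\subseteq\lambda_+\subseteq R$ are Young diagrams, consisting of exactly $n$ boxes $b_1,\dots,b_n$ such that $b_{i+1}$ is strictly above and strictly to the right of $b_i$ for $1\le i\le n-1$. For a filling $T$ and a box $x$, $T[x]$ is the entry of $T$ in $x$. $S_n$ is the symmetric group on $\{1,\dots,n\}$; $\mathrm{SYT}(\lambda)$ is the set of standard Young tableaux of shape $\lambda$. Jeu de taquin: let $T$ be a filling of a set of boxes with entries strictly increasing along rows and columns, and let $x$ be an empty box. Sliding $x$ through $T$: while the empty box has a filled neighbour immediately to its right or immediately below it, move the smaller of these entries into the empty box (the empty box moves to where that entry was). The box where the empty box ends up is the final position of the sliding path. Construction of $T^{\lambda_+}_w$: start with the filling $T$ with $T[b_i]=w(i)$ for $i=1,\dots,n$, all boxes of $\lambda_-$ unfilled. While the set of filled boxes is not all of $\lambda_+$: let $\mu\subseteq\lambda_+$ be the Young diagram of unfilled boxes; choose any corner box $x$ of $\mu$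 (a box whose removal from $\mu$ leaves a Young diagram); let $T'$ be obtained by sliding $x$ through $T$; if the final position of the sliding path is $b_i$, set $T'[b_i]:=T[b_i]+n$, where $T[b_i]$ denotes the entry of $b_i$ before the slide; replace $T$ by $T'$. The output is $T^{\lambda_+}_w$. A sequence of choices is encoded by $U\in\mathrm{SYT}(\lambda_-)$: the box chosen in the $k$-th iteration is the box $x$ with $U[x]=|\lambda_-|+1-k$; $T^U_w$ is the output for the choices encoded by $U$. *)

theory Defs
  imports "HOL-Combinatorics.Permutations" "HOL-Library.While_Combinator"
begin

text \<open>A box is a pair (row, column), both indices starting at 1, with row 1 on top.\<close>

type_synonym box = "nat \<times> nat"
type_synonym filling = "box \<rightharpoonup> nat"

definition rectangle :: "nat \<Rightarrow> nat \<Rightarrow> box set" where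
  "rectangle r c = {1..r} \<times> {1..c}"

definition young_diagram :: "box set \<Rightarrow> bool" where
  "young_diagram lam \<longleftrightarrow>
     finite lam \<and> (\<forall>(i, j)\<in>lam. 1 \<le> i \<and> 1 \<le> j \<and> {1..i} \<times> {1..j} \<subseteq> lam)"

definition is_corner :: "box set \<Rightarrow> box \<Rightarrow> bool" where
  "is_corner mu x \<longleftrightarrow> x \<in> mu \<and> young_diagram (mu - {x})"

definition SYT :: "box set \<Rightarrow> filling set" where
  "SYT lam = {U. dom U = lam
     \<and> bij_betw (\<lambda>x. the (U x)) lam {1..card lam}
     \<and> (\<forall>i j j'. (i, j) \<in> lam \<longrightarrow> (i, j') \<in> lam \<longrightarrow> j < j' \<longrightarrow> the (U (i, j)) < the (U (i, j')))
     \<and> (\<forall>i i' j. (i, j) \<in> lam \<longrightarrow> (i', j) \<in> lam \<longrightarrow> i < i' \<longrightarrow> the (U (i, j)) < the (U (i', j)))}"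

definition is_diagonal :: "nat \<Rightarrow> box set \<Rightarrow> box set \<Rightarrow> box set \<Rightarrow> (nat \<Rightarrow> box) \<Rightarrow> bool" where
  "is_diagonal n R lp lm b \<longleftrightarrow>
     young_diagram lm \<and> young_diagram lp \<and> lm \<subseteq> lp \<and> lp \<subseteq> R
     \<and> bij_betw b {1..n} (lp - lm)
     \<and> (\<forall>i. 1 \<le> i \<and> i < n \<longrightarrow> fst (b (i + 1)) < fst (b i) \<and> snd (b i) < snd (b (i + 1)))"

text \<open>The filled neighbour whose entry moves into the empty box. Entries of the fillings
  that are slid through are distinct, so the tie-breaking is immaterial.\<close>

definition next_box :: "filling \<Rightarrow> box \<Rightarrow> box option" where
  "next_box T x =
     (let right = (fst x, snd x + 1); below = (fst x + 1, snd x) in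
      case (T right, T below) of
        (None, None) \<Rightarrow> None
      | (Some _, None) \<Rightarrow> Some right
      | (None, Some _) \<Rightarrow> Some below
      | (Some p, Some q) \<Rightarrow> Some (if p < q then right else below))"

text \<open>The result of a slide together with the final position of the sliding path. For a
  filling with finite domain the loop terminates.\<close>

definition slide :: "filling \<Rightarrow> box \<Rightarrow> filling \<times> box" where
  "slide T x =
     while (\<lambda>(T, y). next_box T y \<noteq> None)
           (\<lambda>(T, y). let z = the (next_box T y) in (T(y := T z, z := None), z))
           (T, x)"

definition start_filling :: "nat \<Rightarrow> (nat \<Rightarrow> box) \<Rightarrow> (nat \<Rightarrow> nat) \<Rightarrow> filling" where
  "start_filling n b w = map_of (map (\<lambda>i. (b i, w i)) [1..<n + 1])"

definition slide_refill :: "nat \<Rightarrow> (nat \<Rightarrow> box) \<Rightarrow> filling \<Rightarrow> box \<Rightarrow> filling" where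
  "slide_refill n b T x =
     (let (T', y) = slide T x in
      if y \<in> b ` {1..n} then T'(y := map_option (\<lambda>a. a + n) (T y)) else T')"

inductive construction_step ::
  "nat \<Rightarrow> box set \<Rightarrow> (nat \<Rightarrow> box) \<Rightarrow> filling \<Rightarrow> filling \<Rightarrow> bool" for n lp b where
  "dom T \<noteq> lp \<Longrightarrow> is_corner (lp - dom T) x \<Longrightarrow>
     construction_step n lp b T (slide_refill n b T x)"

definition construction_output ::
  "nat \<Rightarrow> box set \<Rightarrow> (nat \<Rightarrow> box) \<Rightarrow> (nat \<Rightarrow> nat) \<Rightarrow> filling \<Rightarrow> bool" where
  "construction_output n lp b w T \<longleftrightarrow>
     (construction_step n lp b)\<^sup>*\<^sup>* (start_filling n b w) T \<and> dom T = lp"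

definition chosen_box :: "box set \<Rightarrow> filling \<Rightarrow> nat \<Rightarrow> box" where
  "chosen_box lm U k = (THE x. x \<in> lm \<and> U x = Some (card lm + 1 - k))"

definition filling_of_choices ::
  "nat \<Rightarrow> box set \<Rightarrow> (nat \<Rightarrow> box) \<Rightarrow> (nat \<Rightarrow> nat) \<Rightarrow> filling \<Rightarrow> filling" where
  "filling_of_choices n lm b w U =
     fold (\<lambda>k T. slide_refill n b T (chosen_box lm U k)) [1..<card lm + 1] (start_filling n b w)"

end

theory Submission
  imports Defs
begin

text \<open>
  Write \<open>p(u)\<close> for the box of the value \<open>u\<close>, where values not yet placed are stacked at the diagonal box of their
  residue class modulo \<open>n\<close>. The rows of \<open>p(1), p(2), \<dots>\<close> form a word, and so do the columns. A slide
  changes single letters of the row word from \<open>r + 1\<close> to \<open>r\<close>, always at a time \<open>q\<close> such that \<open>r + 1\<close> outnumbers \<open>r\<close> in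
  every window ending at \<open>q\<close>. Hence the maximal number of letters covered by \<open>k\<close> weakly decreasing subsequences
  never grows, and in a complete filling the numbers of values \<open>\<le> v\<close> in the first \<open>r\<close> rows and in the first
  \<open>k\<close> columns are bounded by Greene-type numbers \<open>\<Phi>\<close> and \<open>\<Psi>\<close> of the periodic word of residue classes.

  The key inequality is \<open>\<Phi> + \<Psi> \<le> v + r k\<close> for \<open>r + k \<le> n\<close>. It holds for all words in which the letters \<open>e\<close> and \<open>e + 1\<close>
  alternate: peeling off the first row of the insertion tableau gives a word of the same kind on \<open>n - 1\<close>
  letters, lowers \<open>\<Phi>\<close> by at most the number of letters removed while \<open>r\<close> drops by one, and lowers \<open>\<Psi>\<close> by at
  most \<open>k\<close>. At the first value that two complete fillings place differently, counting one of them by rows and the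
  other by columns violates the inequality.
\<close>

text \<open>For strictly decreasing subsequences the key inequality would follow from Greene's
  theorem: \<open>r\<close> rows and \<open>k\<close> columns of a Young diagram share at most
  \<open>r k\<close> boxes, and removing one row costs each column at most one box. Here increase
  and decrease are both weak, and a constant word violates the bound, so repeated letters have to be
  controlled. The periodicity of the word of residue classes does not survive the removal of a row,
  but the alternation of neighbouring letters does; hence the induction is set up for alternating
  words.

  The side of length \<open>n\<close> makes the diagonal meet every row or every column of the
  rectangle. So every corner of \<open>lp\<close> is a diagonal box and every slide ends in a
  refill. Stacking the values not yet placed on the diagonal makes the refills invisible: only
  slides change the two words.

  The inequality covers only \<open>r + k \<le> n\<close>, whereas the first discrepancy between two
  fillings may lie in a column beyond \<open>n - r\<close>. This is why the final bound counts rows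
  and columns up to two different times.\<close>

declare split_paired_All [simp del] split_paired_Ex [simp del]

section \<open>Particle runs on alternating words\<close>

text \<open>Sets of naturals stand for configurations of particles on sites; \<open>dominated X Y\<close> says that
  the \<open>i\<close>-th particle of \<open>X\<close> is never above the \<open>i\<close>-th particle of \<open>Y\<close>.\<close>

definition dominated :: "nat set \<Rightarrow> nat set \<Rightarrow> bool" where
  "dominated X Y \<longleftrightarrow> (\<forall>s. card (X \<inter> {s..}) \<le> card (Y \<inter> {s..}))"

text \<open>\<open>k\<close> particles move monotonically on the sites \<open>A\<close> while the letters \<open>f 1, f 2, \<dots>\<close> are read; the last
  argument counts the letters read at an occupied site. Up-runs and down-runs with \<open>k\<close> particles
  collect the unions of \<open>k\<close> weakly increasing, respectively weakly decreasing, subsequences.\<close>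

inductive run ::
  "(nat set \<Rightarrow> nat set \<Rightarrow> bool) \<Rightarrow> (nat \<Rightarrow> nat) \<Rightarrow> nat set \<Rightarrow> nat \<Rightarrow> nat \<Rightarrow> nat set \<Rightarrow> nat \<Rightarrow> bool"
  for mv f A k where
  run_start: "Y \<subseteq> A \<Longrightarrow> card Y = k \<Longrightarrow> run mv f A k 0 Y 0"
| run_move: "run mv f A k t Y a \<Longrightarrow> mv Y Y' \<Longrightarrow> Y' \<subseteq> A \<Longrightarrow> card Y' = k \<Longrightarrow> run mv f A k t Y' a"
| run_read: "run mv f A k t Y a \<Longrightarrow> run mv f A k (Suc t) Y (a + of_bool (f (Suc t) \<in> Y))"

abbreviation up_run :: "(nat \<Rightarrow> nat) \<Rightarrow> nat \<Rightarrow> nat \<Rightarrow> nat \<Rightarrow> nat set \<Rightarrow> nat \<Rightarrow> bool" where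
  "up_run f n \<equiv> run dominated f {1..n}"

abbreviation down_run :: "(nat \<Rightarrow> nat) \<Rightarrow> nat \<Rightarrow> nat \<Rightarrow> nat \<Rightarrow> nat set \<Rightarrow> nat \<Rightarrow> bool" where
  "down_run f n \<equiv> run (\<lambda>X Y. dominated Y X) f {1..n}"

primrec cnt :: "(nat \<Rightarrow> nat) \<Rightarrow> nat set \<Rightarrow> nat \<Rightarrow> nat" where
  "cnt f A 0 = 0"
| "cnt f A (Suc t) = cnt f A t + of_bool (f (Suc t) \<in> A)"

text \<open>Letters outside \<open>{1..n}\<close> are blanks. Consecutive letters \<open>e\<close> and \<open>Suc e\<close> occur alternately; as the
  difference vanishes at time 0, the upper value \<open>M e\<close> is 0 or 1.\<close>

definition alternating :: "(nat \<Rightarrow> nat) \<Rightarrow> nat \<Rightarrow> (nat \<Rightarrow> int) \<Rightarrow> bool" where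
  "alternating f n M \<longleftrightarrow> (\<forall>e t. 1 \<le> e \<and> e < n \<longrightarrow>
     int (cnt f {Suc e} t) - int (cnt f {e} t) \<in> {M e - 1, M e})"

text \<open>Row insertion into a single row: \<open>lines\<close> is the set of letters \<open>2..n\<close> present in the row. The bumped
  letters, lowered by one, form a word on \<open>n - 1\<close> letters; an insertion that lengthens the row gives
  the letter \<open>n\<close>, a blank for the shorter alphabet. For \<open>r < n\<close>, \<open>peel f n r\<close> interpolates between
  \<open>f\<close> and this word by inserting the letters \<open>1..r\<close> only.\<close>

definition bumped :: "nat \<Rightarrow> nat set \<Rightarrow> nat \<Rightarrow> nat" where
  "bumped n S c = (LEAST s. c < s \<and> (s \<in> S \<or> n < s))"

primrec lines :: "(nat \<Rightarrow> nat) \<Rightarrow> nat \<Rightarrow> nat \<Rightarrow> nat set" where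
  "lines f n 0 = {}"
| "lines f n (Suc t) =
     (let c = f (Suc t); S = lines f n t in
      if c \<in> {1..n} then (S - {bumped n S c}) \<union> ({c} - {1}) else S)"

definition peel :: "(nat \<Rightarrow> nat) \<Rightarrow> nat \<Rightarrow> nat \<Rightarrow> nat \<Rightarrow> nat" where
  "peel f n r u =
     (let c = f u; z = bumped n (lines f n (u - 1)) c in
      if c \<in> {1..r} then (if z \<le> r then z - 1 else r) else c)"

section \<open>Basic facts on runs, tail counts and row insertion\<close>

lemma run_subset: "run mv f A k t Y a \<Longrightarrow> Y \<subseteq> A"
  by (induction rule: run.induct) auto

lemma run_card: "run mv f A k t Y a \<Longrightarrow> card Y = k"
  by (induction rule: run.induct) auto

lemma run_finite: "run mv f {1..n::nat} k t Y a \<Longrightarrow> finite Y"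
  by (drule run_subset) (erule finite_subset, simp)

lemma bumped_props:
  assumes "c \<le> n"
  shows "c < bumped n S c" and "bumped n S c \<in> S \<or> n < bumped n S c"
    and "bumped n S c \<le> Suc n"
    and "\<And>s. s \<in> S \<Longrightarrow> c < s \<Longrightarrow> bumped n S c \<le> s"
proof -
  let ?P = "\<lambda>s. c < s \<and> (s \<in> S \<or> n < s)"
  have ex: "?P (Suc n)" using assms by simp
  have *: "?P (bumped n S c)" unfolding bumped_def by (rule LeastI[of ?P, OF ex])
  then show "c < bumped n S c" "bumped n S c \<in> S \<or> n < bumped n S c" by auto
  show "bumped n S c \<le> Suc n" unfolding bumped_def by (rule Least_le[of ?P, OF ex])
  show "bumped n S c \<le> s" if "s \<in> S" "c < s" for s
    unfolding bumped_def by (rule Least_le) (use that in auto)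
qed

lemma lines_subset: "lines f n t \<subseteq> {2..n}"
  by (induction t) (auto simp: Let_def)

lemma lines_finite: "finite (lines f n t)"
  by (rule finite_subset[OF lines_subset]) simp

lemma card_insert_diff_tail:
  assumes "finite X" "m \<in> X" "c \<notin> X"
  shows "int (card (insert c (X - {m}) \<inter> {s..})) =
     int (card (X \<inter> {s..})) - of_bool (s \<le> m) + of_bool (s \<le> c)"
proof -
  have f: "finite (X \<inter> {s..})" using assms by auto
  have eq: "insert c (X - {m}) \<inter> {s..} = (if s \<le> c then insert c ((X \<inter> {s..}) - {m}) else (X \<inter> {s..}) - {m})"
    by auto
  have d: "int (card ((X \<inter> {s..}) - {m})) = int (card (X \<inter> {s..})) - of_bool (s \<le> m)"
  proof (cases "s \<le> m")
    case True
    then have "m \<in> X \<inter> {s..}" using assms by auto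
    then have "card (X \<inter> {s..}) = Suc (card ((X \<inter> {s..}) - {m}))"
      using f by (metis card_Suc_Diff1)
    then show ?thesis using True by simp
  next
    case False
    then have "(X \<inter> {s..}) - {m} = X \<inter> {s..}" by auto
    then show ?thesis using False by simp
  qed
  show ?thesis using assms d f unfolding eq by (auto simp: card_insert_if)
qed

lemma card_tail_raise:
  assumes "finite Y" "r \<in> Y" "Suc r \<notin> Y"
  shows "card (insert (Suc r) (Y - {r}) \<inter> {s..}) = (if s = Suc r then card (Y \<inter> {r..}) else card (Y \<inter> {s..}))"
proof -
  have "Y \<inter> {r..} = insert r (Y \<inter> {Suc r..})" using assms by auto
  then have "card (Y \<inter> {r..}) = Suc (card (Y \<inter> {Suc r..}))" using assms(1) by simp
  then show ?thesis using card_insert_diff_tail[OF assms, of s] by (cases "s \<le> r"; cases "s = Suc r") auto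
qed

text \<open>Raising a particle from \<open>r\<close> to \<open>Suc r\<close> changes only the tail
  count at \<open>Suc r\<close>. The condition on \<open>Y'\<close> excludes the one situation in
  which there may be no room for this; then \<open>dominated_raise_raise\<close> raises a particle
  on both sides.\<close>

lemma dominated_raise:
  assumes dom: "dominated Y Y'" and fin: "finite Y" "finite Y'" and A: "r \<in> Y" "Suc r \<notin> Y"
    and F: "\<not> (r \<in> Y' \<and> Suc r \<notin> Y')"
  shows "dominated (insert (Suc r) (Y - {r})) Y'"
  unfolding dominated_def
proof
  fix s
  note tX = card_tail_raise[OF fin(1) A]
  have domD: "card (Y \<inter> {s..}) \<le> card (Y' \<inter> {s..})" for s using dom unfolding dominated_def by blast
  show "card (insert (Suc r) (Y - {r}) \<inter> {s..}) \<le> card (Y' \<inter> {s..})"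
  proof (cases "s = Suc r")
    case s: True
    show ?thesis
    proof (cases "r \<in> Y'")
      case False
      have "x \<noteq> r" if "x \<in> Y'" for x using that False by blast
      then have "Y' \<inter> {r..} = Y' \<inter> {Suc r..}" by (force simp: Suc_le_eq)
      then show ?thesis using domD[of r] tX[of s] s by simp
    next
      case True
      then have "Suc r \<in> Y'" using F by blast
      then have "Y' \<inter> {Suc r..} = insert (Suc r) (Y' \<inter> {Suc (Suc r)..})" by auto
      then have e1: "card (Y' \<inter> {Suc r..}) = Suc (card (Y' \<inter> {Suc (Suc r)..}))" using fin by simp
      have "x = r \<or> Suc (Suc r) \<le> x" if "x \<in> Y" "r \<le> x" for x
      proof -
        have "x \<noteq> Suc r" using A that by blast
        then show ?thesis using that by linarith
      qed
      then have "Y \<inter> {r..} = insert r (Y \<inter> {Suc (Suc r)..})" using A by fastforce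
      then have "card (Y \<inter> {r..}) = Suc (card (Y \<inter> {Suc (Suc r)..}))" using fin by simp
      then show ?thesis using e1 domD[of "Suc (Suc r)"] tX[of s] s by simp
    qed
  next
    case False
    then show ?thesis using tX domD by simp
  qed
qed

lemma dominated_raise_raise:
  assumes "dominated Y Y'" "finite Y" "finite Y'" "r \<in> Y" "Suc r \<notin> Y" "r \<in> Y'" "Suc r \<notin> Y'"
  shows "dominated (insert (Suc r) (Y - {r})) (insert (Suc r) (Y' - {r}))"
  using assms(1) card_tail_raise[OF assms(2,4,5)] card_tail_raise[OF assms(3,6,7)]
  unfolding dominated_def by simp

lemma card_insert_diff:
  assumes "finite X" "m \<in> X" "c \<notin> X"
  shows "card (insert c (X - {m})) = card X"
proof -
  have "card (insert c (X - {m})) = Suc (card (X - {m}))" using assms by simp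
  then show ?thesis using card_Suc_Diff1[OF assms(1,2)] by simp
qed

lemma up_move: "up_run f n k t Y a \<Longrightarrow> dominated Y Y' \<Longrightarrow> Y' \<subseteq> {1..n} \<Longrightarrow> card Y' = k \<Longrightarrow> up_run f n k t Y' a"
  by (rule run.run_move)

lemma down_move: "down_run f n k t Y a \<Longrightarrow> dominated Y' Y \<Longrightarrow> Y' \<subseteq> {1..n} \<Longrightarrow> card Y' = k \<Longrightarrow> down_run f n k t Y' a"
  by (rule run.run_move)

section \<open>Row insertion of alternating words\<close>

text \<open>When \<open>c\<close> arrives, the difference has just grown and is at its upper value.
  It cannot drop while \<open>c\<close> stays in the row, because an arriving \<open>c - 1\<close>
  bumps exactly \<open>c\<close>.\<close>

lemma lines_alternating:
  assumes "alternating f n M" "2 \<le> c" "c \<in> lines f n t"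
  shows "int (cnt f {c} t) - int (cnt f {c - 1} t) = M (c - 1)"
  using assms(3)
proof (induction t)
  case 0 then show ?case by simp
next
  case (Suc t)
  let ?S = "lines f n t" and ?l = "f (Suc t)"
  have cn: "c \<le> n" using Suc.prems lines_subset by fastforce
  have rng: "int (cnt f {c} s) - int (cnt f {c - 1} s) \<in> {M (c - 1) - 1, M (c - 1)}" for s
  proof -
    have "Suc (c - 1) = c" "1 \<le> c - 1" "c - 1 < n" using assms(2) cn by auto
    then show ?thesis using assms(1) unfolding alternating_def by metis
  qed
  show ?case
  proof (cases "?l = c")
    case True
    have "int (cnt f {c} (Suc t)) - int (cnt f {c - 1} (Suc t)) = int (cnt f {c} t) - int (cnt f {c - 1} t) + 1"
      using True assms(2) by auto
    then show ?thesis using rng[of t] rng[of "Suc t"] by auto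
  next
    case False
    then have cS: "c \<in> ?S" using Suc.prems by (auto simp: Let_def split: if_splits)
    have "?l \<noteq> c - 1"
    proof
      assume l: "?l = c - 1"
      then have "?l \<in> {1..n}" using assms(2) cn by auto
      then have nb: "c \<noteq> bumped n ?S ?l" using Suc.prems False by (auto simp: Let_def)
      have "?l \<le> n" using l cn by auto
      note b = bumped_props[OF this, where S="?S"]
      have "?l < c" using l assms(2) by auto
      then show False using b(1) b(4)[OF cS] nb l by linarith
    qed
    then show ?thesis using Suc.IH[OF cS] False by simp
  qed
qed


lemma alternatingD:
  assumes "alternating f n M" "1 \<le> e" "e < n"
  shows "int (cnt f {Suc e} t) - int (cnt f {e} t) = M e - 1 \<or> int (cnt f {Suc e} t) - int (cnt f {e} t) = M e"
  using assms unfolding alternating_def by blast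

text \<open>With \<open>c\<close> in the row the difference is already maximal, so another
  \<open>c\<close> would exceed the range. Thus no letter above 1 is repeated in the row, and a set
  is enough to record it.\<close>

lemma arrival_notin_lines:
  assumes "alternating f n M" "f (Suc t) = c"
  shows "c \<notin> lines f n t"
proof
  assume c: "c \<in> lines f n t"
  then have c2: "2 \<le> c" "c \<le> n" using lines_subset by fastforce+
  have "int (cnt f {c} t) - int (cnt f {c - 1} t) = M (c - 1)"
    using lines_alternating[OF assms(1) c2(1) c] .
  moreover have "int (cnt f {Suc (c - 1)} (Suc t)) - int (cnt f {c - 1} (Suc t)) \<le> M (c - 1)"
  proof -
    have "1 \<le> c - 1" "c - 1 < n" using c2 by auto
    from alternatingD[OF assms(1) this, of "Suc t"] show ?thesis by linarith
  qed
  moreover have "c \<noteq> c - 1" "Suc (c - 1) = c" using c2 by auto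
  ultimately show False using assms(2) by simp
qed

text \<open>The arrival of \<open>e\<close> lowered the difference, so \<open>Suc e\<close> must
  have been read later. While \<open>e\<close> is in the row, smaller letters bump \<open>e\<close>
  or something below it and never reach \<open>Suc e\<close>.\<close>

lemma lines_run_up:
  assumes "alternating f n M" "e \<in> lines f n t" "e < n"
    and "int (cnt f {Suc e} t) - int (cnt f {e} t) = M e"
  shows "Suc e \<in> lines f n t"
  using assms(2,4)
proof (induction t)
  case 0 then show ?case by simp
next
  case (Suc t)
  let ?S = "lines f n t" and ?l = "f (Suc t)"
  have e2: "2 \<le> e" using Suc.prems(1) lines_subset by fastforce
  show ?case
  proof (cases "?l = Suc e")
    case True
    then show ?thesis using e2 assms(3) by (auto simp: Let_def)
  next
    case F1: False
    have F2: "?l \<noteq> e"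
    proof
      assume l: "?l = e"
      have "int (cnt f {Suc e} t) - int (cnt f {e} t) = M e + 1" using Suc.prems(2) l by simp
      then show False using alternatingD[OF assms(1), of e t] e2 assms(3) by auto
    qed
    have eS: "e \<in> ?S" using Suc.prems(1) F2 by (auto simp: Let_def split: if_splits)
    have sS: "Suc e \<in> ?S" using Suc.IH[OF eS] Suc.prems(2) F1 F2 by simp
    show ?thesis
    proof (cases "?l \<in> {1..n}")
      case True
      then have "?l \<le> n" by simp
      note b = bumped_props[OF this, where S="?S"]
      have "bumped n ?S ?l \<noteq> Suc e"
      proof
        assume bb: "bumped n ?S ?l = Suc e"
        then have "?l < e" using b(1) F2 by linarith
        then show False using b(4)[OF eS] bb by simp
      qed
      then show ?thesis using sS by (auto simp: Let_def)
    next
      case False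
      then have "lines f n (Suc t) = ?S" by (simp only: lines.simps Let_def if_False)
      then show ?thesis using sS by simp
    qed
  qed
qed

abbreviation peeled :: "(nat \<Rightarrow> nat) \<Rightarrow> nat \<Rightarrow> nat \<Rightarrow> nat" where
  "peeled f n \<equiv> peel f n n"

lemma peeled_Suc:
  "peeled f n (Suc t) = (if f (Suc t) \<in> {1..n} then bumped n (lines f n t) (f (Suc t)) - 1 else f (Suc t))"
proof -
  have "f (Suc t) \<le> n \<Longrightarrow> bumped n (lines f n t) (f (Suc t)) \<le> Suc n"
    by (rule bumped_props)
  then have "\<not> bumped n (lines f n t) (f (Suc t)) \<le> n \<Longrightarrow> f (Suc t) \<in> {1..n} \<Longrightarrow> bumped n (lines f n t) (f (Suc t)) - 1 = n"
    by simp
  then show ?thesis unfolding peel_def Let_def diff_Suc_1 by presburger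
qed

text \<open>Conservation of letters: a \<open>c\<close> that has been read is still in the row or
  has left it as the peeled letter \<open>c - 1\<close>.\<close>

lemma cnt_peeled:
  assumes "alternating f n M" "2 \<le> c" "c \<le> n"
  shows "cnt (peeled f n) {c - 1} t + of_bool (c \<in> lines f n t) = cnt f {c} t"
proof (induction t)
  case 0 then show ?case by simp
next
  case (Suc t)
  let ?S = "lines f n t" and ?l = "f (Suc t)"
  show ?case
  proof (cases "?l \<in> {1..n}")
    case True
    then have l: "?l \<le> n" "1 \<le> ?l" by auto
    note b = bumped_props[OF l(1), where S="?S"]
    let ?z = "bumped n ?S ?l"
    have z: "?z - 1 = c - 1 \<longleftrightarrow> ?z = c" using b(1) assms(2) l by auto
    have S': "lines f n (Suc t) = (?S - {?z}) \<union> ({?l} - {1})" using True by (simp add: Let_def)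
    have m: "c \<in> lines f n (Suc t) \<longleftrightarrow> (c \<in> ?S \<and> c \<noteq> ?z) \<or> c = ?l" unfolding S' using assms(2) by auto
    have p: "peeled f n (Suc t) \<in> {c - 1} \<longleftrightarrow> ?z = c" using True z by (simp only: peeled_Suc if_True singleton_iff)
    have "?l = c \<Longrightarrow> c \<notin> ?S" using arrival_notin_lines[OF assms(1)] by blast
    moreover have "?z = c \<Longrightarrow> c \<in> ?S \<and> ?l \<noteq> c" using b(1,2) assms(3) by auto
    ultimately show ?thesis unfolding cnt.simps(2) m p using Suc.IH
      by (cases "?l = c"; cases "?z = c"; cases "c \<in> ?S") auto
  next
    case False
    then have "lines f n (Suc t) = ?S" by (simp only: lines.simps Let_def if_False)
    moreover have "peeled f n (Suc t) = ?l" using False by (simp only: peeled_Suc if_False)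
    moreover have "?l \<noteq> c" "?l \<noteq> c - 1" using False assms(2,3) by auto
    ultimately show ?thesis using Suc.IH by (simp only: cnt.simps) simp
  qed
qed

text \<open>By \<open>cnt_peeled\<close>, the new difference is the old one for the next pair of
  letters, corrected by the presence of these two letters in the row. The corrections that would
  leave the range are excluded by \<open>lines_alternating\<close> and
  \<open>lines_run_up\<close>.\<close>

lemma alternating_peeled:
  assumes "alternating f n M"
  shows "alternating (peeled f n) (n - 1) (\<lambda>e. M (Suc e))"
  unfolding alternating_def
proof (intro allI impI)
  fix e t assume e: "1 \<le> e \<and> e < n - 1"
  let ?S = "lines f n t"
  have c1: "cnt (peeled f n) {e} t + of_bool (Suc e \<in> ?S) = cnt f {Suc e} t"
  proof -
    have "2 \<le> Suc e" "Suc e \<le> n" using e by auto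
    from cnt_peeled[OF assms this, of t] show ?thesis by (simp only: diff_Suc_1)
  qed
  have c2: "cnt (peeled f n) {Suc e} t + of_bool (Suc (Suc e) \<in> ?S) = cnt f {Suc (Suc e)} t"
  proof -
    have "2 \<le> Suc (Suc e)" "Suc (Suc e) \<le> n" using e by auto
    from cnt_peeled[OF assms this, of t] show ?thesis by (simp only: diff_Suc_1)
  qed
  have a: "int (cnt f {Suc (Suc e)} t) - int (cnt f {Suc e} t) = M (Suc e) - 1
     \<or> int (cnt f {Suc (Suc e)} t) - int (cnt f {Suc e} t) = M (Suc e)"
    using alternatingD[OF assms, of "Suc e" t] e by auto
  have k1: "Suc (Suc e) \<in> ?S \<Longrightarrow> int (cnt f {Suc (Suc e)} t) - int (cnt f {Suc e} t) = M (Suc e)"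
    using lines_alternating[OF assms, of "Suc (Suc e)" t] by simp
  have k2: "Suc e \<in> ?S \<Longrightarrow> int (cnt f {Suc (Suc e)} t) - int (cnt f {Suc e} t) = M (Suc e) \<Longrightarrow> Suc (Suc e) \<in> ?S"
    using lines_run_up[OF assms, of "Suc e" t] e by force
  show "int (cnt (peeled f n) {Suc e} t) - int (cnt (peeled f n) {e} t) \<in> {M (Suc e) - 1, M (Suc e)}"
    using c1 c2 a k1 k2 by (cases "Suc e \<in> ?S"; cases "Suc (Suc e) \<in> ?S") auto
qed

lemma cnt_letters_peeled:
  assumes "1 \<le> n"
  shows "cnt f {1..n} t = cnt (peeled f n) {n} t + cnt (peeled f n) {1..n - 1} t"
proof (induction t)
  case 0 then show ?case by simp
next
  case (Suc t)
  let ?l = "f (Suc t)"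
  have "?l \<in> {1..n} \<Longrightarrow> peeled f n (Suc t) \<in> {1..n}"
    using bumped_props(1,3)[of ?l n "lines f n t"] by (auto simp: peeled_Suc)
  moreover have "?l \<notin> {1..n} \<Longrightarrow> peeled f n (Suc t) \<notin> {1..n}" by (auto simp: peeled_Suc)
  moreover have "{1..n} = insert n {1..n - 1}" "n \<notin> {1..n - 1}" using assms by auto
  ultimately show ?case using Suc by (auto split: if_splits)
qed

lemma lines_Suc_letter:
  "f (Suc t) \<in> {1..n} \<Longrightarrow>
    lines f n (Suc t) = (lines f n t - {bumped n (lines f n t) (f (Suc t))}) \<union> ({f (Suc t)} - {1})"
  by (simp add: Let_def)

lemma lines_Suc_blank: "f (Suc t) \<notin> {1..n} \<Longrightarrow> lines f n (Suc t) = lines f n t"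
  by (simp only: lines.simps Let_def if_False)

declare lines.simps(2) [simp del]

section \<open>Up-runs along the interpolating words\<close>

text \<open>The two words differ only where \<open>r\<close> becomes \<open>Suc r\<close>: an
  inserted letter up to \<open>r\<close> finds no \<open>Suc r\<close> in the row and bumps
  something larger. A letter \<open>r\<close> that bumps \<open>Suc r\<close> stays. So each
  \<open>Suc r\<close> is matched with a later \<open>r\<close>, and the unmatched \<open>r\<close>
  are raised. The second alternative keeps a lone particle of \<open>r\<close> at
  \<open>Suc r\<close> instead; it leads by one as long as a \<open>Suc r\<close> in the row awaits
  its match, and loses this lead when the matching \<open>r\<close> is read.\<close>

lemma up_run_peel_step:
  assumes "up_run (peel f n r) n k t Y a" "alternating f n M" "1 \<le> r" "r < n"
  shows "\<exists>a'. (up_run (peel f n (Suc r)) n k t Y a' \<and> a \<le> a') \<or>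
    (r \<in> Y \<and> Suc r \<notin> Y \<and> up_run (peel f n (Suc r)) n k t (insert (Suc r) (Y - {r})) a'
      \<and> a + of_bool (Suc r \<in> lines f n t) \<le> a')"
  using assms(1)
proof (induction rule: run.induct)
  case (run_start Y)
  then show ?case by (blast intro: run.run_start)
next
  case (run_move t Y a Y')
  let ?R = "up_run (peel f n (Suc r)) n k"
  have fin: "finite Y" "finite Y'"
    using run_finite[OF run_move.hyps(1)] finite_subset[OF run_move.hyps(3)] by auto
  have dom: "dominated Y Y'" using run_move by simp
  from run_move.IH obtain a' where
    "(?R t Y a' \<and> a \<le> a') \<or>
    (r \<in> Y \<and> Suc r \<notin> Y \<and> ?R t (insert (Suc r) (Y - {r})) a'
      \<and> a + of_bool (Suc r \<in> lines f n t) \<le> a')" by blast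
  then show ?case
  proof
    assume "?R t Y a' \<and> a \<le> a'"
    then show ?thesis using up_move[OF _ dom run_move.hyps(3,4)] by blast
  next
    assume A: "r \<in> Y \<and> Suc r \<notin> Y \<and> ?R t (insert (Suc r) (Y - {r})) a'
      \<and> a + of_bool (Suc r \<in> lines f n t) \<le> a'"
    let ?X = "insert (Suc r) (Y - {r})"
    have AR: "?R t ?X a'" using A by simp
    show ?thesis
    proof (cases "r \<in> Y' \<and> Suc r \<notin> Y'")
      case True
      let ?X' = "insert (Suc r) (Y' - {r})"
      have "dominated ?X ?X'" using dominated_raise_raise[OF dom fin] A True by blast
      moreover have "?X' \<subseteq> {1..n}" using run_move.hyps(3) assms(4) by auto
      moreover have "card ?X' = k" using card_insert_diff[of Y' r "Suc r"] True fin run_move.hyps by simp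
      ultimately have "?R t ?X' a'" by (rule up_move[OF AR])
      then show ?thesis using True A by blast
    next
      case False
      then have "dominated ?X Y'" using dominated_raise[OF dom fin] A by blast
      then have "?R t Y' a'" by (rule up_move[OF AR _ run_move.hyps(3,4)])
      moreover have "a \<le> a'" using A by linarith
      ultimately show ?thesis by (intro exI disjI1 conjI)
    qed
  qed
next
  case (run_read t Y a)
  let ?l = "f (Suc t)" and ?S = "lines f n t"
  let ?z = "bumped n ?S ?l"
  let ?g = "peel f n r (Suc t)" and ?g' = "peel f n (Suc r) (Suc t)"
  have fin: "finite Y" "Y \<subseteq> {1..n}" "card Y = k"
    using run_finite[OF run_read.hyps(1)] run_subset[OF run_read.hyps(1)] run_card[OF run_read.hyps(1)] by auto
  note pg = peel_def[of f n _ "Suc t", unfolded Let_def diff_Suc_1]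
  consider (other) "?g' = ?g" "Suc r \<in> lines f n (Suc t) \<Longrightarrow> Suc r \<in> ?S"
      "?g = r \<Longrightarrow> Suc r \<in> ?S \<and> Suc r \<notin> lines f n (Suc t)" "?g \<noteq> Suc r"
    | (arr) "?g' = Suc r" "?g = Suc r"
    | (chg) "?g = r" "?g' = Suc r" "Suc r \<notin> ?S" "Suc r \<notin> lines f n (Suc t)"
  proof -
    consider (a) "?l \<notin> {1..n}" | (b) "?l \<in> {1..r}" | (c) "?l = Suc r" | (d) "Suc r < ?l" "?l \<le> n"
      by fastforce
    then show thesis
    proof cases
      case a
      then have "?g = ?l" "?g' = ?l" using assms(4) by (auto simp: pg)
      moreover have "lines f n (Suc t) = ?S" using a by (rule lines_Suc_blank)
      ultimately show thesis using other a assms(3,4) by auto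
    next
      case b
      then have ln: "?l \<le> n" "?l \<in> {1..n}" "?l \<in> {1..Suc r}" "?l \<noteq> Suc r" using assms(4) by auto
      note bp = bumped_props[OF ln(1), where S="?S"]
      have S': "lines f n (Suc t) = (?S - {?z}) \<union> ({?l} - {1})" using ln(2) by (rule lines_Suc_letter)
      consider "?z \<le> r" | "?z = Suc r" | "Suc r < ?z" by linarith
      then show thesis
      proof cases
        case 1
        then have "?g = ?z - 1" "?g' = ?z - 1" using b ln(3) by (simp_all add: pg)
        then show thesis using other S' ln(4) 1 bp(1) by auto
      next
        case 2
        then have "?g = r" "?g' = r" using b ln(3) by (simp_all add: pg)
        moreover have "Suc r \<in> ?S" using bp(2) 2 assms(4) by auto
        ultimately show thesis using other S' ln(4) 2 by auto
      next
        case 3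
        then have "?g = r" "?g' = Suc r" using b ln(3) by (simp_all add: pg)
        moreover have "Suc r \<notin> ?S" using bp(4)[of "Suc r"] 3 b by auto
        ultimately show thesis using chg S' ln(4) by auto
      qed
    next
      case c
      then have "?l \<le> n" using assms(4) by simp
      note bp = bumped_props[OF this, where S="?S"]
      have "?g = Suc r" "?g' = Suc r" using c bp(1) by (auto simp: pg)
      then show thesis using arr by blast
    next
      case d
      note bp = bumped_props[OF d(2), where S="?S"]
      have "?g = ?l" "?g' = ?l" using d by (auto simp: pg)
      moreover have "lines f n (Suc t) = (?S - {?z}) \<union> ({?l} - {1})" using d by (intro lines_Suc_letter) auto
      ultimately show thesis using other d bp(1) by auto
    qed
  qed
  note cs = this
  let ?X = "insert (Suc r) (Y - {r})"
  let ?R = "up_run (peel f n (Suc r)) n k"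
  from run_read.IH obtain a' where
    "(?R t Y a' \<and> a \<le> a') \<or> (r \<in> Y \<and> Suc r \<notin> Y \<and> ?R t ?X a' \<and> a + of_bool (Suc r \<in> ?S) \<le> a')" by blast
  then show ?case
  proof
    assume A: "?R t Y a' \<and> a \<le> a'"
    then have A': "?R (Suc t) Y (a' + of_bool (?g' \<in> Y))" by (intro run.run_read) simp
    show ?thesis
    proof (cases "?g = r \<and> ?g' = Suc r \<and> r \<in> Y \<and> Suc r \<notin> Y")
      \<comment> \<open>A lone particle at \<open>r\<close> would miss the raised letter, so it
        steps up just before the reading.\<close>
      case True
      have "dominated Y ?X"
        unfolding dominated_def
      proof
        fix s show "card (Y \<inter> {s..}) \<le> card (?X \<inter> {s..})"
          using card_insert_diff_tail[of Y r "Suc r" s] fin True by (cases "s \<le> r"; cases "s = Suc r") auto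
      qed
      moreover have "?X \<subseteq> {1..n}" using fin assms(4) by auto
      moreover have "card ?X = k" using card_insert_diff[of Y r "Suc r"] True fin by simp
      ultimately have "?R t ?X a'" using up_move[of "peel f n (Suc r)" n k t Y a' ?X] A by blast
      then have R1: "?R (Suc t) ?X (a' + of_bool (?g' \<in> ?X))" by (rule run.run_read)
      have "Suc r \<notin> lines f n (Suc t)" using cs True by cases auto
      then have "a + of_bool (?g \<in> Y) + of_bool (Suc r \<in> lines f n (Suc t)) \<le> a' + of_bool (?g' \<in> ?X)"
        using True A by simp
      then show ?thesis
        using R1 True[THEN conjunct2, THEN conjunct2] by - (rule exI, rule disjI2, elim conjE, intro conjI)
    next
      case False
      have "of_bool (?g \<in> Y) \<le> (of_bool (?g' \<in> Y) :: nat)" using cs False by cases auto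
      then have "a + of_bool (?g \<in> Y) \<le> a' + of_bool (?g' \<in> Y)" using A by linarith
      then show ?thesis by (intro exI disjI1 conjI) (rule A')
    qed
  next
    assume A: "r \<in> Y \<and> Suc r \<notin> Y \<and> ?R t ?X a' \<and> a + of_bool (Suc r \<in> ?S) \<le> a'"
    then have A': "?R (Suc t) ?X (a' + of_bool (?g' \<in> ?X))" by (intro run.run_read) simp
    have "a + of_bool (?g \<in> Y) + of_bool (Suc r \<in> lines f n (Suc t)) \<le> a' + of_bool (?g' \<in> ?X)"
      using cs
    proof cases
      case other
      show ?thesis
      proof (cases "?g = r")
        case True
        then show ?thesis using other A by auto
      next
        case False
        then have "?g' \<in> ?X \<longleftrightarrow> ?g \<in> Y" using other by auto
        then show ?thesis using other A by (cases "Suc r \<in> ?S") auto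
      qed
    qed (use A in auto)
    then show ?thesis
      using A' A[THEN conjunct1] A[THEN conjunct2, THEN conjunct1] by - (rule exI, rule disjI2, intro conjI)
  qed
qed

section \<open>Runs on the peeled word\<close>

lemma peel_1: "1 \<le> n \<Longrightarrow> peel f n 1 = f"
proof
  fix u assume n: "1 \<le> n"
  have "f u = 1 \<Longrightarrow> \<not> bumped n (lines f n (u - 1)) (f u) \<le> 1"
    using bumped_props(1)[of "f u" n "lines f n (u - 1)"] n by simp
  then show "peel f n 1 u = f u" unfolding peel_def Let_def by auto
qed

lemma up_run_peeled:
  assumes "up_run f n k t Y a" "alternating f n M" "1 \<le> n"
  shows "\<exists>Y' a'. up_run (peeled f n) n k t Y' a' \<and> a \<le> a'"
proof -
  have "r \<le> n \<longrightarrow> (\<exists>Y' a'. up_run (peel f n r) n k t Y' a' \<and> a \<le> a')" if "1 \<le> r" for r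
    using that
  proof (induction r rule: nat_induct_at_least)
    case base
    show ?case unfolding peel_1[OF assms(3)] using assms(1) by (intro impI exI conjI) auto
  next
    case (Suc r)
    show ?case
    proof
      assume r: "Suc r \<le> n"
      then obtain Y' a' where R: "up_run (peel f n r) n k t Y' a'" "a \<le> a'" using Suc.IH by auto
      from up_run_peel_step[OF R(1) assms(2) Suc.hyps] r obtain Y'' a'' where
        "up_run (peel f n (Suc r)) n k t Y'' a''" "a' \<le> a''" by (auto simp: le_diff_conv2 split: if_splits dest: add_leD1)
      then show "\<exists>Y' a'. up_run (peel f n (Suc r)) n k t Y' a' \<and> a \<le> a'"
        using R(2) by (intro exI[of _ Y''] exI[of _ a''] conjI) (assumption, linarith)
    qed
  qed
  then show ?thesis using assms(3) by blast
qed

lemma card_tail_remove_Max: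
  fixes Y :: "nat set"
  assumes "finite Y" "Y \<noteq> {}"
  shows "card ((Y - {Max Y}) \<inter> {s..}) = card (Y \<inter> {s..}) - 1"
proof (cases "s \<le> Max Y")
  case True
  then have "Max Y \<in> Y \<inter> {s..}" using assms by simp
  moreover have "(Y - {Max Y}) \<inter> {s..} = Y \<inter> {s..} - {Max Y}" by auto
  ultimately show ?thesis by (simp add: assms(1))
next
  case False
  have "Y \<inter> {s..} = {}"
  proof (rule ccontr)
    assume "Y \<inter> {s..} \<noteq> {}"
    then obtain y where "y \<in> Y" "s \<le> y" by auto
    then show False using False Max_ge[OF assms(1) \<open>y \<in> Y\<close>] by linarith
  qed
  moreover then have "(Y - {Max Y}) \<inter> {s..} = {}" by blast
  ultimately show ?thesis by simp
qed

text \<open>The letters read by the top particle are paid for by the letters \<open>n\<close>, which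
  record that the row grows. The potential is the number of row letters above the top particle. A
  bumped letter read there lowers it by one, and a new letter joins this part of the row only by
  bumping a larger one or by lengthening the row. Moving the top particle up can only lower the
  potential.\<close>

lemma up_run_drop_Max:
  assumes "up_run (peeled f n) n k t Y a" "1 \<le> k"
  shows "\<exists>a'. up_run (peeled f n) (n - 1) (k - 1) t (Y - {Max Y}) a' \<and>
    a + card (lines f n t \<inter> {Suc (Max Y)..}) \<le> a' + cnt (peeled f n) {n} t"
  using assms(1)
proof (induction rule: run.induct)
  case (run_start Y)
  let ?U = "up_run (peeled f n) (n - 1) (k - 1)"
  from run_start have "finite Y" "Y \<noteq> {}" using assms(2) finite_subset[OF run_start(1)] by auto
  moreover have "y < n" if "y \<in> Y - {Max Y}" for y
  proof -
    have "y < Max Y" using that calculation by (simp add: order_less_le)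
    also have "Max Y \<le> n" using Max_in[OF \<open>finite Y\<close> \<open>Y \<noteq> {}\<close>] run_start(1) by auto
    finally show ?thesis .
  qed
  ultimately have "?U 0 (Y - {Max Y}) 0"
    using run_start by (intro run.run_start) (fastforce, simp)
  then show ?case by (intro exI conjI) auto
next
  case (run_move t Y a Y')
  let ?U = "up_run (peeled f n) (n - 1) (k - 1)"
  have fin: "finite Y" "finite Y'"
    using run_finite[OF run_move.hyps(1)] finite_subset[OF run_move.hyps(3)] by auto
  have ne: "Y \<noteq> {}" "Y' \<noteq> {}" using run_card[OF run_move.hyps(1)] run_move.hyps(4) assms(2) by auto
  have dom: "dominated Y Y'" by (rule run_move.hyps(2))
  from run_move.IH obtain a' where a': "?U t (Y - {Max Y}) a'"
    "a + card (lines f n t \<inter> {Suc (Max Y)..}) \<le> a' + cnt (peeled f n) {n} t" by auto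
  have "dominated (Y - {Max Y}) (Y' - {Max Y'})"
    using dom unfolding dominated_def card_tail_remove_Max[OF fin(1) ne(1)] card_tail_remove_Max[OF fin(2) ne(2)]
    using diff_le_mono by blast
  moreover have "y < n" "1 \<le> y" if "y \<in> Y' - {Max Y'}" for y
  proof -
    have "y < Max Y'" using that fin ne by (simp add: order_less_le)
    also have "Max Y' \<le> n" using Max_in[OF fin(2) ne(2)] run_move.hyps(3) by auto
    finally show "y < n" .
    show "1 \<le> y" using that run_move.hyps(3) by auto
  qed
  then have "Y' - {Max Y'} \<subseteq> {1..n - 1}" by fastforce
  moreover have "card (Y' - {Max Y'}) = k - 1" using run_move.hyps(4) fin ne by simp
  ultimately have 1: "?U t (Y' - {Max Y'}) a'"
    by (rule up_move[OF a'(1)])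
  have "Max Y \<le> Max Y'"
  proof -
    have "Max Y \<in> Y \<inter> {Max Y..}" using fin ne by simp
    then have "card (Y \<inter> {Max Y..}) \<noteq> 0" using fin by auto
    then have "card (Y' \<inter> {Max Y..}) \<noteq> 0" using dom unfolding dominated_def by (metis le_zero_eq)
    then obtain y where "y \<in> Y'" "Max Y \<le> y" by (metis IntE atLeast_iff card.empty ex_in_conv)
    then show ?thesis using Max_ge[OF fin(2) \<open>y \<in> Y'\<close>] by linarith
  qed
  then have "lines f n t \<inter> {Suc (Max Y')..} \<subseteq> lines f n t \<inter> {Suc (Max Y)..}" by auto
  then have "card (lines f n t \<inter> {Suc (Max Y')..}) \<le> card (lines f n t \<inter> {Suc (Max Y)..})"
    by (intro card_mono) (auto simp: lines_finite)
  then have "a + card (lines f n t \<inter> {Suc (Max Y')..}) \<le> a' + cnt (peeled f n) {n} t" using a'(2) by linarith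
  then show ?case using 1 by - (rule exI, rule conjI)
next
  case (run_read t Y a)
  let ?U = "up_run (peeled f n) (n - 1) (k - 1)"
  let ?S = "lines f n t" and ?c = "f (Suc t)" and ?y = "Max Y" and ?l = "peeled f n (Suc t)"
  let ?z = "bumped n ?S ?c"
  have fin: "finite Y" "Y \<noteq> {}" "Y \<subseteq> {1..n}"
    using run_finite[OF run_read.hyps(1)] run_subset[OF run_read.hyps(1)] run_card[OF run_read.hyps(1)] assms(2) by auto
  from run_read.IH obtain a' where a': "?U t (Y - {?y}) a'"
    "a + card (?S \<inter> {Suc ?y..}) \<le> a' + cnt (peeled f n) {n} t" by auto
  have R: "?U (Suc t) (Y - {?y}) (a' + of_bool (?l \<in> Y - {?y}))"
    by (rule run.run_read[OF a'(1)])
  have yY: "?y \<in> Y" "?y \<le> n" using fin Max_in[OF fin(1,2)] by auto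
  have key: "of_bool (?l \<in> Y) + card (lines f n (Suc t) \<inter> {Suc ?y..})
      \<le> of_bool (?l \<in> Y - {?y}) + of_bool (?l \<in> {n}) + card (?S \<inter> {Suc ?y..})"
  proof (cases "?c \<in> {1..n}")
    case False
    then have "?l = ?c" by (simp only: peeled_Suc if_False)
    then show ?thesis using False lines_Suc_blank[of f t n] fin(3) by auto
  next
    case True
    then have cn: "?c \<le> n" by simp
    note bp = bumped_props[OF cn, where S="?S"]
    have l: "?l = ?z - 1" using True by (simp only: peeled_Suc if_True)
    have f: "finite (?S \<inter> {Suc ?y..})" by (simp add: lines_finite)
    have S': "lines f n (Suc t) \<inter> {Suc ?y..} \<subseteq> (?S \<inter> {Suc ?y..} - {?z}) \<union> ({?c} \<inter> {Suc ?y..})"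
      using lines_Suc_letter[of f t n] True by auto
    have c1: "card (lines f n (Suc t) \<inter> {Suc ?y..}) \<le> card (?S \<inter> {Suc ?y..} - {?z}) + of_bool (Suc ?y \<le> ?c)"
    proof -
      have "card (lines f n (Suc t) \<inter> {Suc ?y..}) \<le> card ((?S \<inter> {Suc ?y..} - {?z}) \<union> ({?c} \<inter> {Suc ?y..}))"
        using S' f by (intro card_mono) auto
      also have "\<dots> \<le> card (?S \<inter> {Suc ?y..} - {?z}) + card ({?c} \<inter> {Suc ?y..})" by (rule card_Un_le)
      also have "card ({?c} \<inter> {Suc ?y..}) \<le> of_bool (Suc ?y \<le> ?c)" by auto
      finally show ?thesis by simp
    qed
    have c2: "card (?S \<inter> {Suc ?y..} - {?z}) + of_bool (?z \<in> ?S \<and> Suc ?y \<le> ?z) = card (?S \<inter> {Suc ?y..})"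
    proof (cases "?z \<in> ?S \<inter> {Suc ?y..}")
      case True
      then show ?thesis using card_Suc_Diff1[OF f True] by simp
    next
      case False
      then have "?S \<inter> {Suc ?y..} - {?z} = ?S \<inter> {Suc ?y..}" by blast
      then show ?thesis using False by simp
    qed
    consider (inS) "?z \<in> ?S" | (out) "?z = Suc n" using bp(2,3) by linarith
    then show ?thesis
    proof cases
      case inS
      show ?thesis
      proof (cases "?l = ?y")
        case True
        then have "?z = Suc ?y" using l bp(1) by linarith
        then have "\<not> Suc ?y \<le> ?c" "Suc ?y \<le> ?z" using bp(1) by linarith+
        then show ?thesis using c1 c2 inS yY(1) True by simp
      next
        case False
        then have "(of_bool (?l \<in> Y) :: nat) = of_bool (?l \<in> Y - {?y})" by simp
        moreover have "Suc ?y \<le> ?c \<Longrightarrow> Suc ?y \<le> ?z" using bp(1) by linarith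
        then have "of_bool (Suc ?y \<le> ?c) \<le> (of_bool (?z \<in> ?S \<and> Suc ?y \<le> ?z) :: nat)"
          using inS by (cases "Suc ?y \<le> ?c") simp_all
        ultimately show ?thesis using c1 c2 by linarith
      qed
    next
      case out
      then have ln: "?l = n" using l by simp
      show ?thesis
      proof (cases "?l = ?y")
        case True
        then have "\<not> Suc ?y \<le> ?c" using cn ln by linarith
        then show ?thesis using c1 c2 ln True by simp
      next
        case False
        then have "(of_bool (?l \<in> Y) :: nat) = of_bool (?l \<in> Y - {?y})" by simp
        moreover have "of_bool (Suc ?y \<le> ?c) \<le> (of_bool (?l \<in> {n}) :: nat)" using ln by simp
        ultimately show ?thesis using c1 c2 by linarith
      qed
    qed
  qed
  have "a + of_bool (?l \<in> Y) + card (lines f n (Suc t) \<inter> {Suc ?y..})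
      \<le> a' + of_bool (?l \<in> Y - {?y}) + cnt (peeled f n) {n} (Suc t)"
    using key a'(2) unfolding cnt.simps(2) by linarith
  then show ?case using R by - (rule exI, rule conjI)
qed

section \<open>Down-runs of the peeled word\<close>

lemma card_filter_swap:
  assumes "finite Z" "m \<notin> Z" "q \<notin> Z"
  shows "card {x \<in> insert q Z. P x} + of_bool (P m) = card {x \<in> insert m Z. P x} + of_bool (P q)"
proof -
  have "card {x \<in> insert p Z. P x} = card {x \<in> Z. P x} + of_bool (P p)" if "p \<notin> Z" for p
  proof -
    have "{x \<in> insert p Z. P x} = (if P p then insert p {x \<in> Z. P x} else {x \<in> Z. P x})" by auto
    then show ?thesis using assms(1) that by simp
  qed
  then show ?thesis using assms by simp
qed

lemma card_filter_update:
  assumes "finite X" "\<And>x. x \<noteq> \<alpha> \<Longrightarrow> x \<noteq> \<beta> \<Longrightarrow> P' x = P x" "\<alpha> \<noteq> \<beta>" "\<not> P' \<alpha>" "\<not> P \<beta>"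
  shows "card {x \<in> X. P' x} + of_bool (\<alpha> \<in> X \<and> P \<alpha>) = card {x \<in> X. P x} + of_bool (\<beta> \<in> X \<and> P' \<beta>)"
proof -
  let ?C = "{x \<in> X - {\<alpha>, \<beta>}. P x}"
  have "{x \<in> X. P' x} = (if \<beta> \<in> X \<and> P' \<beta> then insert \<beta> ?C else ?C)"
    using assms(2-4) by (auto; metis)
  moreover have "{x \<in> X. P x} = (if \<alpha> \<in> X \<and> P \<alpha> then insert \<alpha> ?C else ?C)"
    using assms(3,5) by auto
  moreover have "finite ?C" "\<alpha> \<notin> ?C" "\<beta> \<notin> ?C" using assms(1) by auto
  ultimately show ?thesis by simp
qed

lemma dominated_insert:
  assumes "finite Z" "p \<notin> Z" "q \<notin> Z" "q \<le> p"
  shows "dominated (insert q Z) (insert p Z)"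
  unfolding dominated_def
proof
  fix s
  have "card (insert x Z \<inter> {s..}) = card (Z \<inter> {s..}) + of_bool (s \<le> x)" if "x \<notin> Z" for x
  proof -
    have "insert x Z \<inter> {s..} = (if s \<le> x then insert x (Z \<inter> {s..}) else Z \<inter> {s..})" by auto
    then show ?thesis using assms(1) that by simp
  qed
  then show "card (insert q Z \<inter> {s..}) \<le> card (insert p Z \<inter> {s..})" using assms by simp
qed


text \<open>The potential argument for down-runs. The shadow \<open>X\<close> lags behind \<open>Y\<close> (shifted by one, as the peeled
  letters are lowered by one), and each particle of \<open>X\<close> waiting on a line is owed one letter. Letter 1 is never
  bumped, so particles resting at the sites \<open>1..j\<close> are settled: their shadows sit one site higher
  and have given up their claim once and for all.\<close>

definition shadows :: "(nat \<Rightarrow> nat) \<Rightarrow> nat \<Rightarrow> (nat \<Rightarrow> int) \<Rightarrow> nat \<Rightarrow> nat \<Rightarrow> nat set \<Rightarrow> nat \<Rightarrow> nat set \<Rightarrow> nat \<Rightarrow> nat \<Rightarrow> bool" where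
  "shadows f n M k t Y b X b' j \<longleftrightarrow>
     down_run (peeled f n) (n - 1) k t X b' \<and>
     (\<forall>s. card (Y \<inter> {Suc s..}) \<le> card (X \<inter> {s..})) \<and>
     {1..j} \<subseteq> X \<and> {1..j} \<subseteq> Y \<and>
     (\<forall>c. 1 \<le> c \<and> c \<le> j \<and> int (cnt f {Suc c} t) - int (cnt f {c} t) = M c \<longrightarrow> Suc c \<in> lines f n t) \<and>
     b \<le> b' + j + card {x \<in> X. j < x \<and> Suc x \<in> lines f n t}"

lemma shadowsI:
  assumes "down_run (peeled f n) (n - 1) k t X b'"
    and "\<And>s. card (Y \<inter> {Suc s..}) \<le> card (X \<inter> {s..})"
    and "{1..j} \<subseteq> X" "{1..j} \<subseteq> Y"
    and "\<And>c. 1 \<le> c \<Longrightarrow> c \<le> j \<Longrightarrow> int (cnt f {Suc c} t) - int (cnt f {c} t) = M c \<Longrightarrow> Suc c \<in> lines f n t"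
    and "b \<le> b' + j + card {x \<in> X. j < x \<and> Suc x \<in> lines f n t}"
  shows "shadows f n M k t Y b X b' j"
  unfolding shadows_def using assms(2-6) by (intro conjI assms(1)) auto

lemma shadows_start:
  assumes "Y \<subseteq> {1..n}" "card Y = k" "k < n"
  shows "\<exists>X. shadows f n M k 0 Y 0 X 0 0"
proof -
  \<comment> \<open>The shadow starts as high as possible; \<open>k < n\<close> makes room for
    \<open>k\<close> particles on the sites below \<open>n\<close>.\<close>
  let ?X = "{n - k..n - 1}"
  have X: "?X \<subseteq> {1..n - 1}" "card ?X = k" using assms(3) by auto
  have fY: "finite Y" by (rule finite_subset[OF assms(1)]) simp
  have "card (Y \<inter> {Suc s..}) \<le> card (?X \<inter> {s..})" for s
  proof -
    have "Y \<inter> {Suc s..} \<subseteq> {Suc s..n}" using assms(1) by auto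
    then have 1: "card (Y \<inter> {Suc s..}) \<le> n - s" using card_mono[of "{Suc s..n}"] by fastforce
    have 2: "card (Y \<inter> {Suc s..}) \<le> k" using card_mono[OF fY, of "Y \<inter> {Suc s..}"] assms(2) by simp
    have "?X \<inter> {s..} = {max s (n - k)..n - 1}" by auto
    then have "card (?X \<inter> {s..}) = Suc (n - 1) - max s (n - k)" by simp
    then show ?thesis using 1 2 assms(3) by linarith
  qed
  moreover have "down_run (peeled f n) (n - 1) k 0 ?X 0" using X by (rule run.run_start)
  ultimately have "shadows f n M k 0 Y 0 ?X 0 0" by (intro shadowsI) auto
  then show ?thesis by (rule exI)
qed

lemma dominated_initial_segment:
  assumes "dominated Y' Y" "finite Y" "finite Y'" "card Y' = card Y" "Y' \<subseteq> {1..n}" "Y \<subseteq> {1..n}" "{1..j} \<subseteq> Y"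
  shows "{1..j} \<subseteq> Y'"
proof -
  have split: "card Z = card (Z \<inter> {1..j}) + card (Z \<inter> {Suc j..})" if "finite Z" "Z \<subseteq> {1..n}" for Z
  proof -
    have "Z = (Z \<inter> {1..j}) \<union> (Z \<inter> {Suc j..})" using that(2) by fastforce
    moreover have "(Z \<inter> {1..j}) \<inter> (Z \<inter> {Suc j..}) = {}" by auto
    ultimately show ?thesis using card_Un_disjoint[of "Z \<inter> {1..j}" "Z \<inter> {Suc j..}"] that(1) by simp
  qed
  have "Y \<inter> {1..j} = {1..j}" using assms(7) by auto
  then have "card (Y \<inter> {1..j}) = j" by simp
  moreover have "card (Y' \<inter> {Suc j..}) \<le> card (Y \<inter> {Suc j..})" using assms(1) unfolding dominated_def by blast
  ultimately have "j \<le> card (Y' \<inter> {1..j})" using split[OF assms(2,6)] split[OF assms(3,5)] assms(4) by linarith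
  moreover have "card (Y' \<inter> {1..j}) \<le> card {1..j}" by (intro card_mono) auto
  ultimately have "card (Y' \<inter> {1..j}) = card {1..j}" by simp
  then have "Y' \<inter> {1..j} = {1..j}" by (intro card_subset_eq) auto
  then show ?thesis by auto
qed

text \<open>Moving \<open>Y\<close> down relaxes the tail condition, so the shadow can stay where it
  is; the particles on \<open>{1..j}\<close> have no lower place to go.\<close>

lemma shadows_move:
  assumes "shadows f n M k t Y b X b' j" "down_run f n k t Y b" "dominated Y' Y" "Y' \<subseteq> {1..n}" "card Y' = k"
  shows "shadows f n M k t Y' b X b' j"
proof -
  have "finite Y'" by (rule finite_subset[OF assms(4)]) simp
  then have "{1..j} \<subseteq> Y'"
    using dominated_initial_segment[OF assms(3) run_finite[OF assms(2)] _ _ assms(4) run_subset[OF assms(2)]]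
      run_card[OF assms(2)] assms(1,5) unfolding shadows_def by simp
  moreover have "card (Y' \<inter> {Suc s..}) \<le> card (X \<inter> {s..})" for s
  proof -
    have "card (Y' \<inter> {Suc s..}) \<le> card (Y \<inter> {Suc s..})" using assms(3) unfolding dominated_def by blast
    also have "\<dots> \<le> card (X \<inter> {s..})" using assms(1) unfolding shadows_def by blast
    finally show ?thesis .
  qed
  ultimately show ?thesis using assms(1) unfolding shadows_def by simp
qed

text \<open>When \<open>Y\<close> reads \<open>c\<close>, this letter enters the row. A shadow at
  \<open>c - 1\<close> then waits on a line, and this claim balances the score of \<open>Y\<close>;
  it is redeemed when \<open>c\<close> is bumped and the peeled letter \<open>c - 1\<close> is read.
  If \<open>c - 1\<close> carries no shadow, one is pulled down from above.\<close>

lemma shadows_read: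
  assumes sh: "shadows f n M k t Y b X b' j" and R: "down_run f n k t Y b"
    and alt: "alternating f n M" and kn: "k < n"
  shows "\<exists>X' b'' j'. shadows f n M k (Suc t) Y (b + of_bool (f (Suc t) \<in> Y)) X' b'' j'"
proof -
  let ?S = "lines f n t" and ?c = "f (Suc t)" and ?l = "peeled f n (Suc t)" and ?S' = "lines f n (Suc t)"
  let ?z = "bumped n ?S ?c"
  let ?C = "\<lambda>X j S. card {x \<in> X. j < x \<and> Suc x \<in> S}"
  let ?D = "down_run (peeled f n) (n - 1) k" and ?d = "\<lambda>c t. int (cnt f {Suc c} t) - int (cnt f {c} t)"
  let ?sh = "shadows f n M k (Suc t) Y (b + of_bool (?c \<in> Y))"
  have Y: "finite Y" "Y \<subseteq> {1..n}" "card Y = k" using run_finite[OF R] run_subset[OF R] run_card[OF R] by auto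
  from sh have RX: "?D t X b'"
    and tail: "\<And>s. card (Y \<inter> {Suc s..}) \<le> card (X \<inter> {s..})"
    and jX: "{1..j} \<subseteq> X" and jY: "{1..j} \<subseteq> Y"
    and J: "\<And>c. 1 \<le> c \<Longrightarrow> c \<le> j \<Longrightarrow> ?d c t = M c \<Longrightarrow> Suc c \<in> ?S"
    and le: "b \<le> b' + j + ?C X j ?S"
    unfolding shadows_def by blast+
  have X: "finite X" "X \<subseteq> {1..n - 1}" "card X = k" using run_finite[OF RX] run_subset[OF RX] run_card[OF RX] by auto
  have jk: "j \<le> k" using card_mono[OF X(1) jX] X(3) by simp
  show ?thesis
  proof (cases "?c \<in> {1..n}")
    case False
    have S': "?S' = ?S" using False by (rule lines_Suc_blank)
    have "?l = ?c" using False by (simp only: peeled_Suc if_False)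
    then have "?l \<notin> X" "?c \<notin> Y" using False X(2) Y(2) by auto
    then have R': "?D (Suc t) X b'" using run.run_read[OF RX] by simp
    have "Suc c \<in> ?S'" if "1 \<le> c" "c \<le> j" "?d c (Suc t) = M c" for c
    proof -
      have "?c \<noteq> c" "?c \<noteq> Suc c" using that False jk kn by auto
      then show ?thesis using J[OF that(1,2)] that(3) S' by simp
    qed
    then have "?sh X b' j"
      using R' tail jX jY le S' \<open>?c \<notin> Y\<close> by (intro shadowsI) auto
    then show ?thesis by (intro exI)
  next
    case cn: True
    then have c: "1 \<le> ?c" "?c \<le> n" by auto
    note bp = bumped_props[OF c(2), where S="?S"]
    have S': "?S' = (?S - {?z}) \<union> ({?c} - {1})" using cn by (rule lines_Suc_letter)
    have l: "?l = ?z - 1" using cn by (simp only: peeled_Suc if_True)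
    have cS: "?c \<notin> ?S" by (rule arrival_notin_lines[OF alt]) simp
    have upd: "card {x \<in> V. i < x \<and> Suc x \<in> ?S'} + of_bool (?z - 1 \<in> V \<and> i < ?z - 1 \<and> ?z \<in> ?S)
        = ?C V i ?S + of_bool (?c - 1 \<in> V \<and> i < ?c - 1)" if V: "finite V" for V i
    proof -
      have z1: "Suc (?z - 1) = ?z" using bp(1) by linarith
      have c1: "i < ?c - 1 \<Longrightarrow> Suc (?c - 1) = ?c \<and> ?c \<noteq> 1" by auto
      have "card {x \<in> V. i < x \<and> Suc x \<in> ?S'} + of_bool (?z - 1 \<in> V \<and> i < ?z - 1 \<and> Suc (?z - 1) \<in> ?S)
        = ?C V i ?S + of_bool (?c - 1 \<in> V \<and> i < ?c - 1 \<and> Suc (?c - 1) \<in> ?S')"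
      proof (rule card_filter_update[OF V])
        show "?z - 1 \<noteq> ?c - 1" using bp(1) c by linarith
        show "\<not> (i < ?z - 1 \<and> Suc (?z - 1) \<in> ?S')" unfolding S' z1 using bp(1) by auto
        show "\<not> (i < ?c - 1 \<and> Suc (?c - 1) \<in> ?S)" using cS c1 by auto
        show "(i < x \<and> Suc x \<in> ?S') = (i < x \<and> Suc x \<in> ?S)" if "x \<noteq> ?z - 1" "x \<noteq> ?c - 1" for x
          unfolding S' using that by auto
      qed
      moreover have "i < ?c - 1 \<Longrightarrow> Suc (?c - 1) \<in> ?S'" unfolding S' using c1 by auto
      ultimately show ?thesis unfolding z1 by (auto split: if_splits)
    qed
    have Jstep: "Suc c \<in> ?S'" if "1 \<le> c" "c \<le> j" "?d c (Suc t) = M c"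
      "?z \<noteq> Suc c" for c
    proof (cases "?c = Suc c")
      case True
      then show ?thesis unfolding S' using that(1) by auto
    next
      case False
      have "?c \<noteq> c"
      proof
        assume "?c = c"
        then have "?d c t = M c + 1" using that(3) by simp
        moreover have "c < n" using that(2) jk kn by linarith
        ultimately show False using alternatingD[OF alt that(1), of t] by linarith
      qed
      then have "Suc c \<in> ?S" using J[OF that(1,2)] that(3) False by simp
      then show ?thesis unfolding S' using that(4) by auto
    qed
    have RX': "?D (Suc t) X (b' + of_bool (?z - 1 \<in> X))"
      using run.run_read[OF RX] unfolding l .
    consider (settled) "?c \<le> j" | (unread) "j < ?c" "?c \<notin> Y \<or> (j + 2 \<le> ?c \<and> ?c - 1 \<in> X)"
      | (pull) "j < ?c" "?c \<in> Y" "?c = Suc j \<or> ?c - 1 \<notin> X" by linarith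
    then show ?thesis
    proof cases
      case settled
      have "?c < n" using settled jk kn by linarith
      \<comment> \<open>Reading \<open>?c\<close> lowers the difference, so it was at its upper
        value and \<open>Suc ?c\<close> is in the row. It is bumped, and the settled particle and
        its shadow both score.\<close>
      have "?d ?c (Suc t) = ?d ?c t - 1" by simp
      then have dM: "?d ?c t = M ?c"
        using alternatingD[OF alt c(1) \<open>?c < n\<close>, of t] alternatingD[OF alt c(1) \<open>?c < n\<close>, of "Suc t"] by linarith
      then have "Suc ?c \<in> ?S" using J[OF c(1) settled] by simp
      then have z: "?z = Suc ?c" using bp(1) bp(4)[of "Suc ?c"] by linarith
      then have "?z - 1 \<in> X" "?c \<in> Y" using settled jX jY c(1) by auto
      moreover have "\<not> j < ?c - 1" using settled by linarith
      then have "?C X j ?S' = ?C X j ?S" using upd[OF X(1), of j] z settled by simp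
      moreover have "Suc c \<in> ?S'" if "1 \<le> c" "c \<le> j" "?d c (Suc t) = M c" for c
      proof -
        have "c \<noteq> ?c" using that(3) dM by auto
        then show ?thesis using Jstep[OF that] z by auto
      qed
      ultimately have "?sh X (b' + of_bool (?z - 1 \<in> X)) j"
        using RX' tail jX jY le by (intro shadowsI) auto
      then show ?thesis by (intro exI)
    next
      case unread
      have zj: "j < ?z - 1" using unread(1) bp(1) by linarith
      have "b + of_bool (?c \<in> Y) \<le> b' + of_bool (?z - 1 \<in> X) + j + ?C X j ?S'"
      proof -
        have "?c \<in> Y \<Longrightarrow> ?c - 1 \<in> X \<and> j < ?c - 1" using unread(2) by linarith
        then have "of_bool (?c \<in> Y) \<le> (of_bool (?c - 1 \<in> X \<and> j < ?c - 1) :: nat)" by simp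
        moreover have "of_bool (?z - 1 \<in> X \<and> j < ?z - 1 \<and> ?z \<in> ?S) \<le> (of_bool (?z - 1 \<in> X) :: nat)" by simp
        ultimately show ?thesis using upd[OF X(1), of j] le by linarith
      qed
      then have "?sh X (b' + of_bool (?z - 1 \<in> X)) j"
        using tail jX jY Jstep zj by (intro shadowsI RX') auto
      then show ?thesis by (intro exI)
    next
      case pull
      \<comment> \<open>If \<open>?c = Suc j\<close>, the site below is 0 or belongs to the settled
        segment. The shadow then stops at \<open>?c\<close> itself and is settled from now
        on.\<close>
      define q where "q = (if ?c = Suc j then ?c else ?c - 1)"
      define j' where "j' = (if ?c = Suc j then Suc j else j)"
      have jjY: "{1..j'} \<subseteq> Y" using jY pull(2) unfolding j'_def by (auto simp: le_Suc_eq)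
      have j'k: "j' \<le> k" using card_mono[OF Y(1) jjY] Y(3) by simp
      have ne: "\<exists>x\<in>X. ?c \<le> x"
      proof (cases "?c = Suc j")
        case True
        then have "\<not> X \<subseteq> {1..j}" using card_mono[of "{1..j}" X] X(3) j'k unfolding j'_def by auto
        then show ?thesis using X(2) True by fastforce
      next
        case False
        then have n: "?c - 1 \<notin> X" using pull(3) by blast
        have "?c \<in> Y \<inter> {Suc (?c - 1)..}" using pull(2) c by auto
        then have "card (Y \<inter> {Suc (?c - 1)..}) \<noteq> 0" using Y(1) by auto
        then have "card (X \<inter> {?c - 1..}) \<noteq> 0" using tail[of "?c - 1"] by linarith
        then obtain x where "x \<in> X" "?c - 1 \<le> x" by (metis IntE atLeast_iff card.empty ex_in_conv)
        then show ?thesis using n by (intro bexI[of _ x]) (auto simp: le_less)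
      qed
      define m where "m = Min {x \<in> X. ?c \<le> x}"
      have "m \<in> {x \<in> X. ?c \<le> x}" unfolding m_def using ne X(1) by (intro Min_in) auto
      then have mp: "m \<in> X" "?c \<le> m" by auto
      have mmin: "m \<le> x" if "x \<in> X" "?c \<le> x" for x
        unfolding m_def using that X(1) by (intro Min_le) auto
      define Z where "Z = X - {m}"
      have Z: "finite Z" "m \<notin> Z" "X = insert m Z" "Z \<subseteq> {1..n - 1}" "Suc (card Z) = k"
        using X mp card_Suc_Diff1[OF X(1) mp(1)] unfolding Z_def by auto
      have Zm: "m < x" if "x \<in> Z" "?c \<le> x" for x
        using mmin[of x] that unfolding Z_def by auto
      have q: "q \<notin> Z" "q \<le> ?c" "1 \<le> q"
        using pull Zm[of ?c] mp(2) Z(3) c(1) unfolding q_def by (auto simp: not_less split: if_splits)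
      \<comment> \<open>If the site of the peeled letter lies between \<open>?c\<close> and
        \<open>m\<close>, the pulled shadow stops there for the reading; it goes on to
        \<open>q\<close> only afterwards.\<close>
      define p where "p = (if ?z \<le> m then ?z - 1 else m)"
      have p: "?c \<le> p" "p \<le> m" using bp(1) mp(2) unfolding p_def by auto
      have pZ: "p \<notin> Z" using Zm[of p] p by fastforce
      note p = p pZ
      have mn: "m \<le> n - 1" using mp(1) X(2) by auto
      \<comment> \<open>The shadow leaving \<open>m\<close> gives up its claim on the line
        \<open>Suc m\<close> without loss: if this line is present, then \<open>?z\<close> is at
        most \<open>Suc m\<close>, and the shadow reads the peeled letter at
        \<open>p\<close>.\<close>
      have key: "of_bool (Suc m \<in> ?S) + of_bool (?z - 1 \<in> Z \<and> ?z \<in> ?S) \<le> (of_bool (?z - 1 \<in> insert p Z) :: nat)"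
      proof -
        consider "?z \<le> m" | "?z = Suc m" | "Suc m < ?z" by linarith
        then show ?thesis
        proof cases
          case 1
          then have "?z - 1 = p" by (simp add: p_def)
          then show ?thesis using p(3) by simp
        next
          case 2
          then have "?z - 1 = p" by (simp add: p_def)
          then show ?thesis using p(3) by simp
        next
          case 3
          then have "Suc m \<notin> ?S" using bp(4)[of "Suc m"] mp(2) by auto
          then show ?thesis by simp
        qed
      qed
      have R1: "?D t (insert p Z) b'"
        using RX unfolding Z(3)
        by (rule down_move) (use dominated_insert[OF Z(1,2) p(3) p(2)] Z p mn c(1) in auto)
      have R2: "?D (Suc t) (insert p Z) (b' + of_bool (?z - 1 \<in> insert p Z))"
        using run.run_read[OF R1] unfolding l .
      have R3: "?D (Suc t) (insert q Z) (b' + of_bool (?z - 1 \<in> insert p Z))"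
        using R2 by (rule down_move) (use dominated_insert[OF Z(1) p(3) q(1)] Z p q mn c(1) in auto)
      have jZ: "{1..j} \<subseteq> Z" using jX pull(1) mp(2) unfolding Z_def by auto
      have jq: "{1..j'} \<subseteq> insert q Z" using jZ unfolding j'_def q_def by (auto simp: le_Suc_eq)
      have tz: "card (insert x Z \<inter> {s..}) = card (Z \<inter> {s..}) + of_bool (s \<le> x)" if "x \<notin> Z" for x s
      proof -
        have "insert x Z \<inter> {s..} = (if s \<le> x then insert x (Z \<inter> {s..}) else Z \<inter> {s..})" by auto
        then show ?thesis using Z(1) that by simp
      qed
      \<comment> \<open>Only the tails starting above \<open>q\<close> and up to \<open>m\<close>
        lose a shadow. Room for this comes from the settled sites, which are full on both sides, or
        from the particle of \<open>Y\<close> at \<open>?c\<close> together with the gap of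
        \<open>X\<close> at \<open>?c - 1\<close>.\<close>
      have tl: "card (Y \<inter> {Suc s..}) \<le> card (insert q Z \<inter> {s..})" for s
      proof (cases "q < s \<and> s \<le> m")
        case False
        then have "s \<le> q \<longleftrightarrow> s \<le> m" using q(2) p by linarith
        then have "card (insert q Z \<inter> {s..}) = card (X \<inter> {s..})" unfolding Z(3) using tz q(1) Z(2) by simp
        then show ?thesis using tail[of s] by simp
      next
        case True
        show ?thesis
        proof (cases "?c = Suc j")
          case C: True
          then have "Y \<inter> {Suc s..} \<subseteq> Y - {1..j'}" using True unfolding q_def j'_def by auto
          then have "card (Y \<inter> {Suc s..}) \<le> card (Y - {1..j'})" using Y(1) by (intro card_mono) auto
          also have "\<dots> = k - j'" using card_Diff_subset[OF _ jjY] Y(3) by simp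
          finally have 1: "card (Y \<inter> {Suc s..}) \<le> k - Suc j" using C unfolding j'_def by simp
          have "x \<in> {s..}" if "x \<in> Z - {1..j}" for x
          proof -
            have "?c \<le> x" using that C Z(4) by auto
            then show ?thesis using Zm[of x] that True by auto
          qed
          then have "Z - {1..j} \<subseteq> insert q Z \<inter> {s..}" by blast
          then have "card (Z - {1..j}) \<le> card (insert q Z \<inter> {s..})" using Z(1) by (intro card_mono) auto
          moreover have "card (Z - {1..j}) = card Z - j" using card_Diff_subset[OF _ jZ] by simp
          ultimately show ?thesis using 1 Z(5) by linarith
        next
          case C: False
          then have nc: "?c - 1 \<notin> X" using pull(3) by blast
          have sc: "?c \<le> s" using True C unfolding q_def by auto
          have "x \<in> {s..}" if "x \<in> X" "?c - 1 \<le> x" for x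
          proof -
            have "x \<noteq> ?c - 1" using nc that by blast
            then have "?c \<le> x" using that(2) by linarith
            then show ?thesis using mmin[OF that(1)] True by simp
          qed
          then have "X \<inter> {?c - 1..} \<subseteq> X \<inter> {s..}" by auto
          then have "card (X \<inter> {?c - 1..}) \<le> card (X \<inter> {s..})" using X(1) by (intro card_mono) auto
          moreover have "card (X \<inter> {s..}) = Suc (card (insert q Z \<inter> {s..}))"
            unfolding Z(3) using tz[OF Z(2), of s] tz[OF q(1), of s] True by simp
          moreover have "Suc (card (Y \<inter> {Suc s..})) \<le> card (Y \<inter> {Suc (?c - 1)..})"
          proof -
            have "insert ?c (Y \<inter> {Suc s..}) \<subseteq> Y \<inter> {Suc (?c - 1)..}" using pull(2) sc c(1) by auto
            then have "card (insert ?c (Y \<inter> {Suc s..})) \<le> card (Y \<inter> {Suc (?c - 1)..})" using Y(1) by (intro card_mono) auto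
            moreover have "?c \<notin> Y \<inter> {Suc s..}" using sc by auto
            ultimately show ?thesis using Y(1) by simp
          qed
          ultimately show ?thesis using tail[of "?c - 1"] by linarith
        qed
      qed
      have Jn: "Suc c \<in> ?S'" if h: "1 \<le> c" "c \<le> j'" "?d c (Suc t) = M c" for c
      proof (cases "c \<le> j")
        case True
        then show ?thesis using Jstep[OF h(1) _ h(3)] bp(1) pull(1) by auto
      next
        case False
        then have cc: "c = ?c" using h(2) unfolding j'_def by (auto split: if_splits)
        then have "?d c t = M c + 1" using h(3) by simp
        moreover have "c < n" using h(2) j'k kn by linarith
        ultimately show ?thesis using alternatingD[OF alt h(1), of t] by linarith
      qed
      have "b + 1 \<le> b' + of_bool (?z - 1 \<in> insert p Z) + j' + ?C (insert q Z) j' ?S'"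
      proof (cases "?c = Suc j")
        case True
        have e1: "{x \<in> insert q Z. j' < x \<and> Suc x \<in> ?S} = {x \<in> Z. j < x \<and> Suc x \<in> ?S}"
          using True Zm mp(2) unfolding q_def j'_def by (auto simp: Suc_le_eq[symmetric]) fastforce+
        have e2: "?C X j ?S = ?C Z j ?S + of_bool (Suc m \<in> ?S)"
        proof -
          have "{x \<in> X. j < x \<and> Suc x \<in> ?S} = (if Suc m \<in> ?S then insert m {x \<in> Z. j < x \<and> Suc x \<in> ?S} else {x \<in> Z. j < x \<and> Suc x \<in> ?S})"
            unfolding Z(3) using pull(1) mp(2) by auto
          then show ?thesis using Z(1,2) by simp
        qed
        have "?C (insert q Z) j' ?S' + of_bool (?z - 1 \<in> insert q Z \<and> j' < ?z - 1 \<and> ?z \<in> ?S) = ?C Z j ?S"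
          using upd[of "insert q Z" j'] Z(1) True unfolding e1 by (simp add: j'_def)
        moreover have "?z - 1 \<in> insert q Z \<and> j' < ?z - 1 \<and> ?z \<in> ?S \<Longrightarrow> ?z - 1 \<in> Z \<and> ?z \<in> ?S"
          using True unfolding q_def j'_def by auto
        ultimately have "?C Z j ?S \<le> ?C (insert q Z) j' ?S' + of_bool (?z - 1 \<in> Z \<and> ?z \<in> ?S)"
          by (cases "?z - 1 \<in> insert q Z \<and> j' < ?z - 1 \<and> ?z \<in> ?S") auto
        moreover have "j' = Suc j" using True by (simp add: j'_def)
        ultimately show ?thesis using key le e2 by linarith
      next
        case False
        have c2: "Suc (?c - 1) = ?c" "q = ?c - 1" "j' = j" "j < ?c - 1" using False pull(1) c(1) unfolding q_def j'_def by auto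
        have "?C (insert q Z) j ?S + of_bool (j < m \<and> Suc m \<in> ?S) = ?C X j ?S + of_bool (j < q \<and> Suc q \<in> ?S)"
          unfolding Z(3) by (rule card_filter_swap[OF Z(1,2) q(1)])
        then have s1: "?C (insert q Z) j ?S + of_bool (Suc m \<in> ?S) = ?C X j ?S"
          using c2 cS pull(1) mp(2) by (auto split: if_splits)
        have "?C (insert q Z) j' ?S' + of_bool (?z - 1 \<in> insert q Z \<and> j' < ?z - 1 \<and> ?z \<in> ?S) = ?C (insert q Z) j ?S + 1"
          using upd[of "insert q Z" j'] Z(1) c2 by simp
        moreover have "?z - 1 \<in> insert q Z \<and> j' < ?z - 1 \<and> ?z \<in> ?S \<Longrightarrow> ?z - 1 \<in> Z \<and> ?z \<in> ?S"
          using c2 bp(1) c(1) by auto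
        ultimately have "?C (insert q Z) j ?S + 1 \<le> ?C (insert q Z) j' ?S' + of_bool (?z - 1 \<in> Z \<and> ?z \<in> ?S)"
          by (cases "?z - 1 \<in> insert q Z \<and> j' < ?z - 1 \<and> ?z \<in> ?S") auto
        then show ?thesis using key le s1 c2(3) by linarith
      qed
      then have "?sh (insert q Z) (b' + of_bool (?z - 1 \<in> insert p Z)) j'"
        using tl jq jjY Jn pull(2) by (intro shadowsI R3) auto
      then show ?thesis by (intro exI)
    qed
  qed
qed

text \<open>In the end each shadow is settled or holds at most one claim, so the debt is at most
  \<open>k\<close>.\<close>

lemma down_run_peeled:
  assumes "down_run f n k t Y b" "alternating f n M" "k < n"
  shows "\<exists>X b'. down_run (peeled f n) (n - 1) k t X b' \<and> b \<le> b' + k"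
proof -
  have "\<exists>X b' j. shadows f n M k t Y b X b' j"
    using assms(1)
  proof (induction rule: run.induct)
    case (run_start Y)
    then show ?case using shadows_start[OF run_start assms(3)] by blast
  next
    case (run_move t Y a Y')
    from run_move.IH obtain X b' j where "shadows f n M k t Y a X b' j" by auto
    from shadows_move[OF this run_move.hyps(1,2,3,4)] show ?case by (intro exI)
  next
    case (run_read t Y a)
    from run_read.IH obtain X b' j where "shadows f n M k t Y a X b' j" by auto
    from shadows_read[OF this run_read.hyps(1) assms(2,3)] show ?case .
  qed
  then obtain X b' j where sh: "shadows f n M k t Y b X b' j" by auto
  then have R: "down_run (peeled f n) (n - 1) k t X b'" "{1..j} \<subseteq> X"
    and le: "b \<le> b' + j + card {x \<in> X. j < x \<and> Suc x \<in> lines f n t}" unfolding shadows_def by auto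
  have fX: "finite X" by (rule run_finite[OF R(1)])
  have "card {x \<in> X. j < x \<and> Suc x \<in> lines f n t} \<le> card (X - {1..j})" using fX by (intro card_mono) auto
  also have "\<dots> = k - j" using card_Diff_subset[OF _ R(2)] run_card[OF R(1)] by simp
  finally have "b \<le> b' + k" using le card_mono[OF fX R(2)] run_card[OF R(1)] by simp
  then show ?thesis using R(1) by (intro exI conjI)
qed

section \<open>The inequality between up-runs and down-runs\<close>

lemma cnt_bound_run: "run mv f {1..n} k t Y a \<Longrightarrow> a \<le> cnt f {1..n} t"
proof (induction rule: run.induct)
  case (run_read t Y a)
  then show ?case using run_subset[OF run_read.hyps] by (auto split: if_splits)
qed auto

text \<open>One peeling removes an up-particle at the price of the letters \<open>n\<close> of the
  peeled word, which are exactly the letters that the shorter alphabet no longer counts. It costs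
  the down-run at most \<open>k\<close>, so \<open>r\<close> rounds give \<open>r * k\<close>. The
  condition \<open>r + k \<le> n\<close> keeps \<open>k\<close> below the alphabet size in every
  round.\<close>

theorem up_down_bound:
  assumes "up_run f n r v Y a" "down_run f n k v Z b" "alternating f n M" "r + k \<le> n"
  shows "a + b \<le> cnt f {1..n} v + r * k"
  using assms
proof (induction r arbitrary: f n M Y a Z b)
  case 0
  have "a \<le> 0"
  proof -
    have "a = 0" using 0(1) 
    proof (induction rule: run.induct)
      case (run_read t Y a)
      then show ?case using run_card[OF run_read.hyps] run_finite[OF run_read.hyps] by simp
    qed auto
    then show ?thesis by simp
  qed
  then show ?case using cnt_bound_run[OF 0(2)] by simp
next
  case (Suc r)
  have n: "1 \<le> n" "k < n" using Suc.prems(4) by auto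
  obtain Y1 a1 where 1: "up_run (peeled f n) n (Suc r) v Y1 a1" "a \<le> a1"
    using up_run_peeled[OF Suc.prems(1,3) n(1)] by auto
  obtain a2 where 2: "up_run (peeled f n) (n - 1) r v (Y1 - {Max Y1}) a2" "a1 \<le> a2 + cnt (peeled f n) {n} v"
    using up_run_drop_Max[OF 1(1)] by auto
  obtain X b2 where 3: "down_run (peeled f n) (n - 1) k v X b2" "b \<le> b2 + k"
    using down_run_peeled[OF Suc.prems(2,3) n(2)] by auto
  have "a2 + b2 \<le> cnt (peeled f n) {1..n - 1} v + r * k"
    using Suc.IH[OF 2(1) 3(1) alternating_peeled[OF Suc.prems(3)]] Suc.prems(4) by simp
  then show ?case using 1(2) 2(2) 3(2) cnt_letters_peeled[OF n(1), of f v] by simp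
qed

section \<open>Crossings, relabelling and the word of residue classes\<close>

text \<open>A run for the new word may use \<open>q\<close> at site \<open>r\<close>. In the old word its particle is kept at \<open>Suc r\<close>
  instead, from the moment it became the only one on the two sites; the ladder condition pays for this.\<close>

lemma down_run_crossing_aux:
  assumes "down_run (W(q := r)) L k t Y a" and W: "W q = Suc r" and r: "1 \<le> r" "Suc r \<le> L" and q: "1 \<le> q"
    and ladder: "\<And>s. s < q \<Longrightarrow> cnt W {r} q + cnt W {Suc r} s < cnt W {Suc r} q + cnt W {r} s"
  shows "(t < q \<longrightarrow> down_run W L k t Y a \<and> (r \<in> Y \<and> Suc r \<notin> Y \<longrightarrow>
      (\<exists>a'. down_run W L k t (insert (Suc r) (Y - {r})) a' \<and>
        a + 1 + cnt W {r} q + cnt W {Suc r} t \<le> a' + cnt W {Suc r} q + cnt W {r} t)))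
    \<and> (q \<le> t \<longrightarrow> (\<exists>a'. down_run W L k t Y a' \<and> a \<le> a'))"
  \<comment> \<open>The score of the run with the detour may fall behind by the surplus of
    \<open>Suc r\<close> over \<open>r\<close> in the window from \<open>t\<close> to
    \<open>q\<close>, less one. The ladder condition makes this nonnegative at every start of a
    detour, and it is zero just before \<open>q\<close> is read.\<close>
  using assms(1)
proof (induction rule: run.induct)
  case (run_start Y)
  let ?D = "down_run W L k" and ?s = "cnt W {Suc r}" and ?r = "cnt W {r}"
  have R: "?D 0 Y 0" using run_start by (rule run.run_start)
  have "\<exists>a'. ?D 0 (insert (Suc r) (Y - {r})) a' \<and>
        0 + 1 + ?r q + ?s 0 \<le> a' + ?s q + ?r 0" if y: "r \<in> Y \<and> Suc r \<notin> Y"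
  proof -
    have "finite Y" by (rule finite_subset[OF run_start(1)]) simp
    then have "card (insert (Suc r) (Y - {r})) = k" using card_insert_diff[of Y r "Suc r"] y run_start(2) by simp
    then have "?D 0 (insert (Suc r) (Y - {r})) 0" using run_start r by (intro run.run_start) auto
    then show ?thesis using ladder[of 0] q by (intro exI[of _ 0] conjI) auto
  qed
  then show ?case using R q by (intro conjI impI) simp_all
next
  case (run_move t Y a Y')
  let ?D = "down_run W L k" and ?s = "cnt W {Suc r}" and ?r = "cnt W {r}"
  have fin: "finite Y" "finite Y'"
    using run_finite[OF run_move.hyps(1)] finite_subset[OF run_move.hyps(3)] by auto
  have dom: "dominated Y' Y" by (rule run_move.hyps(2))
  have domD: "card (Y' \<inter> {s..}) \<le> card (Y \<inter> {s..})" for s using dom unfolding dominated_def by blast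
  show ?case
  proof (intro conjI impI)
    assume t: "t < q"
    then have R: "?D t Y a" using run_move.IH by blast
    then show "?D t Y' a" using dom run_move.hyps(3,4) by (rule down_move)
    assume y: "r \<in> Y' \<and> Suc r \<notin> Y'"
    let ?X' = "insert (Suc r) (Y' - {r})" and ?X = "insert (Suc r) (Y - {r})"
    have X': "?X' \<subseteq> {1..L}" "card ?X' = k"
      using run_move.hyps(3,4) r card_insert_diff[of Y' r "Suc r"] y fin by auto
    show "\<exists>a'. ?D t ?X' a' \<and> a + 1 + ?r q + ?s t \<le> a' + ?s q + ?r t"
    proof (cases "r \<in> Y \<and> Suc r \<notin> Y")
      case True
      then obtain a' where a': "?D t ?X a'"
        "a + 1 + ?r q + ?s t \<le> a' + ?s q + ?r t"
        using run_move.IH t by blast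
      have "dominated ?X' ?X" using dominated_raise_raise[OF dom fin(2,1)] True y by blast
      from down_move[OF a'(1) this X'] a'(2) show ?thesis by (intro exI conjI)
    next
      case False
      then have "dominated ?X' Y" using dominated_raise[OF dom fin(2,1)] y by blast
      from down_move[OF R this X'] have "?D t ?X' a" .
      moreover have "a + 1 + ?r q + ?s t \<le> a + ?s q + ?r t"
        using ladder[OF t] by linarith
      ultimately show ?thesis by (intro exI conjI)
    qed
  next
    assume "q \<le> t"
    then obtain a' where "?D t Y a'" "a \<le> a'" using run_move.IH by blast
    from down_move[OF this(1) dom run_move.hyps(3,4)] this(2) show "\<exists>a'. ?D t Y' a' \<and> a \<le> a'"
      by (intro exI conjI)
  qed
next
  case (run_read t Y a)
  let ?D = "down_run W L k" and ?s = "cnt W {Suc r}" and ?r = "cnt W {r}"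
  let ?X = "insert (Suc r) (Y - {r})"
  have fin: "finite Y" "Y \<subseteq> {1..L}" "card Y = k"
    using run_finite[OF run_read.hyps(1)] run_subset[OF run_read.hyps(1)] run_card[OF run_read.hyps(1)] by auto
  let ?W' = "W(q := r)"
  consider (lt) "Suc t < q" | (eq) "Suc t = q" | (gt) "q < Suc t" by linarith
  then show ?case
  proof cases
    case lt
    then have w: "?W' (Suc t) = W (Suc t)" by simp
    have R: "?D t Y a" using run_read.IH lt by simp
    have "\<exists>a'. ?D (Suc t) ?X a' \<and>
        a + of_bool (?W' (Suc t) \<in> Y) + 1 + ?r q + ?s (Suc t) \<le> a' + ?s q + ?r (Suc t)"
      if y: "r \<in> Y \<and> Suc r \<notin> Y"
    proof -
      obtain a' where a': "?D t ?X a'"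
        "a + 1 + ?r q + ?s t \<le> a' + ?s q + ?r t"
        using run_read.IH lt y by (auto simp del: fun_upd_apply)
      have R': "?D (Suc t) ?X (a' + of_bool (W (Suc t) \<in> ?X))" by (rule run.run_read[OF a'(1)])
      have "of_bool (W (Suc t) \<in> Y) + of_bool (W (Suc t) \<in> {Suc r}) = (of_bool (W (Suc t) \<in> ?X) + of_bool (W (Suc t) \<in> {r}) :: nat)"
        using y by auto
      then have "a + of_bool (?W' (Suc t) \<in> Y) + 1 + ?r q + ?s (Suc t)
        \<le> (a' + of_bool (W (Suc t) \<in> ?X)) + ?s q + ?r (Suc t)"
        unfolding w cnt.simps(2) using a'(2) by linarith
      with R' show ?thesis by (intro exI conjI)
    qed
    moreover have "?D (Suc t) Y (a + of_bool (?W' (Suc t) \<in> Y))"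
      unfolding w by (rule run.run_read[OF R])
    ultimately show ?thesis using lt by simp
  next
    case eq
    then have w: "?W' (Suc t) = r" "W (Suc t) = Suc r" using W by auto
    have R: "?D t Y a" using run_read.IH eq by simp
    have "\<exists>a'. ?D (Suc t) Y a' \<and> a + of_bool (r \<in> Y) \<le> a'"
    proof (cases "r \<in> Y \<and> Suc r \<notin> Y")
      \<comment> \<open>The detour ends: the particle reads \<open>q\<close> at \<open>Suc r\<close>
        and then steps down to \<open>r\<close>.\<close>
      case True
      then obtain a' where a': "?D t ?X a'"
        "a + 1 + ?r q + ?s t \<le> a' + ?s q + ?r t"
        using run_read.IH eq by (auto simp del: fun_upd_apply)
      have R': "?D (Suc t) ?X (a' + of_bool (W (Suc t) \<in> ?X))" by (rule run.run_read[OF a'(1)])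
      have "dominated Y ?X" unfolding dominated_def
      proof
        fix s
        have "Y \<inter> {Suc r..} \<subseteq> Y \<inter> {r..}" by auto
        then have "card (Y \<inter> {Suc r..}) \<le> card (Y \<inter> {r..})" using fin(1) by (intro card_mono) auto
        then show "card (Y \<inter> {s..}) \<le> card (?X \<inter> {s..})"
          using card_tail_raise[of Y r s] True fin(1) by simp
      qed
      from down_move[OF R' this fin(2,3)] have "?D (Suc t) Y (a' + of_bool (W (Suc t) \<in> ?X))" .
      moreover have "?s q = Suc (?s t)" "?r q = ?r t" using eq w by auto
      then have "a + of_bool (r \<in> Y) \<le> a' + of_bool (W (Suc t) \<in> ?X)" using a'(2) True w by simp
      ultimately show ?thesis by (intro exI conjI)
    next
      case False
      then have "of_bool (r \<in> Y) \<le> (of_bool (W (Suc t) \<in> Y) :: nat)" using w by auto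
      then have "a + of_bool (r \<in> Y) \<le> a + of_bool (W (Suc t) \<in> Y)" by simp
      with run.run_read[OF R] show ?thesis by (intro exI conjI)
    qed
    then show ?thesis using eq w by simp
  next
    case gt
    then obtain a' where a': "?D t Y a'" "a \<le> a'" using run_read.IH by auto
    have "?W' (Suc t) = W (Suc t)" using gt by simp
    then have "a + of_bool (?W' (Suc t) \<in> Y) \<le> a' + of_bool (W (Suc t) \<in> Y)" using a'(2) by simp
    with run.run_read[OF a'(1)] have "\<exists>a'. ?D (Suc t) Y a' \<and> a + of_bool (?W' (Suc t) \<in> Y) \<le> a'"
      by (intro exI conjI)
    then show ?thesis using gt by simp
  qed
qed

lemma down_run_crossing:
  assumes "down_run (W(q := r)) L k t Y a" and "W q = Suc r" and "1 \<le> r" "Suc r \<le> L" and "1 \<le> q"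
    and "\<And>s. s < q \<Longrightarrow> cnt W {r} q + cnt W {Suc r} s < cnt W {Suc r} q + cnt W {r} s"
  shows "\<exists>a'. down_run W L k t Y a' \<and> a \<le> a'"
  using down_run_crossing_aux[OF assms] by (cases "t < q") (auto simp del: fun_upd_apply)

section \<open>Relabelling and reflecting the letters of a run\<close>

text \<open>\<open>X\<close> may use sites outside the range of \<open>c\<close>, so its particles
  cannot be renamed one by one. Instead \<open>Z\<close> starts at the top and is lowered only when
  a letter requires it. The tail condition, capped by the number of available sites, guarantees a
  particle that can be pulled down to each letter read by \<open>X\<close>.\<close>

lemma down_run_relabel:
  assumes "down_run (\<lambda>u. c (f u)) L k t X a" and k: "k \<le> n"
    and f: "\<And>u. 1 \<le> u \<Longrightarrow> f u \<in> {1..n}" and c: "\<And>i j. 1 \<le> i \<Longrightarrow> i < j \<Longrightarrow> j \<le> n \<Longrightarrow> c i < (c j :: nat)"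
  shows "\<exists>Z a'. down_run f n k t Z a' \<and> a \<le> a' \<and>
     (\<forall>s. 1 \<le> s \<and> s \<le> n \<longrightarrow> min (Suc n - s) (card (X \<inter> {c s..})) \<le> card (Z \<inter> {s..}))"
  using assms(1)
proof (induction rule: run.induct)
  case (run_start X)
  let ?Z = "{Suc n - k..n}"
  have fX: "finite X" by (rule finite_subset[OF run_start(1)]) simp
  have "down_run f n k 0 ?Z 0" using k by (intro run.run_start) auto
  moreover have "min (Suc n - s) (card (X \<inter> {c s..})) \<le> card (?Z \<inter> {s..})" if "1 \<le> s \<and> s \<le> n" for s
  proof -
    have "?Z \<inter> {s..} = {max s (Suc n - k)..n}" by auto
    then have "card (?Z \<inter> {s..}) = Suc n - max s (Suc n - k)" by simp
    moreover have "card (X \<inter> {c s..}) \<le> k" using card_mono[OF fX, of "X \<inter> {c s..}"] run_start(2) by simp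
    ultimately show ?thesis using that k by linarith
  qed
  ultimately show ?case by (intro exI[of _ ?Z] exI[of _ 0] conjI) auto
next
  case (run_move t X a X')
  then obtain Z a' where Z: "down_run f n k t Z a'" "a \<le> a'"
    "\<And>s. 1 \<le> s \<and> s \<le> n \<longrightarrow> min (Suc n - s) (card (X \<inter> {c s..})) \<le> card (Z \<inter> {s..})" by blast
  have "min (Suc n - s) (card (X' \<inter> {c s..})) \<le> card (Z \<inter> {s..})" if "1 \<le> s \<and> s \<le> n" for s
  proof -
    have "card (X' \<inter> {c s..}) \<le> card (X \<inter> {c s..})" using run_move.hyps(2) unfolding dominated_def by blast
    then show ?thesis using Z(3)[of s] that by linarith
  qed
  then show ?case using Z(1,2) by (intro exI[of _ Z] exI[of _ a'] conjI) auto
next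
  case (run_read t X a)
  then obtain Z a' where Z: "down_run f n k t Z a'" "a \<le> a'"
    "\<And>s. 1 \<le> s \<and> s \<le> n \<Longrightarrow> min (Suc n - s) (card (X \<inter> {c s..})) \<le> card (Z \<inter> {s..})" by blast
  have fX: "finite X" by (rule run_finite[OF run_read.hyps(1)])
  have fZ: "finite Z" "Z \<subseteq> {1..n}" "card Z = k" using run_finite[OF Z(1)] run_subset[OF Z(1)] run_card[OF Z(1)] by auto
  let ?i = "f (Suc t)"
  have i: "1 \<le> ?i" "?i \<le> n" using f[of "Suc t"] by auto
  show ?case
  proof (cases "c ?i \<in> X \<and> ?i \<notin> Z")
    case False
    then have "a + of_bool (c ?i \<in> X) \<le> a' + of_bool (?i \<in> Z)" using Z(2) by auto
    with run.run_read[OF Z(1)] Z(3) show ?thesis by (intro exI conjI) auto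
  next
    case True
    have "card (X \<inter> {c ?i..}) \<noteq> 0" using True fX by auto
    then have "1 \<le> card (Z \<inter> {?i..})" using Z(3)[of ?i] i by linarith
    then obtain z where "z \<in> Z" "?i \<le> z" by (metis IntE One_nat_def Suc_le_eq atLeast_iff card.empty ex_in_conv less_numeral_extra(3))
    then have ne: "{z \<in> Z. ?i < z} \<noteq> {}" using True by (auto simp: le_less)
    define m where "m = Min {z \<in> Z. ?i < z}"
    have "m \<in> {z \<in> Z. ?i < z}" unfolding m_def using ne fZ(1) by (intro Min_in) auto
    then have m: "m \<in> Z" "?i < m" by auto
    have mmin: "m \<le> z" if "z \<in> Z" "?i < z" for z unfolding m_def using that fZ(1) by (intro Min_le) auto
    let ?Z = "insert ?i (Z - {m})"
    have "dominated ?Z Z" using dominated_insert[of "Z - {m}" m ?i] fZ(1) m True by (simp add: insert_absorb)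
    moreover have "?Z \<subseteq> {1..n}" using fZ(2) i by auto
    moreover have "card ?Z = k" using card_insert_diff[OF fZ(1) m(1)] True fZ(3) by simp
    ultimately have "down_run f n k t ?Z a'" by (rule down_move[OF Z(1)])
    from run.run_read[OF this] have R: "down_run f n k (Suc t) ?Z (a' + 1)" by simp
    have "min (Suc n - s) (card (X \<inter> {c s..})) \<le> card (?Z \<inter> {s..})" if s: "1 \<le> s" "s \<le> n" for s
    proof -
      have e: "int (card (?Z \<inter> {s..})) = int (card (Z \<inter> {s..})) - of_bool (s \<le> m) + of_bool (s \<le> ?i)"
        using card_insert_diff_tail[OF fZ(1) m(1)] True by blast
      show ?thesis
      proof (cases "?i < s \<and> s \<le> m")
        case False
        then have "card (?Z \<inter> {s..}) = card (Z \<inter> {s..})" using e m(2) by auto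
        then show ?thesis using Z(3)[of s] s by simp
      next
        case T: True
        then have e': "Suc (card (?Z \<inter> {s..})) = card (Z \<inter> {s..})" using e by auto
        have "x \<in> {s..}" if "x \<in> Z" "?i \<le> x" for x
        proof -
          have "x \<noteq> ?i" using True that by blast
          then show ?thesis using mmin[of x] that T by auto
        qed
        then have "Z \<inter> {?i..} \<subseteq> Z \<inter> {s..}" by auto
        then have 1: "card (Z \<inter> {?i..}) \<le> card (Z \<inter> {s..})" using fZ(1) by (intro card_mono) auto
        have "c ?i < c s" using c[of ?i s] i s T by auto
        then have "insert (c ?i) (X \<inter> {c s..}) \<subseteq> X \<inter> {c ?i..}" "c ?i \<notin> X \<inter> {c s..}" using True by auto
        then have "Suc (card (X \<inter> {c s..})) \<le> card (X \<inter> {c ?i..})"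
          using card_mono[of "X \<inter> {c ?i..}" "insert (c ?i) (X \<inter> {c s..})"] fX by simp
        then show ?thesis using 1 e' Z(3)[of ?i] i s T by linarith
      qed
    qed
    moreover have "a + of_bool (c ?i \<in> X) \<le> a' + 1" using Z(2) by simp
    ultimately show ?thesis using R by (intro exI conjI) auto
  qed
qed

lemma inj_on_reflect: "Z \<subseteq> {1..n} \<Longrightarrow> inj_on (\<lambda>x. Suc n - x) Z"
proof (rule inj_onI)
  fix x y assume "Z \<subseteq> {1..n}" "x \<in> Z" "y \<in> Z" and e: "Suc n - x = Suc n - y"
  then have "x \<le> n" "y \<le> n" by auto
  then show "x = y" using e by linarith
qed

lemma reflect_subset: "Z \<subseteq> {1..n} \<Longrightarrow> (\<lambda>x. Suc n - x) ` Z \<subseteq> {1..n}"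
proof
  fix y assume Z: "Z \<subseteq> {1..n}" and "y \<in> (\<lambda>x. Suc n - x) ` Z"
  then obtain x where x: "x \<in> Z" "y = Suc n - x" by auto
  then have "1 \<le> x" "x \<le> n" "y = Suc n - x" using Z by auto
  then show "y \<in> {1..n}" by auto
qed

lemma card_reflect_tail:
  assumes "Z \<subseteq> {1..n}" "card Z = k" "s \<le> n"
  shows "card ((\<lambda>x. Suc n - x) ` Z \<inter> {s..}) + card (Z \<inter> {Suc (Suc n) - s..}) = k"
proof -
  have fZ: "finite Z" by (rule finite_subset[OF assms(1)]) simp
  have "(\<lambda>x. Suc n - x) ` Z \<inter> {s..} = (\<lambda>x. Suc n - x) ` (Z - {Suc (Suc n) - s..})"
  proof (rule set_eqI, rule iffI)
    fix y assume "y \<in> (\<lambda>x. Suc n - x) ` Z \<inter> {s..}"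
    then obtain x where x: "x \<in> Z" "y = Suc n - x" "s \<le> y" by auto
    then have "x \<le> n" using assms(1) by auto
    then have "x < Suc (Suc n) - s" using x(2,3) assms(3) by linarith
    then have "x \<notin> {Suc (Suc n) - s..}" by simp
    then show "y \<in> (\<lambda>x. Suc n - x) ` (Z - {Suc (Suc n) - s..})" using x by blast
  next
    fix y assume "y \<in> (\<lambda>x. Suc n - x) ` (Z - {Suc (Suc n) - s..})"
    then obtain x where x: "x \<in> Z" "y = Suc n - x" "\<not> Suc (Suc n) - s \<le> x" by auto
    then have "s \<le> y" by linarith
    then show "y \<in> (\<lambda>x. Suc n - x) ` Z \<inter> {s..}" using x by blast
  qed
  moreover have "inj_on (\<lambda>x. Suc n - x) (Z - {Suc (Suc n) - s..})" using assms(1) by (intro inj_on_reflect) auto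
  ultimately have "card ((\<lambda>x. Suc n - x) ` Z \<inter> {s..}) = card (Z - {Suc (Suc n) - s..})" by (simp add: card_image)
  moreover have "card (Z - {Suc (Suc n) - s..}) + card (Z \<inter> {Suc (Suc n) - s..}) = card Z"
    using card_Diff_subset_Int[of Z "{Suc (Suc n) - s..}"] card_mono[OF fZ, of "Z \<inter> {Suc (Suc n) - s..}"] fZ by simp
  ultimately show ?thesis using assms(2) by simp
qed

lemma up_run_reflect:
  assumes "down_run (\<lambda>u. Suc n - f u) n k t Z a" "\<And>u. 1 \<le> u \<Longrightarrow> f u \<in> {1..n}"
  shows "up_run f n k t ((\<lambda>x. Suc n - x) ` Z) a"
  using assms(1)
proof (induction rule: run.induct)
  case (run_start Z)
  have "inj_on (\<lambda>x. Suc n - x) Z" using run_start(1) by (rule inj_on_reflect)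
  then show ?case using run_start reflect_subset[OF run_start(1)] by (intro run.run_start) (auto simp: card_image)
next
  case (run_move t Z a Z')
  have "inj_on (\<lambda>x. Suc n - x) Z'" using run_move.hyps(3) by (rule inj_on_reflect)
  then have cZ': "card ((\<lambda>x. Suc n - x) ` Z') = k" using run_move.hyps(4) by (simp add: card_image)
  have "dominated ((\<lambda>x. Suc n - x) ` Z) ((\<lambda>x. Suc n - x) ` Z')"
    unfolding dominated_def
  proof
    fix s
    show "card ((\<lambda>x. Suc n - x) ` Z \<inter> {s..}) \<le> card ((\<lambda>x. Suc n - x) ` Z' \<inter> {s..})"
    proof (cases "s \<le> n")
      case True
      have "card (Z' \<inter> {Suc (Suc n) - s..}) \<le> card (Z \<inter> {Suc (Suc n) - s..})"
        using run_move.hyps(2) unfolding dominated_def by blast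
      then show ?thesis
        using card_reflect_tail[OF run_subset[OF run_move.hyps(1)] run_card[OF run_move.hyps(1)] True]
          card_reflect_tail[OF run_move.hyps(3,4) True] by linarith
    next
      case False
      then have "(\<lambda>x. Suc n - x) ` Z \<inter> {s..} = {}" using run_subset[OF run_move.hyps(1)] by fastforce
      then show ?thesis by simp
    qed
  qed
  then show ?case using reflect_subset[OF run_move.hyps(3)] cZ' by (rule up_move[OF run_move.IH])
next
  case (run_read t Z a)
  have "f (Suc t) \<in> (\<lambda>x. Suc n - x) ` Z \<longleftrightarrow> Suc n - f (Suc t) \<in> Z"
  proof -
    have fi: "f (Suc t) \<in> {1..n}" by (rule assms(2)) simp
    have "x = Suc n - f (Suc t)" if "x \<in> Z" "f (Suc t) = Suc n - x" for x
      using that run_subset[OF run_read.hyps(1)] by fastforce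
    moreover have "f (Suc t) = Suc n - (Suc n - f (Suc t))" using fi by auto
    ultimately show ?thesis by blast
  qed
  then show ?case using run.run_read[OF run_read.IH] by simp
qed


text \<open>The index of the diagonal box that receives \<open>u\<close>: the representative of
  \<open>u\<close> modulo \<open>n\<close> in \<open>{1..n}\<close> is the initial entry of this
  box.\<close>

definition cls :: "(nat \<Rightarrow> nat) \<Rightarrow> nat \<Rightarrow> nat \<Rightarrow> nat" where
  "cls w n u = inv w (Suc ((u - 1) mod n))"

context
  fixes w :: "nat \<Rightarrow> nat" and n :: nat
  assumes n1: "1 \<le> n" and w: "w permutes {1..n}"
begin

lemma w_cls: "w (cls w n u) = Suc ((u - 1) mod n)"
  unfolding cls_def using permutes_inverses(1)[OF w] .

lemma cls_in: "cls w n u \<in> {1..n}"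
proof -
  have "Suc ((u - 1) mod n) \<in> {1..n}" using n1 by (simp add: Suc_le_eq)
  then show ?thesis unfolding cls_def using permutes_in_image[OF permutes_inv[OF w]] by blast
qed

lemma cls_eq_iff: "1 \<le> j \<Longrightarrow> j \<le> n \<Longrightarrow> cls w n u = j \<longleftrightarrow> w j = Suc ((u - 1) mod n)"
  using w_cls permutes_inverses(2)[OF w] unfolding cls_def by metis

lemma w_in: "1 \<le> j \<Longrightarrow> j \<le> n \<Longrightarrow> 1 \<le> w j \<and> w j \<le> n"
  using permutes_in_image[OF w, of j] by auto

lemma cls_w: "1 \<le> j \<Longrightarrow> j \<le> n \<Longrightarrow> cls w n (w j) = j"
  using w_in[of j] by (subst cls_eq_iff) auto

lemma cls_add: "1 \<le> u \<Longrightarrow> cls w n (u + n) = cls w n u"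
  unfolding cls_def by (metis Nat.add_diff_assoc2 mod_add_self2)

lemma cls_same: 
  assumes "1 \<le> u" "1 \<le> v" "cls w n u = cls w n v" "u \<le> v"
  shows "\<exists>k. v = u + k * n"
proof -
  have "(u - 1) mod n = (v - 1) mod n" using w_cls[of u] w_cls[of v] assms(3) by simp
  then obtain k where "v - 1 = u - 1 + n * k" using assms(4) by (metis diff_le_mono mod_eq_nat1E)
  then show ?thesis using assms(1,2) by (intro exI[of _ k]) (simp add: mult.commute)
qed

text \<open>The letter \<open>j\<close> is read at the times \<open>w j\<close>,
  \<open>w j + n\<close>, \<open>w j + 2 * n\<close> and so on.\<close>

lemma cnt_cls:
  assumes "1 \<le> j" "j \<le> n"
  shows "cnt (cls w n) {j} t = (t + n - w j) div n"
proof (induction t)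
  case 0
  then show ?case using w_in[OF assms] n1 by simp
next
  case (Suc t)
  have wj: "1 \<le> w j" "w j \<le> n" using w_in[OF assms] by auto
  have e: "Suc t + n - w j = Suc (t + n - w j)" using wj by simp
  have "(Suc (t + n - w j)) mod n = 0 \<longleftrightarrow> w j = Suc (t mod n)"
  proof -
    have "int (Suc (t + n - w j)) = int (t mod n) + 1 - int (w j) + int n * (int (t div n) + 1)"
    proof -
      have "int t = int (t mod n) + int n * int (t div n)" by (metis mod_mult_div_eq of_nat_add of_nat_mult)
      then show ?thesis using wj by (simp add: of_nat_diff algebra_simps)
    qed
    then have "int (Suc (t + n - w j)) mod int n = (int (t mod n) + 1 - int (w j)) mod int n"
      by (simp only: mod_mult_self2)
    moreover have "(int (t mod n) + 1 - int (w j)) mod int n = 0 \<longleftrightarrow> int (t mod n) + 1 - int (w j) = 0"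
    proof
      assume "(int (t mod n) + 1 - int (w j)) mod int n = 0"
      then have d: "int n dvd (int (t mod n) + 1 - int (w j))" by (simp add: dvd_eq_mod_eq_0)
      have "t mod n < n" using n1 by simp
      then have "\<bar>int (t mod n) + 1 - int (w j)\<bar> < int n" using wj by linarith
      then show "int (t mod n) + 1 - int (w j) = 0" using d zdvd_not_zless zdvd_imp_le by (metis abs_of_nonneg dvd_abs_iff linorder_not_le abs_ge_zero zero_less_abs_iff)
    qed simp
    ultimately show ?thesis by (metis (no_types, lifting) add.commute eq_iff_diff_eq_0 of_nat_0_eq_iff of_nat_Suc of_nat_eq_iff zmod_int)
  qed
  then show ?case using Suc assms e cls_eq_iff[OF assms, of "Suc t"] by (simp add: div_Suc)
qed

text \<open>Each letter occurs once per period, so two letters alternate; the smaller of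
  \<open>w e\<close> and \<open>w (Suc e)\<close> decides which comes first, and thereby
  \<open>M e\<close>.\<close>

lemma alternating_cls: "\<exists>M. alternating (cls w n) n M"
proof -
  have "int (cnt (cls w n) {Suc e} t) - int (cnt (cls w n) {e} t)
      \<in> {(if w (Suc e) < w e then 1 else 0) - 1, (if w (Suc e) < w e then 1 else 0)}" if e: "1 \<le> e \<and> e < n" for e t
  proof -
    have a: "1 \<le> w e" "w e \<le> n" "1 \<le> w (Suc e)" "w (Suc e) \<le> n" using w_in[of e] w_in[of "Suc e"] e by auto
    have c: "cnt (cls w n) {Suc e} t = (t + n - w (Suc e)) div n" "cnt (cls w n) {e} t = (t + n - w e) div n"
      using cnt_cls e by auto
    have "(t + n - x) div n \<le> (t + n - y) div n \<and> (t + n - y) div n \<le> Suc ((t + n - x) div n)"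
      if "y \<le> x" "x \<le> n" for x y
    proof -
      have "(t + n - x) div n \<le> (t + n - y) div n" using that by (intro div_le_mono) auto
      moreover have "(t + n - y) div n \<le> (t + n - x + n) div n" using that by (intro div_le_mono) auto
      moreover have "(t + n - x + n) div n = Suc ((t + n - x) div n)"
        using n1 div_add_self2[of n "t + n - x"] by simp
      ultimately show ?thesis by simp
    qed
    from this[of "w (Suc e)" "w e"] this[of "w e" "w (Suc e)"] show ?thesis
      unfolding c using a by (cases "w (Suc e) < w e") auto
  qed
  then show ?thesis unfolding alternating_def by (intro exI[of _ "\<lambda>e. if w (Suc e) < w e then 1 else 0"]) blast
qed

end

lemma cnt_all: "(\<And>u. 1 \<le> u \<Longrightarrow> f u \<in> A) \<Longrightarrow> cnt f A t = t"
  by (induction t) auto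

lemma run_extend:
  assumes "run mv f A k t Y a" "t \<le> v"
  shows "\<exists>a'. run mv f A k v Y a' \<and> a' + cnt f Y t = a + cnt f Y v"
  using assms(2)
proof (induction v rule: dec_induct)
  case base
  show ?case using assms(1) by (intro exI[of _ a] conjI) auto
next
  case (step v)
  then obtain a' where "run mv f A k v Y a'" "a' + cnt f Y t = a + cnt f Y v" by blast
  with run.run_read[OF this(1)] show ?case by (intro exI conjI) (assumption, simp)
qed

lemma dominated_low:
  assumes "Y \<subseteq> {1..n}" "card Y = k"
  shows "dominated {1..k} Y"
  unfolding dominated_def
proof
  fix s
  have fY: "finite Y" by (rule finite_subset[OF assms(1)]) simp
  have "{1..k} \<inter> {s..} = {max 1 s..k}" by auto
  then have 1: "card ({1..k} \<inter> {s..}) = Suc k - max 1 s" by simp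
  have "Y - {s..} \<subseteq> {1..<s}" using assms(1) by auto
  then have "card (Y - {s..}) \<le> s - 1" using card_mono[of "{1..<s}" "Y - {s..}"] by simp
  moreover have "card (Y - {s..}) + card (Y \<inter> {s..}) = k"
    using card_Diff_subset_Int[of Y "{s..}"] card_mono[OF fY, of "Y \<inter> {s..}"] fY assms(2) by simp
  ultimately show "card ({1..k} \<inter> {s..}) \<le> card (Y \<inter> {s..})" using 1 by linarith
qed

lemma dominated_high:
  assumes "Y \<subseteq> {1..n}" "card Y = k"
  shows "dominated Y {Suc n - k..n}"
  unfolding dominated_def
proof
  fix s
  have fY: "finite Y" by (rule finite_subset[OF assms(1)]) simp
  have k: "k \<le> n" using card_mono[of "{1..n}" Y] assms by simp
  have "{Suc n - k..n} \<inter> {s..} = {max (Suc n - k) s..n}" by auto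
  then have 1: "card ({Suc n - k..n} \<inter> {s..}) = Suc n - max (Suc n - k) s" by simp
  have "Y \<inter> {s..} \<subseteq> {s..n}" using assms(1) by auto
  then have "card (Y \<inter> {s..}) \<le> Suc n - s" using card_mono[of "{s..n}" "Y \<inter> {s..}"] by simp
  moreover have "card (Y \<inter> {s..}) \<le> k" using card_mono[OF fY, of "Y \<inter> {s..}"] assms(2) by simp
  ultimately show "card (Y \<inter> {s..}) \<le> card ({Suc n - k..n} \<inter> {s..})" using 1 k by linarith
qed

text \<open>At the times \<open>t\<close> and \<open>t'\<close> the particles are moved for free to
  the top \<open>r\<close> and the bottom \<open>k\<close> letters, where they keep reading up to
  the common time \<open>v\<close>. This reduces two different times to one.\<close>

lemma row_column_bound:
  assumes n1: "1 \<le> n" and w: "w permutes {1..n}"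
    and rr: "\<And>i j. 1 \<le> i \<Longrightarrow> i < j \<Longrightarrow> j \<le> n \<Longrightarrow> rr j < (rr i :: nat)"
    and cc: "\<And>i j. 1 \<le> i \<Longrightarrow> i < j \<Longrightarrow> j \<le> n \<Longrightarrow> cc i < (cc j :: nat)"
    and RR: "down_run (\<lambda>u. rr (cls w n u)) L r t X a" and RC: "down_run (\<lambda>u. cc (cls w n u)) L' k t' Y b"
    and rk: "r + k \<le> n" and tv: "t \<le> v" "t' \<le> v"
  shows "a + cnt (cls w n) {Suc n - r..n} v + b + cnt (cls w n) {1..k} v
    \<le> v + r * k + cnt (cls w n) {Suc n - r..n} t + cnt (cls w n) {1..k} t'"
proof -
  let ?f = "cls w n"
  have fin: "\<And>u. 1 \<le> u \<Longrightarrow> ?f u \<in> {1..n}" using cls_in[OF n1 w] by blast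
  obtain M where alt: "alternating ?f n M" using alternating_cls[OF n1 w] by blast
  obtain Z b1 where b1: "down_run ?f n k t' Z b1" "b \<le> b1"
    using down_run_relabel[OF RC _ fin cc] rk by auto
  have "down_run ?f n k t' {1..k} b1"
    by (rule down_move[OF b1(1) dominated_low[OF run_subset[OF b1(1)] run_card[OF b1(1)]]]) (use rk in auto)
  from run_extend[OF this tv(2)] obtain b2 where b2: "down_run ?f n k v {1..k} b2"
    "b2 + cnt ?f {1..k} t' = b1 + cnt ?f {1..k} v" by auto
  \<comment> \<open>Row numbers decrease with the class index, so \<open>down_run_relabel\<close> is
    applied to the reflected index; reflecting back turns the down-run into an up-run.\<close>
  define g where "g = (\<lambda>u. Suc n - ?f u)"
  define rr' where "rr' = (\<lambda>i. rr (Suc n - i))"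
  have gin: "g u \<in> {1..n}" if "1 \<le> u" for u using fin[OF that] unfolding g_def by auto
  have "down_run (\<lambda>u. rr' (g u)) L r t X a"
  proof -
    have "rr' (g u) = rr (?f u)" for u
    proof -
      have "Suc n - (Suc n - ?f u) = ?f u" using cls_in[OF n1 w, of u] by auto
      then show ?thesis by (simp add: rr'_def g_def)
    qed
    then show ?thesis using RR by simp
  qed
  moreover have "rr' i < rr' j" if "1 \<le> i" "i < j" "j \<le> n" for i j
    unfolding rr'_def using that by (intro rr) auto
  ultimately obtain Z' a1 where a1: "down_run g n r t Z' a1" "a \<le> a1"
    using down_run_relabel[of rr' g L r t X a n] gin rk by auto
  have U: "up_run ?f n r t ((\<lambda>x. Suc n - x) ` Z') a1"
    using up_run_reflect[of n ?f r t Z' a1] a1(1) fin unfolding g_def by auto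
  have "up_run ?f n r t {Suc n - r..n} a1"
    by (rule up_move[OF U dominated_high[OF run_subset[OF U] run_card[OF U]]]) (use rk in auto)
  from run_extend[OF this tv(1)] obtain a2 where a2: "up_run ?f n r v {Suc n - r..n} a2"
    "a2 + cnt ?f {Suc n - r..n} t = a1 + cnt ?f {Suc n - r..n} v" by auto
  have "a2 + b2 \<le> cnt ?f {1..n} v + r * k" by (rule up_down_bound[OF a2(1) b2(1) alt rk])
  moreover have "cnt ?f {1..n} v = v" by (rule cnt_all[OF fin])
  ultimately show ?thesis using a1(2) a2(2) b1(2) b2(2) by linarith
qed

section \<open>A single step of a slide\<close>

definition increasing :: "filling \<Rightarrow> bool" where
  "increasing T \<longleftrightarrow>
     (\<forall>i j j' u u'. j < j' \<longrightarrow> T (i, j) = Some u \<longrightarrow> T (i, j') = Some u' \<longrightarrow> u < u') \<and>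
     (\<forall>i i' j u u'. i < i' \<longrightarrow> T (i, j) = Some u \<longrightarrow> T (i', j) = Some u' \<longrightarrow> u < u')"

definition entries_distinct :: "filling \<Rightarrow> bool" where
  "entries_distinct T \<longleftrightarrow> (\<forall>z z' u. T z = Some u \<longrightarrow> T z' = Some u \<longrightarrow> z = z')"

definition corner_of :: "box set \<Rightarrow> box \<Rightarrow> bool" where
  "corner_of lp z \<longleftrightarrow> z \<in> lp \<and> (fst z, Suc (snd z)) \<notin> lp \<and> (Suc (fst z), snd z) \<notin> lp"

definition northwest :: "box \<Rightarrow> box \<Rightarrow> bool" where
  "northwest x y \<longleftrightarrow> fst x \<le> fst y \<and> snd x \<le> snd y"

text \<open>A value \<open>u\<close> that has not been placed yet is regarded as stacked at the diagonal box \<open>bb u\<close> of its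
  residue class; refilling a diagonal box then leaves all positions unchanged.\<close>

definition posn :: "(nat \<Rightarrow> box) \<Rightarrow> filling \<Rightarrow> nat \<Rightarrow> box" where
  "posn bb T u = (if \<exists>z. T z = Some u then (THE z. T z = Some u) else bb u)"

text \<open>Compares the Greene numbers of two words. The final configuration is left free because
  only the score matters.\<close>

definition transfers :: "nat \<Rightarrow> (nat \<Rightarrow> nat) \<Rightarrow> (nat \<Rightarrow> nat) \<Rightarrow> bool" where
  "transfers L W W0 \<longleftrightarrow> (\<forall>k v Y a. down_run W L k v Y a \<longrightarrow> (\<exists>Y' a'. down_run W0 L k v Y' a' \<and> a \<le> a'))"

text \<open>The smaller entry in the same box is what keeps waiting values out of
  \<open>ladder\<close>: in the row of the hole it already exceeds the moving value.\<close>

definition ghosts :: "box set \<Rightarrow> filling \<Rightarrow> (nat \<Rightarrow> box) \<Rightarrow> bool" where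
  "ghosts lp T bb \<longleftrightarrow> (\<forall>u. 1 \<le> u \<longrightarrow> u \<notin> ran T \<longrightarrow> corner_of lp (bb u) \<and> (\<exists>u0<u. T (bb u) = Some u0))"

text \<open>State of a slide through \<open>T0\<close> with the hole at \<open>y\<close>; \<open>nu\<close> is the unfilled region without the initial
  hole.\<close>

definition sliding :: "box set \<Rightarrow> box set \<Rightarrow> filling \<Rightarrow> (nat \<Rightarrow> box) \<Rightarrow> nat \<Rightarrow> filling \<Rightarrow> box \<Rightarrow> bool" where
  "sliding lp nu T0 bb L T y \<longleftrightarrow>
     y \<in> lp \<and> y \<notin> nu \<and> dom T = lp - nu - {y} \<and> increasing T \<and> entries_distinct T \<and> ran T = ran T0 \<and>
     (\<forall>z. fst y + snd y < fst z + snd z \<longrightarrow> T z = T0 z) \<and>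
     (\<forall>z. corner_of lp z \<longrightarrow> z \<noteq> y \<longrightarrow> T z = T0 z) \<and>
     (T = T0 \<or> (\<exists>q. T0 y = Some q \<and> (\<forall>z u. T z = Some u \<longrightarrow>
        (fst z = fst y \<and> snd z < snd y \<or> snd z = snd y \<and> fst z < fst y) \<longrightarrow> u \<le> q))) \<and>
     (\<forall>z u. T z = Some u \<longrightarrow> (\<exists>z0. T0 z0 = Some u \<and> northwest z z0)) \<and>
     transfers L (fst \<circ> posn bb T) (fst \<circ> posn bb T0) \<and> transfers L (snd \<circ> posn bb T) (snd \<circ> posn bb T0)"

lemma slidingD:
  assumes "sliding lp nu T0 bb L T y"
  shows "y \<in> lp" "y \<notin> nu" "dom T = lp - nu - {y}" "increasing T" "entries_distinct T" "ran T = ran T0"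
    and "\<And>z. fst y + snd y < fst z + snd z \<Longrightarrow> T z = T0 z"
    and "\<And>z. corner_of lp z \<Longrightarrow> z \<noteq> y \<Longrightarrow> T z = T0 z"
    and "T = T0 \<or> (\<exists>q. T0 y = Some q \<and> (\<forall>z u. T z = Some u \<longrightarrow>
        (fst z = fst y \<and> snd z < snd y \<or> snd z = snd y \<and> fst z < fst y) \<longrightarrow> u \<le> q))"
    and "\<And>z u. T z = Some u \<Longrightarrow> \<exists>z0. T0 z0 = Some u \<and> northwest z z0"
    and "transfers L (fst \<circ> posn bb T) (fst \<circ> posn bb T0)" "transfers L (snd \<circ> posn bb T) (snd \<circ> posn bb T0)"
  using assms unfolding sliding_def by blast+

lemma young_diagramD:
  "young_diagram lam \<Longrightarrow> (i, j) \<in> lam \<Longrightarrow> 1 \<le> i' \<Longrightarrow> i' \<le> i \<Longrightarrow> 1 \<le> j' \<Longrightarrow> j' \<le> j \<Longrightarrow> (i', j') \<in> lam"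
  unfolding young_diagram_def by fastforce

lemma young_diagram_pos: "young_diagram lam \<Longrightarrow> (i, j) \<in> lam \<Longrightarrow> 1 \<le> i \<and> 1 \<le> j"
  unfolding young_diagram_def by fastforce

lemma increasing_update:
  assumes inc: "increasing T" and sub: "\<And>x u. V x = Some u \<Longrightarrow> x \<noteq> (i, k) \<Longrightarrow> T x = Some u" and q: "V (i, k) = Some q"
    and row: "\<And>j u. V (i, j) = Some u \<Longrightarrow> j < k \<Longrightarrow> u < q" "\<And>j u. V (i, j) = Some u \<Longrightarrow> k < j \<Longrightarrow> q < u"
    and col: "\<And>j u. V (j, k) = Some u \<Longrightarrow> j < i \<Longrightarrow> u < q" "\<And>j u. V (j, k) = Some u \<Longrightarrow> i < j \<Longrightarrow> q < u"
  shows "increasing V"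
  unfolding increasing_def
proof (intro conjI allI impI)
  fix a j j' u u' assume h: "j < j'" "V (a, j) = Some u" "V (a, j') = Some u'"
  consider "(a, j) = (i, k)" | "(a, j') = (i, k)" | "(a, j) \<noteq> (i, k)" "(a, j') \<noteq> (i, k)" by blast
  then show "u < u'"
  proof cases
    case 3
    then show ?thesis using inc h(1) sub[OF h(2)] sub[OF h(3)] unfolding increasing_def by blast
  qed (use h q row(2)[of j' u'] row(1)[of j u] in simp_all)
next
  fix a a' j u u' assume h: "a < a'" "V (a, j) = Some u" "V (a', j) = Some u'"
  consider "(a, j) = (i, k)" | "(a', j) = (i, k)" | "(a, j) \<noteq> (i, k)" "(a', j) \<noteq> (i, k)" by blast
  then show "u < u'"
  proof cases
    case 3
    then show ?thesis using inc h(1) sub[OF h(2)] sub[OF h(3)] unfolding increasing_def by blast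
  qed (use h q col(2)[of a' u'] col(1)[of a u] in simp_all)
qed

lemma posn_real:
  assumes "entries_distinct T" "T z = Some u"
  shows "posn bb T u = z"
proof -
  have "(THE z. T z = Some u) = z" using assms unfolding entries_distinct_def by (intro the_equality) blast+
  then show ?thesis unfolding posn_def using assms(2) by auto
qed

lemma posn_ghost: "u \<notin> ran T \<Longrightarrow> posn bb T u = bb u"
  unfolding posn_def ran_def by auto

lemma transfers_refl: "transfers L W W"
  unfolding transfers_def by blast

lemma transfers_trans: "transfers L W W1 \<Longrightarrow> transfers L W1 W2 \<Longrightarrow> transfers L W W2"
  unfolding transfers_def
proof (intro allI impI)
  fix k v Y a
  assume 1: "\<forall>k v Y a. down_run W L k v Y a \<longrightarrow> (\<exists>Y' a'. down_run W1 L k v Y' a' \<and> a \<le> a')"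
    and 2: "\<forall>k v Y a. down_run W1 L k v Y a \<longrightarrow> (\<exists>Y' a'. down_run W2 L k v Y' a' \<and> a \<le> a')"
    and "down_run W L k v Y a"
  then obtain Y1 a1 where a1: "down_run W1 L k v Y1 a1" "a \<le> a1" by blast
  then obtain Y2 a2 where "down_run W2 L k v Y2 a2" "a1 \<le> a2" using 2 by blast
  with a1(2) show "\<exists>Y' a'. down_run W2 L k v Y' a' \<and> a \<le> a'"
    by (intro exI[of _ Y2] exI[of _ a2] conjI) simp_all
qed

lemma cnt_card: "cnt f A t = card {u \<in> {1..t}. f u \<in> A}"
proof (induction t)
  case (Suc t)
  have "{u \<in> {1..Suc t}. f u \<in> A} = (if f (Suc t) \<in> A then insert (Suc t) {u \<in> {1..t}. f u \<in> A} else {u \<in> {1..t}. f u \<in> A})"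
    by (auto simp: le_Suc_eq)
  then show ?case using Suc by simp
qed simp

lemma cnt_split: "s \<le> t \<Longrightarrow> cnt f A t = cnt f A s + card {u \<in> {s<..t}. f u \<in> A}"
proof -
  assume "s \<le> t"
  then have "{u \<in> {1..t}. f u \<in> A} = {u \<in> {1..s}. f u \<in> A} \<union> {u \<in> {s<..t}. f u \<in> A}" by auto
  moreover have "{u \<in> {1..s}. f u \<in> A} \<inter> {u \<in> {s<..t}. f u \<in> A} = {}" by auto
  ultimately show ?thesis unfolding cnt_card by (simp add: card_Un_disjoint)
qed

text \<open>Sending each value of row \<open>r\<close> to the entry below it maps the part of row
  \<open>r\<close> in a window ending at \<open>q\<close> injectively into row \<open>Suc r\<close>,
  within the same window, and misses \<open>q\<close>. The hypothesis \<open>real\<close> rules out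
  waiting values, which have no entry of their own.\<close>

lemma ladder:
  fixes T :: filling
  assumes inv: "\<And>z u. T z = Some u \<Longrightarrow> p u = z"
    and real: "\<And>u. 1 \<le> u \<Longrightarrow> u \<le> q \<Longrightarrow> fst (p u) = r \<Longrightarrow> T (p u) = Some u"
    and Tq: "T (Suc r, c) = Some q"
    and below: "\<And>c' u. T (r, c') = Some u \<Longrightarrow> u \<le> q \<Longrightarrow> \<exists>u'. T (Suc r, c') = Some u' \<and> u < u' \<and> u' < q"
    and s: "s < q"
  shows "cnt (fst \<circ> p) {r} q + cnt (fst \<circ> p) {Suc r} s < cnt (fst \<circ> p) {Suc r} q + cnt (fst \<circ> p) {r} s"
proof -
  let ?A = "{u \<in> {s<..q}. (fst \<circ> p) u \<in> {r}}" and ?B = "{u \<in> {s<..q}. (fst \<circ> p) u \<in> {Suc r}}"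
  define g where "g u = the (T (Suc r, snd (p u)))" for u
  have g: "T (Suc r, snd (p u)) = Some (g u) \<and> u < g u \<and> g u < q" if "u \<in> ?A" for u
  proof -
    have "T (p u) = Some u" using real[of u] that by auto
    moreover have "p u = (r, snd (p u))" using that by (cases "p u") auto
    ultimately have "T (r, snd (p u)) = Some u" by metis
    moreover have "u \<le> q" using that by simp
    ultimately obtain u' where "T (Suc r, snd (p u)) = Some u'" "u < u'" "u' < q"
      using below[of "snd (p u)" u] by blast
    then show ?thesis unfolding g_def by simp
  qed
  have "inj_on g ?A"
  proof (rule inj_onI)
    fix u v assume uv: "u \<in> ?A" "v \<in> ?A" "g u = g v"
    then have "(Suc r, snd (p u)) = (Suc r, snd (p v))" using g[OF uv(1)] g[OF uv(2)] inv by metis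
    moreover have "fst (p u) = fst (p v)" using uv by auto
    ultimately have e: "p u = p v" by (intro prod_eqI) simp_all
    have "T (p u) = Some u" using real[of u] uv(1) by simp
    moreover have "T (p v) = Some v" using real[of v] uv(2) by simp
    ultimately show "u = v" unfolding e by simp
  qed
  moreover have "g ` ?A \<subseteq> ?B - {q}"
  proof
    fix y assume "y \<in> g ` ?A"
    then obtain u where u: "u \<in> ?A" "y = g u" by blast
    from g[OF u(1)] have "p (g u) = (Suc r, snd (p u))" "u < g u" "g u < q" using inv by auto
    then show "y \<in> ?B - {q}" using u by auto
  qed
  ultimately have "card ?A \<le> card (?B - {q})" by (intro card_inj_on_le) auto
  moreover have "q \<in> ?B" using inv[OF Tq] s by simp
  then have "card (?B - {q}) < card ?B" by (intro card_Diff1_less) auto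
  ultimately show ?thesis using cnt_split[of s q "fst \<circ> p"] s by simp
qed

text \<open>Only \<open>q\<close> changes its row, from \<open>Suc r\<close> to \<open>r\<close>,
  and no value changes its column. So the row word undergoes one crossing and the column word is
  unchanged. The ladder condition comes from the shape: left of the hole, entries of row
  \<open>r\<close> lie above entries smaller than \<open>q\<close>; right of it, they exceed
  \<open>q\<close>.\<close>

lemma sliding_step_below:
  assumes st: "sliding lp nu T0 bb L T (r, c)" and lp: "young_diagram lp" "lp \<subseteq> {1..L} \<times> {1..L}"
    and nu: "young_diagram nu" and gh: "ghosts lp T0 bb" and pos: "0 \<notin> ran T0"
    and q: "T (Suc r, c) = Some q" and rt: "\<And>p. T (r, Suc c) = Some p \<Longrightarrow> q < p"
  shows "sliding lp nu T0 bb L (T((r, c) := Some q, (Suc r, c) := None)) (Suc r, c)"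
proof -
  let ?y = "(r, c)" and ?z = "(Suc r, c)"
  let ?T = "T(?y := Some q, ?z := None)"
  note st = slidingD[OF st, unfolded fst_conv snd_conv]
  note y = st(1,2) and dT = st(3) and inc = st(4) and dis = st(5) and ranT = st(6) and far = st(7)
    and cor = st(8) and nw = st(10) and trr = st(11) and trc = st(12)
  have row: "\<And>i j j' u u'. j < j' \<Longrightarrow> T (i, j) = Some u \<Longrightarrow> T (i, j') = Some u' \<Longrightarrow> u < u'"
    and col: "\<And>i i' j u u'. i < i' \<Longrightarrow> T (i, j) = Some u \<Longrightarrow> T (i', j) = Some u' \<Longrightarrow> u < u'"
    using inc unfolding increasing_def by blast+
  have Ty: "T ?y = None" using dT by (metis DiffE domIff insertI1)
  have z: "?z \<in> lp" "?z \<notin> nu" using dT q by blast+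
  have rc: "1 \<le> r" "1 \<le> c" using young_diagram_pos[OF lp(1) y(1)] by auto
  have filled: "\<exists>u. T x = Some u" if "x \<in> lp" "x \<notin> nu" "x \<noteq> ?y" for x
  proof -
    have "x \<in> dom T" using dT that by blast
    then show ?thesis by blast
  qed
  have left: "\<exists>u'. T (Suc r, c') = Some u' \<and> u < u' \<and> u' < q" if "T (r, c') = Some u" "c' < c" for c' u
  proof -
    have i: "(r, c') \<in> lp" "(r, c') \<notin> nu" using dT that(1) by blast+
    have c1: "1 \<le> c'" using young_diagram_pos[OF lp(1) i(1)] by simp
    have "(Suc r, c') \<in> lp" using young_diagramD[OF lp(1) z(1), of "Suc r" c'] c1 that(2) by simp
    moreover have "(Suc r, c') \<notin> nu" using young_diagramD[OF nu, of "Suc r" c' r c'] i(2) c1 rc by auto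
    ultimately obtain u' where u': "T (Suc r, c') = Some u'" using filled[of "(Suc r, c')"] by auto
    then show ?thesis using col[OF _ that(1) u'] row[OF that(2) u' q] by auto
  qed
  have right: "q < u" if "T (r, c') = Some u" "c < c'" for c' u
  proof (cases "c' = Suc c")
    case True
    then show ?thesis using rt that by blast
  next
    case False
    have "(r, c') \<in> lp" using dT that(1) by blast
    then have "(r, Suc c) \<in> lp" using young_diagramD[OF lp(1), of r c' r "Suc c"] that(2) rc by simp
    moreover have "(r, Suc c) \<notin> nu" using young_diagramD[OF nu, of r "Suc c" r c] y(2) rc by auto
    ultimately obtain p where p: "T (r, Suc c) = Some p" using filled[of "(r, Suc c)"] by auto
    then show ?thesis using rt[OF p] row[OF _ p that(1)] that(2) False by fastforce
  qed
  have T1: "?T x = Some u \<longleftrightarrow> (if x = ?y then u = q else x \<noteq> ?z \<and> T x = Some u)" for x u by auto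
  have dom1: "dom ?T = lp - nu - {?z}" using dT y z by auto
  have inc1: "increasing ?T"
  proof (rule increasing_update[OF inc])
    show "T x = Some u" if "?T x = Some u" "x \<noteq> ?y" for x u using that unfolding T1 by simp
    show "?T ?y = Some q" by simp
    show "u < q" if "?T (r, j) = Some u" "j < c" for j u using that left[of j u] unfolding T1 by auto
    show "q < u" if "?T (r, j) = Some u" "c < j" for j u using that right[of j u] unfolding T1 by auto
    show "u < q" if "?T (j, c) = Some u" "j < r" for j u using that col[OF _ _ q, of j u] unfolding T1 by auto
    show "q < u" if "?T (j, c) = Some u" "r < j" for j u using that col[OF _ q, of j u] unfolding T1 by auto
  qed
  have dis1: "entries_distinct ?T"
    using dis q unfolding entries_distinct_def T1 by (metis (full_types))
  have ran1: "ran ?T = ran T0"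
  proof -
    have "u \<in> ran ?T \<longleftrightarrow> u \<in> ran T" for u
    proof
      assume "u \<in> ran ?T"
      then obtain x where "?T x = Some u" unfolding ran_def by blast
      then show "u \<in> ran T" using q unfolding T1 ran_def by (auto split: if_splits)
    next
      assume "u \<in> ran T"
      then obtain x where x: "T x = Some u" unfolding ran_def by blast
      then have "x \<noteq> ?y" using Ty by auto
      then have "?T (if x = ?z then ?y else x) = Some u" using x q by auto
      then show "u \<in> ran ?T" unfolding ran_def by blast
    qed
    then show ?thesis using ranT by blast
  qed
  have q0: "T0 ?z = Some q" using far[of ?z] q by simp
  have nc: "\<not> corner_of lp ?y" unfolding corner_of_def using z(1) by simp
  have posn1: "posn bb ?T u = (if u = q then ?y else posn bb T u)" for u
  proof (cases "u \<in> ran T")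
    case False
    then have "u \<notin> ran ?T" "u \<noteq> q" using ran1 ranT q unfolding ran_def by blast+
    then show ?thesis using posn_ghost[of u T bb] posn_ghost[of u ?T bb] False by simp
  next
    case True
    then obtain x where x: "T x = Some u" unfolding ran_def by blast
    show ?thesis
    proof (cases "u = q")
      case True
      then show ?thesis using posn_real[OF dis1, of ?y q bb] by simp
    next
      case F: False
      then have "x \<noteq> ?z" "x \<noteq> ?y" using x q Ty by auto
      then have "?T x = Some u" using x by simp
      then show ?thesis using posn_real[OF dis1, of x u bb] posn_real[OF dis x, of bb] F by simp
    qed
  qed
  have q1: "1 \<le> q"
  proof -
    have "q \<noteq> 0" using q pos ranT unfolding ran_def by force
    then show ?thesis by simp
  qed
  have pq: "posn bb T q = ?z" by (rule posn_real[OF dis q])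
  have real: "T (posn bb T u) = Some u" if u: "1 \<le> u" "u \<le> q" "fst (posn bb T u) = r" for u
  proof (cases "u \<in> ran T")
    case True
    then obtain x where x: "T x = Some u" unfolding ran_def by blast
    then show ?thesis using posn_real[OF dis x, of bb] by simp
  next
    \<comment> \<open>A waiting value in row \<open>r\<close> sits at a corner of \<open>lp\<close>,
      hence to the right of the hole. The entry of that box is smaller than it, yet exceeds
      \<open>q\<close>.\<close>
    case False
    then have pb: "posn bb T u = bb u" by (rule posn_ghost)
    obtain u0 where u0: "corner_of lp (bb u)" "u0 < u" "T0 (bb u) = Some u0"
      using gh u(1) False ranT unfolding ghosts_def by blast
    obtain c' where c': "bb u = (r, c')" using u(3) pb by (cases "bb u") auto
    have lpb: "(r, c') \<in> lp" "(r, Suc c') \<notin> lp" using u0(1) c' unfolding corner_of_def by auto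
    have ny: "bb u \<noteq> ?y" using nc u0(1) by auto
    have "\<not> c' < c" using young_diagramD[OF lp(1) y(1), of r "Suc c'"] lpb(2) rc by auto
    then have "c < c'" using ny c' by auto
    moreover have "T (r, c') = Some u0" using cor[OF u0(1) ny] u0(3) c' by simp
    ultimately have "q < u0" using right by blast
    then show ?thesis using u0(2) u(2) by linarith
  qed
  have tr1: "transfers L (fst \<circ> posn bb ?T) (fst \<circ> posn bb T)"
    unfolding transfers_def
  proof (intro allI impI)
    fix k v Y a
    assume R: "down_run (fst \<circ> posn bb ?T) L k v Y a"
    have "fst \<circ> posn bb ?T = (fst \<circ> posn bb T)(q := r)" using posn1 by (auto simp: fun_eq_iff)
    then have R': "down_run ((fst \<circ> posn bb T)(q := r)) L k v Y a" using R by simp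
    have "(fst \<circ> posn bb T) q = Suc r" using pq by simp
    moreover have "Suc r \<le> L" using z(1) lp(2) by auto
    moreover have "cnt (fst \<circ> posn bb T) {r} q + cnt (fst \<circ> posn bb T) {Suc r} s
        < cnt (fst \<circ> posn bb T) {Suc r} q + cnt (fst \<circ> posn bb T) {r} s" if "s < q" for s
    proof (rule ladder[OF posn_real[OF dis] real q _ that])
      fix c' u assume 1: "T (r, c') = Some u" "u \<le> q"
      have "c' \<noteq> c" using 1 Ty by auto
      then have "c' < c" using right[OF 1(1)] 1(2) by fastforce
      then show "\<exists>u'. T (Suc r, c') = Some u' \<and> u < u' \<and> u' < q" using left[OF 1(1)] by blast
    qed auto
    ultimately show "\<exists>Y' a'. down_run (fst \<circ> posn bb T) L k v Y' a' \<and> a \<le> a'"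
      using down_run_crossing[OF R' _ rc(1) _ q1] by blast
  qed
  have tc1: "snd \<circ> posn bb ?T = snd \<circ> posn bb T" using posn1 pq by (auto simp: fun_eq_iff)
  show ?thesis
    unfolding sliding_def
  proof (intro conjI)
    \<comment> \<open>This clause prepares the refill: if the slide ends here, \<open>q + n\<close>
      must exceed everything to the left and above.\<close>
    show "?T = T0 \<or> (\<exists>q. T0 ?z = Some q \<and> (\<forall>x u. ?T x = Some u \<longrightarrow>
        (fst x = fst ?z \<and> snd x < snd ?z \<or> snd x = snd ?z \<and> fst x < fst ?z) \<longrightarrow> u \<le> q))"
    proof (rule disjI2, intro exI conjI allI impI)
      show "T0 ?z = Some q" by (rule q0)
      fix x u assume x: "?T x = Some u" "fst x = fst ?z \<and> snd x < snd ?z \<or> snd x = snd ?z \<and> fst x < fst ?z"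
      obtain i j where ij: "x = (i, j)" by (cases x)
      show "u \<le> q"
      proof (cases "x = ?y")
        case True then show ?thesis using x(1) by simp
      next
        case False
        then have "T (i, j) = Some u" using x(1) ij by (auto split: if_splits)
        then show ?thesis using x(2) ij row[of j c i u q] col[of i "Suc r" j u q] q by auto
      qed
    qed
    show "\<forall>x u. ?T x = Some u \<longrightarrow> (\<exists>z0. T0 z0 = Some u \<and> northwest x z0)"
    proof (intro allI impI)
      fix x u assume x: "?T x = Some u"
      show "\<exists>z0. T0 z0 = Some u \<and> northwest x z0"
      proof (cases "x = ?y")
        case True
        then have "u = q" using x by simp
        then show ?thesis using q0 True by (intro exI[of _ ?z]) (auto simp: northwest_def)
      next
        case False
        then show ?thesis using nw x by (auto split: if_splits)
      qed
    qed
    show "\<forall>x. fst ?z + snd ?z < fst x + snd x \<longrightarrow> ?T x = T0 x" using far by auto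
    show "\<forall>x. corner_of lp x \<longrightarrow> x \<noteq> ?z \<longrightarrow> ?T x = T0 x" using cor nc by auto
    show "transfers L (fst \<circ> posn bb ?T) (fst \<circ> posn bb T0)" by (rule transfers_trans[OF tr1 trr])
    show "transfers L (snd \<circ> posn bb ?T) (snd \<circ> posn bb T0)" unfolding tc1 by (rule trc)
  qed (use z dom1 inc1 dis1 ran1 in simp_all)
qed

section \<open>Transposition and complete slides\<close>

definition transposed :: "filling \<Rightarrow> filling" where
  "transposed T z = T (prod.swap z)"

lemma tr_tr [simp]: "transposed (transposed T) = T"
  by (rule ext) (simp add: transposed_def)

lemma swap_in_image [simp]: "z \<in> prod.swap ` A \<longleftrightarrow> prod.swap z \<in> A"
  by (metis image_iff swap_swap)

lemma swap_eq_iff: "prod.swap x = y \<longleftrightarrow> x = prod.swap y"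
  by (metis swap_swap)

lemma swap_image_image [simp]: "prod.swap ` prod.swap ` A = A"
  by (simp add: image_image)

lemma ex_swap: "(\<exists>z. P (prod.swap z)) \<longleftrightarrow> (\<exists>z. P z)"
  by (metis swap_swap)

lemma dom_tr: "dom (transposed T) = prod.swap ` dom T"
  by (rule set_eqI) (simp add: transposed_def domIff)

lemma ran_tr [simp]: "ran (transposed T) = ran T"
  unfolding ran_def transposed_def using ex_swap[of "\<lambda>z. T z = Some _"] by simp

lemma increasing_tr: "increasing T \<Longrightarrow> increasing (transposed T)"
proof -
  assume "increasing T"
  then have row: "\<And>i j j' u u'. j < j' \<Longrightarrow> T (i, j) = Some u \<Longrightarrow> T (i, j') = Some u' \<Longrightarrow> u < u'"
    and col: "\<And>i i' j u u'. i < i' \<Longrightarrow> T (i, j) = Some u \<Longrightarrow> T (i', j) = Some u' \<Longrightarrow> u < u'"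
    unfolding increasing_def by blast+
  show "increasing (transposed T)"
    unfolding increasing_def transposed_def swap_simp
    by (intro conjI allI impI) (erule (2) col, erule (2) row)
qed

lemma entries_distinct_tr: "entries_distinct T \<Longrightarrow> entries_distinct (transposed T)"
  unfolding entries_distinct_def transposed_def by (metis swap_swap)

lemma young_diagram_swap:
  assumes "young_diagram lam"
  shows "young_diagram (prod.swap ` lam)"
proof -
  have "finite (prod.swap ` lam)" using assms unfolding young_diagram_def by simp
  moreover have "1 \<le> i \<and> 1 \<le> j \<and> {1..i} \<times> {1..j} \<subseteq> prod.swap ` lam" if "(i, j) \<in> prod.swap ` lam" for i j
  proof -
    have ji: "(j, i) \<in> lam" using that by simp
    have "x \<in> prod.swap ` lam" if "x \<in> {1..i} \<times> {1..j}" for x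
      using young_diagramD[OF assms ji, of "snd x" "fst x"] that by (cases x) simp
    then show ?thesis using young_diagram_pos[OF assms ji] by blast
  qed
  ultimately show ?thesis unfolding young_diagram_def by blast
qed

lemma corner_of_swap: "corner_of (prod.swap ` lp) z \<longleftrightarrow> corner_of lp (prod.swap z)"
  unfolding corner_of_def by (cases z) auto

lemma northwest_swap: "northwest (prod.swap x) (prod.swap y) \<longleftrightarrow> northwest x y"
  unfolding northwest_def by (cases x; cases y) auto

lemma posn_tr:
  assumes "entries_distinct T"
  shows "posn (prod.swap \<circ> bb) (transposed T) u = prod.swap (posn bb T u)"
proof (cases "u \<in> ran T")
  case True
  then obtain z where z: "T z = Some u" unfolding ran_def by blast
  then have "transposed T (prod.swap z) = Some u" by (simp add: transposed_def)
  from posn_real[OF entries_distinct_tr[OF assms] this] posn_real[OF assms z] show ?thesis by simp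
next
  case False
  then show ?thesis using posn_ghost[of u T bb] posn_ghost[of u "transposed T"] by simp
qed

lemma ghosts_tr:
  assumes "ghosts lp T bb"
  shows "ghosts (prod.swap ` lp) (transposed T) (prod.swap \<circ> bb)"
  using assms unfolding ghosts_def corner_of_swap by (simp add: transposed_def)

lemma sliding_tr:
  assumes "sliding lp nu T0 bb L T y" "entries_distinct T0"
  shows "sliding (prod.swap ` lp) (prod.swap ` nu) (transposed T0) (prod.swap \<circ> bb) L (transposed T) (prod.swap y)"
proof -
  note st = slidingD[OF assms(1)]
  note y = st(1,2) and dT = st(3) and inc = st(4) and dis = st(5) and ranT = st(6) and far = st(7)
    and cor = st(8) and alt = st(9) and nw = st(10) and trr = st(11) and trc = st(12)
  have w: "fst \<circ> posn (prod.swap \<circ> bb) (transposed V) = snd \<circ> posn bb V"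
    "snd \<circ> posn (prod.swap \<circ> bb) (transposed V) = fst \<circ> posn bb V" if "entries_distinct V" for V
    using posn_tr[OF that] by (auto simp: fun_eq_iff)
  show ?thesis
    unfolding sliding_def w[OF dis] w[OF assms(2)]
  proof (intro conjI)
    show "dom (transposed T) = prod.swap ` lp - prod.swap ` nu - {prod.swap y}"
      unfolding dom_tr dT by (rule set_eqI) (simp add: swap_eq_iff)
    show "\<forall>z. fst (prod.swap y) + snd (prod.swap y) < fst z + snd z \<longrightarrow> transposed T z = transposed T0 z"
      using far by (simp add: transposed_def add.commute)
    show "\<forall>z. corner_of (prod.swap ` lp) z \<longrightarrow> z \<noteq> prod.swap y \<longrightarrow> transposed T z = transposed T0 z"
      unfolding corner_of_swap transposed_def using cor by (metis swap_swap)
    show "transposed T = transposed T0 \<or> (\<exists>q. transposed T0 (prod.swap y) = Some q \<and> (\<forall>z u. transposed T z = Some u \<longrightarrow>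
        (fst z = fst (prod.swap y) \<and> snd z < snd (prod.swap y) \<or> snd z = snd (prod.swap y) \<and> fst z < fst (prod.swap y)) \<longrightarrow> u \<le> q))"
      using alt
    proof
      assume "\<exists>q. T0 y = Some q \<and> (\<forall>z u. T z = Some u \<longrightarrow>
        (fst z = fst y \<and> snd z < snd y \<or> snd z = snd y \<and> fst z < fst y) \<longrightarrow> u \<le> q)"
      then obtain q where q: "T0 y = Some q" "\<And>z u. T z = Some u \<Longrightarrow>
        (fst z = fst y \<and> snd z < snd y \<or> snd z = snd y \<and> fst z < fst y) \<Longrightarrow> u \<le> q" by blast
      show ?thesis
        using q(1) q(2)[of "prod.swap _"] by (intro disjI2 exI[of _ q]) (auto simp: transposed_def)
    qed simp
    show "\<forall>z u. transposed T z = Some u \<longrightarrow> (\<exists>z0. transposed T0 z0 = Some u \<and> northwest z z0)"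
    proof (intro allI impI)
      fix z u assume "transposed T z = Some u"
      then obtain z0 where "T0 z0 = Some u" "northwest (prod.swap z) z0" using nw unfolding transposed_def by blast
      then show "\<exists>z0. transposed T0 z0 = Some u \<and> northwest z z0"
        using northwest_swap[of "prod.swap z" z0] by (intro exI[of _ "prod.swap z0"]) (simp add: transposed_def)
    qed
  qed (use y inc dis ranT trr trc increasing_tr entries_distinct_tr in simp_all)
qed

lemma sliding_step_right:
  assumes st: "sliding lp nu T0 bb L T (r, c)" and lp: "young_diagram lp" "lp \<subseteq> {1..L} \<times> {1..L}"
    and nu: "young_diagram nu" and gh: "ghosts lp T0 bb" and pos: "0 \<notin> ran T0" and dis: "entries_distinct T0"
    and q: "T (r, Suc c) = Some q" and bl: "\<And>p. T (Suc r, c) = Some p \<Longrightarrow> q < p"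
  shows "sliding lp nu T0 bb L (T((r, c) := Some q, (r, Suc c) := None)) (r, Suc c)"
proof -
  have 1: "sliding (prod.swap ` lp) (prod.swap ` nu) (transposed T0) (prod.swap \<circ> bb) L (transposed T) (c, r)"
    using sliding_tr[OF st dis] by simp
  have sub: "prod.swap ` lp \<subseteq> {1..L} \<times> {1..L}" using lp(2) by auto
  have "sliding (prod.swap ` lp) (prod.swap ` nu) (transposed T0) (prod.swap \<circ> bb) L
      ((transposed T)((c, r) := Some q, (Suc c, r) := None)) (Suc c, r)"
    by (rule sliding_step_below[OF 1 young_diagram_swap[OF lp(1)] sub young_diagram_swap[OF nu] ghosts_tr[OF gh]])
      (use pos q bl in \<open>simp_all add: transposed_def\<close>)
  from sliding_tr[OF this entries_distinct_tr[OF dis]]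
  have "sliding lp nu T0 (prod.swap \<circ> (prod.swap \<circ> bb)) L (transposed ((transposed T)((c, r) := Some q, (Suc c, r) := None))) (r, Suc c)"
    by simp
  moreover have "prod.swap \<circ> (prod.swap \<circ> bb) = bb" by (simp add: fun_eq_iff)
  moreover have "transposed ((transposed T)((c, r) := Some q, (Suc c, r) := None)) = T((r, c) := Some q, (r, Suc c) := None)"
  proof
    fix z show "transposed ((transposed T)((c, r) := Some q, (Suc c, r) := None)) z = (T((r, c) := Some q, (r, Suc c) := None)) z"
      by (cases z) (auto simp: transposed_def)
  qed
  ultimately show ?thesis by simp
qed

text \<open>Row plus column of the hole grows with each step, so the loop ends with no filled
  neighbour to the right or below. These neighbours are not in the Young diagram
  \<open>mu - {x}\<close>, since the hole is not; so they lie outside \<open>lp\<close>.\<close>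

lemma slide_result:
  assumes T: "dom T = lp - mu" "increasing T" "entries_distinct T" "0 \<notin> ran T"
    and mu: "young_diagram mu" "is_corner mu x" "mu \<subseteq> lp"
    and lp: "young_diagram lp" "lp \<subseteq> {1..L} \<times> {1..L}" and gh: "ghosts lp T bb"
  shows "\<exists>T' y. slide T x = (T', y) \<and> sliding lp (mu - {x}) T bb L T' y \<and> corner_of lp y"
proof -
  let ?nu = "mu - {x}"
  have nu: "young_diagram ?nu" and x: "x \<in> mu" using mu(2) unfolding is_corner_def by auto
  let ?P = "\<lambda>(T', y). sliding lp ?nu T bb L T' y"
  have init: "sliding lp ?nu T bb L T x"
    unfolding sliding_def
  proof (intro conjI)
    show "dom T = lp - ?nu - {x}" using T(1) x by auto
    show "\<forall>z u. T z = Some u \<longrightarrow> (\<exists>z0. T z0 = Some u \<and> northwest z z0)"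
      by (auto simp: northwest_def intro!: exI)
  qed (use T x mu(3) transfers_refl in auto)
  have step: "sliding lp ?nu T bb L (T'(y := T' z, z := None)) z \<and> fst z + snd z = Suc (fst y + snd y)"
    if st: "sliding lp ?nu T bb L T' y" and z: "next_box T' y = Some z" for T' y z
  proof -
    obtain r c where y: "y = (r, c)" by (cases y)
    have dis: "entries_distinct T'" using st unfolding sliding_def by blast
    have ne: "p \<noteq> q" if "T' (r, Suc c) = Some p" "T' (Suc r, c) = Some q" for p q
      using dis that unfolding entries_distinct_def by fastforce
    have "(\<exists>q. z = (r, Suc c) \<and> T' (r, Suc c) = Some q \<and> (\<forall>p. T' (Suc r, c) = Some p \<longrightarrow> q < p)) \<or>
      (\<exists>q. z = (Suc r, c) \<and> T' (Suc r, c) = Some q \<and> (\<forall>p. T' (r, Suc c) = Some p \<longrightarrow> q < p))"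
      using z ne unfolding next_box_def y Let_def
      by (auto split: option.splits if_splits simp: not_less order.strict_iff_order)
    then show ?thesis
    proof (elim disjE exE conjE)
      fix q assume 1: "z = (r, Suc c)" "T' (r, Suc c) = Some q" "\<forall>p. T' (Suc r, c) = Some p \<longrightarrow> q < p"
      from sliding_step_right[OF st[unfolded y] lp nu gh T(4,3) 1(2)] 1 show ?thesis unfolding y by simp
    next
      fix q assume 1: "z = (Suc r, c)" "T' (Suc r, c) = Some q" "\<forall>p. T' (r, Suc c) = Some p \<longrightarrow> q < p"
      from sliding_step_below[OF st[unfolded y] lp nu gh T(4) 1(2)] 1 show ?thesis unfolding y by simp
    qed
  qed
  have "?P (slide T x) \<and> next_box (fst (slide T x)) (snd (slide T x)) = None"
    unfolding slide_def
  proof (rule while_rule[where P = ?P and r = "measure (\<lambda>(T', y). 2 * L - (fst y + snd y))"])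
    show "?P (T, x)" using init by simp
    fix s assume P: "?P s" and b: "case s of (T, y) \<Rightarrow> next_box T y \<noteq> None"
    obtain T' y where s: "s = (T', y)" by (cases s)
    obtain z where z: "next_box T' y = Some z" using b s by auto
    from step[OF _ z] P s have st: "sliding lp ?nu T bb L (T'(y := T' z, z := None)) z" "fst z + snd z = Suc (fst y + snd y)"
      by auto
    show "?P (case s of (T, y) \<Rightarrow> let z = the (next_box T y) in (T(y := T z, z := None), z))"
      using st(1) s z by (simp add: Let_def)
    have "z \<in> lp" using st(1) unfolding sliding_def by blast
    then have "fst z + snd z \<le> 2 * L" using lp(2) by auto
    then show "(case s of (T, y) \<Rightarrow> let z = the (next_box T y) in (T(y := T z, z := None), z), s)
        \<in> measure (\<lambda>(T', y). 2 * L - (fst y + snd y))"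
      using st(2) s z by (simp add: Let_def)
  next
    fix s assume 1: "?P s" "\<not> (case s of (T, y) \<Rightarrow> next_box T y \<noteq> None)"
    obtain T' y where s: "s = (T', y)" by (cases s)
    show "?P s \<and> next_box (fst s) (snd s) = None" using 1 unfolding s by simp
  qed simp
  moreover obtain T' y where sl: "slide T x = (T', y)" by (cases "slide T x")
  ultimately have s: "slide T x = (T', y)" "sliding lp ?nu T bb L T' y" "next_box T' y = None"
    by simp_all
  obtain r c where y: "y = (r, c)" by (cases y)
  have none: "T' (r, Suc c) = None" "T' (Suc r, c) = None"
    using s(3) unfolding next_box_def y Let_def by (auto split: option.splits)
  have yl: "y \<in> lp" "y \<notin> ?nu" "dom T' = lp - ?nu - {y}" using s(2) unfolding sliding_def by blast+
  have rc: "1 \<le> r" "1 \<le> c" using young_diagram_pos[OF lp(1), of r c] yl(1) unfolding y by blast+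
  have out: "z \<notin> lp" if "T' z = None" "z \<notin> ?nu" "z \<noteq> y" for z
  proof
    assume "z \<in> lp"
    then have "z \<in> dom T'" unfolding yl(3) using that(2,3) by blast
    then show False using that(1) by blast
  qed
  have "(r, Suc c) \<notin> ?nu"
  proof
    assume "(r, Suc c) \<in> ?nu"
    from young_diagramD[OF nu this, of r c] rc have "(r, c) \<in> ?nu" by linarith
    then show False using yl(2) y by simp
  qed
  then have 1: "(r, Suc c) \<notin> lp" by (intro out none) (simp_all add: y)
  have "(Suc r, c) \<notin> ?nu"
  proof
    assume "(Suc r, c) \<in> ?nu"
    from young_diagramD[OF nu this, of r c] rc have "(r, c) \<in> ?nu" by linarith
    then show False using yl(2) y by simp
  qed
  then have "(Suc r, c) \<notin> lp" by (intro out none) (simp_all add: y)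
  then have "corner_of lp y" unfolding corner_of_def using 1 yl(1) y by simp
  then show ?thesis using s by blast
qed

section \<open>Fillings reachable from a diagonal\<close>

lemma corner_not_left:
  assumes lp: "young_diagram lp" and y: "corner_of lp y" and z: "corner_of lp z" and e: "fst y = fst z"
  shows "\<not> snd y < snd z"
proof
  assume lt: "snd y < snd z"
  have m: "(fst z, snd z) \<in> lp" using z unfolding corner_of_def by simp
  have "(fst y, Suc (snd y)) \<in> lp"
    using young_diagramD[OF lp m, of "fst y" "Suc (snd y)"] young_diagram_pos[OF lp m] e lt by simp
  then show False using y unfolding corner_of_def by simp
qed

text \<open>This covers both orientations of the rectangle. \<open>L\<close> bounds the row and
  column numbers, which are the sites of the runs; it will be the longer side
  \<open>m\<close>.\<close>

locale antidiagonal =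
  fixes n L :: nat and lp lm :: "box set" and b :: "nat \<Rightarrow> box" and w :: "nat \<Rightarrow> nat"
  assumes n1: "1 \<le> n" and nL: "n \<le> L" and lm: "young_diagram lm" and lp: "young_diagram lp" "lp \<subseteq> {1..L} \<times> {1..L}"
    and sub: "lm \<subseteq> lp" and bij: "bij_betw b {1..n} (lp - lm)"
    and anti: "\<And>i. 1 \<le> i \<Longrightarrow> i < n \<Longrightarrow> fst (b (Suc i)) < fst (b i) \<and> snd (b i) < snd (b (Suc i))"
    and w: "w permutes {1..n}"
begin

abbreviation "cl \<equiv> cls w n"
abbreviation "bb \<equiv> (\<lambda>u. b (cl u))"

lemma b_strict:
  assumes "1 \<le> i" "i < j" "j \<le> n"
  shows "fst (b j) < fst (b i) \<and> snd (b i) < snd (b j)"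
  using assms(2,3)
proof (induction j)
  case (Suc j)
  show ?case
  proof (cases "i = j")
    case True
    then show ?thesis using anti[of i] assms(1) Suc.prems by simp
  next
    case False
    then have "i < j" "j \<le> n" using Suc.prems by auto
    then show ?thesis using Suc.IH anti[of j] assms(1) Suc.prems by fastforce
  qed
qed simp

lemma b_in: "1 \<le> j \<Longrightarrow> j \<le> n \<Longrightarrow> b j \<in> lp \<and> b j \<notin> lm"
  using bij_betwE[OF bij] by auto

lemma b_ex:
  assumes "z \<in> lp" "z \<notin> lm"
  shows "\<exists>j. 1 \<le> j \<and> j \<le> n \<and> z = b j"
proof -
  have "z \<in> b ` {1..n}" using bij_betw_imp_surj_on[OF bij] assms by blast
  then show ?thesis by auto
qed

lemma b_row_inj: "1 \<le> i \<Longrightarrow> i \<le> n \<Longrightarrow> 1 \<le> j \<Longrightarrow> j \<le> n \<Longrightarrow> fst (b i) = fst (b j) \<Longrightarrow> i = j"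
  using b_strict[of i j] b_strict[of j i] by (metis less_irrefl linorder_neqE_nat)

lemma b_col_inj: "1 \<le> i \<Longrightarrow> i \<le> n \<Longrightarrow> 1 \<le> j \<Longrightarrow> j \<le> n \<Longrightarrow> snd (b i) = snd (b j) \<Longrightarrow> i = j"
  using b_strict[of i j] b_strict[of j i] by (metis less_irrefl linorder_neqE_nat)

lemma b_corner:
  assumes "1 \<le> j" "j \<le> n"
  shows "corner_of lp (b j)"
proof -
  obtain r c where rc: "b j = (r, c)" by (cases "b j")
  have i: "(r, c) \<in> lp" "(r, c) \<notin> lm" using b_in[OF assms] rc by auto
  have p: "1 \<le> r" "1 \<le> c" using young_diagram_pos[OF lp(1) i(1)] by auto
  have "(r, Suc c) \<notin> lp"
  proof
    assume h: "(r, Suc c) \<in> lp"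
    have "(r, Suc c) \<notin> lm" using young_diagramD[OF lm, of r "Suc c" r c] i(2) p by auto
    then obtain k where k: "1 \<le> k" "k \<le> n" "(r, Suc c) = b k" using b_ex[OF h] by blast
    then have "fst (b k) = fst (b j)" using rc by (metis fst_conv)
    then have "k = j" using b_row_inj[OF k(1,2) assms] by blast
    then show False using k(3) rc by simp
  qed
  moreover have "(Suc r, c) \<notin> lp"
  proof
    assume h: "(Suc r, c) \<in> lp"
    have "(Suc r, c) \<notin> lm" using young_diagramD[OF lm, of "Suc r" c r c] i(2) p by auto
    then obtain k where k: "1 \<le> k" "k \<le> n" "(Suc r, c) = b k" using b_ex[OF h] by blast
    then have "snd (b k) = snd (b j)" using rc by (metis snd_conv)
    then have "k = j" using b_col_inj[OF k(1,2) assms] by blast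
    then show False using k(3) rc by simp
  qed
  ultimately show ?thesis unfolding corner_of_def using i rc by simp
qed

lemma cl_in: "1 \<le> cl u" "cl u \<le> n"
  using cls_in[OF n1 w, of u] by auto

lemma corner_in_row:
  assumes y: "corner_of lp y" and j: "1 \<le> j" "j \<le> n" "fst (b j) = fst y"
  shows "y \<in> b ` {1..n}"
proof -
  note nc = corner_not_left[OF lp(1)] and c = b_corner[OF j(1,2)]
  have "snd (b j) = snd y" using nc[OF y c] nc[OF c y] j(3) by (metis linorder_neqE_nat)
  then have "y = b j" using j(3) by (intro prod_eqI) simp_all
  then show ?thesis using j by simp
qed

lemma corner_in_column:
  assumes y: "corner_of lp y" and j: "1 \<le> j" "j \<le> n" "snd (b j) = snd y"
  shows "y \<in> b ` {1..n}"
proof -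
  note nc = corner_not_left[OF young_diagram_swap[OF lp(1)], unfolded corner_of_swap, of "prod.swap _" "prod.swap _"]
  note c = b_corner[OF j(1,2)]
  have "\<not> fst y < fst (b j)" "\<not> fst (b j) < fst y" using nc[of y "b j"] nc[of "b j" y] y c j(3) by simp_all
  then have "fst (b j) = fst y" by linarith
  then have "y = b j" using j(3) by (intro prod_eqI) simp_all
  then show ?thesis using j by simp
qed

end

text \<open>Here every slide ends at a diagonal box. The assumption is met when the diagonal hits
  every row or every column, since each of these contains at most one corner.\<close>

locale diagonal = antidiagonal +
  assumes ends: "\<And>y. corner_of lp y \<Longrightarrow> y \<in> b ` {1..n}"
begin

text \<open>In the comparison words \<open>fst (bb u)\<close> and \<open>snd (bb u)\<close> all
  values are still stacked on the diagonal.\<close>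

definition good :: "box set \<Rightarrow> filling \<Rightarrow> bool" where
  "good mu T \<longleftrightarrow> young_diagram mu \<and> mu \<subseteq> lm \<and> dom T = lp - mu \<and> increasing T \<and> entries_distinct T \<and>
     (\<forall>u. u \<in> ran T \<longleftrightarrow> 1 \<le> u \<and> (\<exists>u0. T (bb u) = Some u0 \<and> u \<le> u0)) \<and>
     (\<forall>j u0. 1 \<le> j \<longrightarrow> j \<le> n \<longrightarrow> T (b j) = Some u0 \<longrightarrow> cl u0 = j) \<and>
     (\<forall>z u. T z = Some u \<longrightarrow> northwest z (bb u)) \<and>
     transfers L (fst \<circ> posn bb T) (\<lambda>u. fst (bb u)) \<and> transfers L (snd \<circ> posn bb T) (\<lambda>u. snd (bb u))"

lemma goodI:
  assumes "young_diagram mu" "mu \<subseteq> lm" "dom T = lp - mu" "increasing T" "entries_distinct T"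
    and "\<And>u. u \<in> ran T \<longleftrightarrow> 1 \<le> u \<and> (\<exists>u0. T (bb u) = Some u0 \<and> u \<le> u0)"
    and "\<And>j u0. 1 \<le> j \<Longrightarrow> j \<le> n \<Longrightarrow> T (b j) = Some u0 \<Longrightarrow> cl u0 = j"
    and "\<And>z u. T z = Some u \<Longrightarrow> northwest z (bb u)"
    and "transfers L (fst \<circ> posn bb T) (\<lambda>u. fst (bb u))" "transfers L (snd \<circ> posn bb T) (\<lambda>u. snd (bb u))"
  shows "good mu T"
  unfolding good_def by (intro conjI allI impI assms)

lemma goodD:
  assumes "good mu T"
  shows "young_diagram mu" "mu \<subseteq> lm" "dom T = lp - mu" "increasing T" "entries_distinct T"
    and "\<forall>u. u \<in> ran T \<longleftrightarrow> 1 \<le> u \<and> (\<exists>u0. T (bb u) = Some u0 \<and> u \<le> u0)"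
    and "\<forall>j u0. 1 \<le> j \<longrightarrow> j \<le> n \<longrightarrow> T (b j) = Some u0 \<longrightarrow> cl u0 = j"
    and "\<forall>z u. T z = Some u \<longrightarrow> northwest z (bb u)"
    and "transfers L (fst \<circ> posn bb T) (\<lambda>u. fst (bb u))" "transfers L (snd \<circ> posn bb T) (\<lambda>u. snd (bb u))"
  using assms unfolding good_def by - (elim conjE, assumption)+

lemma start_filling_b:
  assumes "1 \<le> i" "i \<le> n"
  shows "start_filling n b w (b i) = Some (w i)"
proof -
  have "map fst (map (\<lambda>i. (b i, w i)) [1..<n + 1]) = map b [1..<n + 1]" by (simp only: map_map comp_def fst_conv)
  moreover have "set [1..<n + 1] = {1..n}" by (simp only: set_upt Suc_eq_plus1[symmetric] atLeastLessThanSuc_atLeastAtMost)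
  ultimately have d: "distinct (map fst (map (\<lambda>i. (b i, w i)) [1..<n + 1]))"
    using bij_betw_imp_inj_on[OF bij] by (simp only: distinct_map distinct_upt)
  show ?thesis unfolding start_filling_def 
    by (intro map_of_is_SomeI[OF d]) (simp only: set_map set_upt, rule image_eqI[OF refl], use assms in simp)
qed

lemma dom_start_filling: "dom (start_filling n b w) = lp - lm"
proof -
  have "dom (start_filling n b w) = b ` {1..<n + 1}"
    unfolding start_filling_def by (simp only: dom_map_of_conv_image_fst set_map set_upt image_image fst_conv)
  also have "{1..<n + 1} = {1..n}" by auto
  finally show ?thesis using bij_betw_imp_surj_on[OF bij] by simp
qed

lemma start_filling_SomeD:
  assumes "start_filling n b w z = Some u"
  shows "\<exists>j. 1 \<le> j \<and> j \<le> n \<and> z = b j \<and> u = w j"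
proof -
  have "z \<in> lp - lm" using assms dom_start_filling by blast
  then obtain j where j: "1 \<le> j" "j \<le> n" "z = b j" using b_ex by blast
  then show ?thesis using start_filling_b[OF j(1,2)] assms by auto
qed

lemma good_start: "good lm (start_filling n b w)"
proof -
  let ?T = "start_filling n b w"
  have inc: "increasing ?T"
    unfolding increasing_def
  proof (intro conjI allI impI)
    fix i j j' u u' assume h: "j < j'" "?T (i, j) = Some u" "?T (i, j') = Some u'"
    obtain k k' where k: "1 \<le> k" "k \<le> n" "(i, j) = b k" "1 \<le> k'" "k' \<le> n" "(i, j') = b k'"
      using start_filling_SomeD[OF h(2)] start_filling_SomeD[OF h(3)] by blast
    then have "fst (b k) = fst (b k')" by (metis fst_conv)
    then have "k = k'" using b_row_inj k by blast
    then show "u < u'" using k h(1) by (metis Pair_inject less_irrefl)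
  next
    fix i i' j u u' assume h: "i < i'" "?T (i, j) = Some u" "?T (i', j) = Some u'"
    obtain k k' where k: "1 \<le> k" "k \<le> n" "(i, j) = b k" "1 \<le> k'" "k' \<le> n" "(i', j) = b k'"
      using start_filling_SomeD[OF h(2)] start_filling_SomeD[OF h(3)] by blast
    then have "snd (b k) = snd (b k')" by (metis snd_conv)
    then have "k = k'" using b_col_inj k by blast
    then show "u < u'" using k h(1) by (metis Pair_inject less_irrefl)
  qed
  have dis: "entries_distinct ?T"
    unfolding entries_distinct_def
  proof (intro allI impI)
    fix z z' u assume h: "?T z = Some u" "?T z' = Some u"
    obtain k k' where k: "z = b k" "u = w k" "z' = b k'" "u = w k'"
      using start_filling_SomeD[OF h(1)] start_filling_SomeD[OF h(2)] by blast
    then have "w k = w k'" by simp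
    then have "k = k'" using permutes_inj[OF w] by (simp add: inj_eq)
    then show "z = z'" using k by simp
  qed
  have ranT: "u \<in> ran ?T \<longleftrightarrow> (\<exists>j. 1 \<le> j \<and> j \<le> n \<and> u = w j)" for u
  proof
    assume "u \<in> ran ?T"
    then obtain z where "?T z = Some u" unfolding ran_def by blast
    then show "\<exists>j. 1 \<le> j \<and> j \<le> n \<and> u = w j" using start_filling_SomeD by blast
  next
    assume "\<exists>j. 1 \<le> j \<and> j \<le> n \<and> u = w j"
    then show "u \<in> ran ?T" using start_filling_b unfolding ran_def by blast
  qed
  have vals: "u \<in> ran ?T \<longleftrightarrow> 1 \<le> u \<and> (\<exists>u0. ?T (bb u) = Some u0 \<and> u \<le> u0)" for u
  proof -
    have T: "?T (bb u) = Some (w (cl u))" by (rule start_filling_b[OF cl_in])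
    show ?thesis
    proof
      assume "u \<in> ran ?T"
      then obtain j where j: "1 \<le> j" "j \<le> n" "u = w j" using ranT by blast
      then have "cl u = j" using cls_w[OF n1 w] by blast
      then show "1 \<le> u \<and> (\<exists>u0. ?T (bb u) = Some u0 \<and> u \<le> u0)" using T j w_in[OF n1 w j(1,2)] by simp
    next
      assume h: "1 \<le> u \<and> (\<exists>u0. ?T (bb u) = Some u0 \<and> u \<le> u0)"
      then have le: "u \<le> w (cl u)" using T by auto
      have e: "w (cl u) = Suc ((u - 1) mod n)" by (rule w_cls[OF n1 w])
      have "(u - 1) mod n \<le> u - 1" by (rule mod_less_eq_dividend)
      then have "u = w (cl u)" using le e h by linarith
      then show "u \<in> ran ?T" using ranT cl_in by blast
    qed
  qed
  have p: "posn bb ?T u = bb u" for u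
  proof (cases "u \<in> ran ?T")
    case True
    then obtain j where j: "1 \<le> j" "j \<le> n" "u = w j" using ranT by blast
    then have c: "cl u = j" using cls_w[OF n1 w] by blast
    have "?T (b j) = Some u" using start_filling_b[OF j(1,2)] j(3) by simp
    then show ?thesis using posn_real[OF dis] c by simp
  next
    case False
    then show ?thesis by (rule posn_ghost)
  qed
  have "fst \<circ> posn bb ?T = (\<lambda>u. fst (bb u))" "snd \<circ> posn bb ?T = (\<lambda>u. snd (bb u))"
    using p by (simp_all add: fun_eq_iff)
  then have tr: "transfers L (fst \<circ> posn bb ?T) (\<lambda>u. fst (bb u))" "transfers L (snd \<circ> posn bb ?T) (\<lambda>u. snd (bb u))"
    using transfers_refl by simp_all
  have clb: "cl u0 = j" if "1 \<le> j" "j \<le> n" "?T (b j) = Some u0" for j u0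
    using that start_filling_b[OF that(1,2)] cls_w[OF n1 w that(1,2)] by simp
  have nw: "northwest z (bb u)" if "?T z = Some u" for z u
    using start_filling_SomeD[OF that] cls_w[OF n1 w] by (auto simp: northwest_def)
  show ?thesis by (rule goodI[OF lm subset_refl dom_start_filling inc dis vals clb nw tr])
qed

lemma good_ghosts:
  assumes "good mu T"
  shows "ghosts lp T bb"
  unfolding ghosts_def
proof (intro allI impI conjI)
  fix u assume u: "1 \<le> u" "u \<notin> ran T"
  show "corner_of lp (bb u)" by (rule b_corner[OF cl_in])
  note mu = goodD(2)[OF assms] and dT = goodD(3)[OF assms] and vals = goodD(6)[OF assms, rule_format]
  have "bb u \<in> dom T" unfolding dT using b_in[OF cl_in, of u] mu by blast
  then obtain u0 where u0: "T (bb u) = Some u0" by blast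
  then have "\<not> u \<le> u0" using vals[of u] u by simp
  then show "\<exists>u0<u. T (bb u) = Some u0" using u0 by (intro exI[of _ u0]) simp
qed

lemma good_step:
  assumes g: "good mu T" and x: "is_corner mu x"
  shows "good (mu - {x}) (slide_refill n b T x)"
proof -
  let ?nu = "mu - {x}"
  note mu = goodD(1,2)[OF g] and dT = goodD(3)[OF g] and inc = goodD(4)[OF g] and dis = goodD(5)[OF g]
    and vals = goodD(6)[OF g, rule_format] and clb = goodD(7)[OF g, rule_format]
    and nw = goodD(8)[OF g, rule_format] and trr = goodD(9)[OF g] and trc = goodD(10)[OF g]
  have z0: "0 \<notin> ran T" using vals[of 0] by simp
  obtain T' y where s: "slide T x = (T', y)" "sliding lp ?nu T bb L T' y" "corner_of lp y"
    using slide_result[OF dT inc dis z0 mu(1) x _ lp good_ghosts[OF g]] mu(2) sub by blast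
  note st = slidingD[OF s(2)]
  note yn = st(2,1) and dT' = st(3) and inc' = st(4) and dis' = st(5) and ran' = st(6)
    and cor = st(8) and alt = st(9) and nw' = st(10) and trr' = st(11) and trc' = st(12)
  obtain i where i: "1 \<le> i" "i \<le> n" "y = b i" using ends[OF s(3)] by auto
  have "y \<in> dom T" using b_in[OF i(1,2)] i(3) dT mu(2) by blast
  then obtain q where q: "T y = Some q" by blast
  have T'y: "T' y = None" using dT' by blast
  have lq: "u \<le> q" if "T' z = Some u" "fst z = fst y \<and> snd z < snd y \<or> snd z = snd y \<and> fst z < fst y" for z u
  proof -
    have "T' \<noteq> T" using q T'y by auto
    then show ?thesis using alt q that by auto
  qed
  let ?V = "T'(y := Some (q + n))"
  have V: "slide_refill n b T x = ?V" unfolding slide_refill_def s(1) using i q by auto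
  have clq: "cl q = i" using clb[OF i(1,2)] q i(3) by simp
  have q1: "1 \<le> q"
  proof -
    have "q \<in> ran T" using q unfolding ran_def by blast
    then show ?thesis using vals by blast
  qed
  have clqn: "cl (q + n) = i" using cls_add[OF n1 w q1] clq by simp
  have qn: "q + n \<notin> ran T" using vals[of "q + n"] clqn q i(3) n1 by auto
  have VS: "?V z = Some u \<longleftrightarrow> (if z = y then u = q + n else T' z = Some u)" for z u by auto
  have ranV: "u \<in> ran ?V \<longleftrightarrow> u = q + n \<or> u \<in> ran T" for u
  proof
    assume "u \<in> ran ?V"
    then obtain z where "?V z = Some u" unfolding ran_def by blast
    then show "u = q + n \<or> u \<in> ran T" unfolding VS using ran' unfolding ran_def by (auto split: if_splits)
  next
    assume "u = q + n \<or> u \<in> ran T"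
    then show "u \<in> ran ?V"
    proof
      assume "u = q + n"
      then have "?V y = Some u" by simp
      then show ?thesis unfolding ran_def by blast
    next
      assume "u \<in> ran T"
      then obtain z where z: "T' z = Some u" using ran' unfolding ran_def by blast
      then have "z \<noteq> y" using T'y by auto
      then have "?V z = Some u" using z by simp
      then show ?thesis unfolding ran_def by blast
    qed
  qed
  have Vb: "?V (b j) = (if j = i then Some (q + n) else T (b j))" if j: "1 \<le> j" "j \<le> n" for j
  proof (cases "j = i")
    case True then show ?thesis using i(3) by simp
  next
    case False
    then have "b j \<noteq> y" using b_row_inj[OF j i(1,2)] i(3) by auto
    then show ?thesis using cor[OF b_corner[OF j]] False by simp
  qed
  have domV: "dom ?V = lp - ?nu" using dT' yn by auto
  have yc: "(fst y, Suc (snd y)) \<notin> lp" "(Suc (fst y), snd y) \<notin> lp" using s(3) unfolding corner_of_def by auto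
  have ypos: "1 \<le> fst y" "1 \<le> snd y" using young_diagram_pos[OF lp(1), of "fst y" "snd y"] yn(2) by auto
  have nr: "T' (fst y, j) = None" if "snd y < j" for j
  proof (rule ccontr)
    assume "T' (fst y, j) \<noteq> None"
    then have "(fst y, j) \<in> lp" using dT' by blast
    from young_diagramD[OF lp(1) this, of "fst y" "Suc (snd y)"] yc that ypos show False by simp
  qed
  have nb: "T' (j, snd y) = None" if "fst y < j" for j
  proof (rule ccontr)
    assume "T' (j, snd y) \<noteq> None"
    then have "(j, snd y) \<in> lp" using dT' by blast
    from young_diagramD[OF lp(1) this, of "Suc (fst y)" "snd y"] yc that ypos show False by simp
  qed
  have ny: "j \<noteq> snd y \<Longrightarrow> (fst y, j) \<noteq> y" "j \<noteq> fst y \<Longrightarrow> (j, snd y) \<noteq> y" for j by (cases y; simp)+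
  have incV: "increasing ?V"
  proof (rule increasing_update[OF inc', of ?V "fst y" "snd y" "q + n"])
    show "T' x = Some u" if "?V x = Some u" "x \<noteq> (fst y, snd y)" for x u using that by simp
    show "?V (fst y, snd y) = Some (q + n)" by simp
    show "u < q + n" if "?V (fst y, j) = Some u" "j < snd y" for j u
      using that lq[of "(fst y, j)" u] n1 ny(1)[of j] by auto
    show "q + n < u" if "?V (fst y, j) = Some u" "snd y < j" for j u
      using that nr[of j] ny(1)[of j] by auto
    show "u < q + n" if "?V (j, snd y) = Some u" "j < fst y" for j u
      using that lq[of "(j, snd y)" u] n1 ny(2)[of j] by auto
    show "q + n < u" if "?V (j, snd y) = Some u" "fst y < j" for j u
      using that nb[of j] ny(2)[of j] by auto
  qed
  have qnT': "T' z \<noteq> Some (q + n)" for z using qn ran' unfolding ran_def by blast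
  have disV: "entries_distinct ?V"
    unfolding entries_distinct_def VS
  proof (intro allI impI)
    fix z z' u assume "if z = y then u = q + n else T' z = Some u" "if z' = y then u = q + n else T' z' = Some u"
    then show "z = z'" using qnT' dis' unfolding entries_distinct_def by (auto split: if_splits)
  qed
  have valsV: "u \<in> ran ?V \<longleftrightarrow> 1 \<le> u \<and> (\<exists>u0. ?V (bb u) = Some u0 \<and> u \<le> u0)" for u
  proof (cases "cl u = i")
    case False
    then have "u \<noteq> q + n" using clqn by auto
    then show ?thesis using ranV[of u] vals[of u] Vb[OF cl_in, of u] False by simp
  next
    case True
    then have 1: "?V (bb u) = Some (q + n)" using Vb[OF i(1,2)] by simp
    have 2: "u \<in> ran T \<longleftrightarrow> 1 \<le> u \<and> u \<le> q" using vals[of u] True q i(3) by auto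
    \<comment> \<open>Values of one class differ by multiples of \<open>n\<close>, so the refill
      skips none of them.\<close>
    have "u = q + n" if "q < u" "u \<le> q + n"
    proof -
      have "1 \<le> u" "cl q = cl u" "q \<le> u" using that q1 True clq by simp_all
      then obtain k where k: "u = q + k * n" using cls_same[OF n1 w q1] by blast
      then have "k \<noteq> 0" "k * n \<le> 1 * n" using that by auto
      then have "k = 1" using n1 by (metis One_nat_def Suc_leI le_antisym mult_le_cancel2 neq0_conv less_le_trans zero_less_one)
      then show ?thesis using k by simp
    qed
    then show ?thesis unfolding ranV using 1 2 q1 by (auto simp: not_le)
  qed
  have clV: "cl u0 = j" if "1 \<le> j" "j \<le> n" "?V (b j) = Some u0" for j u0
    using Vb[OF that(1,2)] that(3) clqn clb[OF that(1,2)] by (auto split: if_splits)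
  have nwV: "northwest z (bb u)" if "?V z = Some u" for z u
  proof (cases "z = y")
    case True
    then show ?thesis using that clqn i(3) by (auto simp: northwest_def)
  next
    case False
    then have "T' z = Some u" using that by simp
    then obtain z0 where "T z0 = Some u" "northwest z z0" using nw' by blast
    then show ?thesis using nw[of z0 u] unfolding northwest_def by fastforce
  qed
  \<comment> \<open>The new entry \<open>q + n\<close> was already regarded as waiting at this very
    box, so the refill moves nothing.\<close>
  have pV: "posn bb ?V u = posn bb T' u" for u
  proof (cases "u = q + n")
    case True
    have "?V y = Some u" using True by simp
    from posn_real[OF disV this] have "posn bb ?V u = y" .
    moreover have "posn bb T' u = bb u" using qn ran' True by (intro posn_ghost) simp
    ultimately show ?thesis using clqn i(3) True by simp
  next
    case F: False
    show ?thesis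
    proof (cases "u \<in> ran T")
      case True
      then obtain z where z: "T' z = Some u" using ran' unfolding ran_def by blast
      then have "z \<noteq> y" using T'y by auto
      then have "?V z = Some u" using z by simp
      then show ?thesis using posn_real[OF disV] posn_real[OF dis' z] by simp
    next
      case False
      then have "u \<notin> ran ?V" "u \<notin> ran T'" using F ranV ran' by blast+
      then show ?thesis using posn_ghost[of u ?V] posn_ghost[of u T'] by simp
    qed
  qed
  have pc: "fst \<circ> posn bb ?V = fst \<circ> posn bb T'" "snd \<circ> posn bb ?V = snd \<circ> posn bb T'"
    using pV by (simp_all add: fun_eq_iff)
  have trV: "transfers L (fst \<circ> posn bb ?V) (\<lambda>u. fst (bb u))" "transfers L (snd \<circ> posn bb ?V) (\<lambda>u. snd (bb u))"
    unfolding pc using transfers_trans[OF trr' trr] transfers_trans[OF trc' trc] by blast+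
  have "young_diagram ?nu" "?nu \<subseteq> lm" using x mu(2) unfolding is_corner_def by auto
  then show ?thesis unfolding V by (rule goodI[OF _ _ domV incV disV valsV clV nwV trV])
qed

end

section \<open>Corner choices\<close>

lemma corner_exists:
  assumes "young_diagram mu" "mu \<noteq> {}"
  shows "\<exists>x. is_corner mu x"
proof -
  let ?s = "\<lambda>z. fst z + snd z :: nat"
  have fin: "finite mu" using assms(1) unfolding young_diagram_def by blast
  \<comment> \<open>A box with maximal row plus column is a corner.\<close>
  have "Max (?s ` mu) \<in> ?s ` mu" using fin assms(2) by (intro Max_in) auto
  then obtain x where x: "x \<in> mu" "?s x = Max (?s ` mu)" by auto
  have mx: "?s z \<le> ?s x" if "z \<in> mu" for z unfolding x(2) using that fin by (intro Max_ge) auto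
  have "1 \<le> i \<and> 1 \<le> j \<and> {1..i} \<times> {1..j} \<subseteq> mu - {x}" if ij: "(i, j) \<in> mu - {x}" for i j
  proof (intro conjI subsetI)
    have m: "(i, j) \<in> mu" "(i, j) \<noteq> x" using ij by auto
    show "1 \<le> i" "1 \<le> j" using young_diagram_pos[OF assms(1) m(1)] by auto
    fix z assume z: "z \<in> {1..i} \<times> {1..j}"
    obtain i' j' where z': "z = (i', j')" by (cases z)
    have le: "1 \<le> i'" "i' \<le> i" "1 \<le> j'" "j' \<le> j" using z z' by auto
    have "z \<in> mu" unfolding z' by (rule young_diagramD[OF assms(1) m(1) le])
    moreover have "z \<noteq> x"
    proof
      assume "z = x"
      then have "i + j \<le> i' + j'" using mx[OF m(1)] z' by auto
      then have "i' = i" "j' = j" using le by linarith+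
      then show False using m(2) \<open>z = x\<close> z' by simp
    qed
    ultimately show "z \<in> mu - {x}" by simp
  qed
  then have "young_diagram (mu - {x})" unfolding young_diagram_def using fin by blast
  then show ?thesis using x(1) unfolding is_corner_def by blast
qed

lemma SYT_sublevel_young:
  assumes lm: "young_diagram lm" and U: "U \<in> SYT lm"
  shows "young_diagram {x \<in> lm. the (U x) \<le> s}"
proof -
  from U have row: "\<And>i j j'. (i, j) \<in> lm \<Longrightarrow> (i, j') \<in> lm \<Longrightarrow> j < j' \<Longrightarrow> the (U (i, j)) < the (U (i, j'))"
    and col: "\<And>i i' j. (i, j) \<in> lm \<Longrightarrow> (i', j) \<in> lm \<Longrightarrow> i < i' \<Longrightarrow> the (U (i, j)) < the (U (i', j))"
    unfolding SYT_def by blast+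
  have "1 \<le> i \<and> 1 \<le> j \<and> {1..i} \<times> {1..j} \<subseteq> {x \<in> lm. the (U x) \<le> s}" if ij: "(i, j) \<in> {x \<in> lm. the (U x) \<le> s}" for i j
  proof (intro conjI subsetI)
    have m: "(i, j) \<in> lm" "the (U (i, j)) \<le> s" using ij by auto
    show "1 \<le> i" "1 \<le> j" using young_diagram_pos[OF lm m(1)] by auto
    fix z assume z: "z \<in> {1..i} \<times> {1..j}"
    obtain i' j' where z': "z = (i', j')" by (cases z)
    have le: "1 \<le> i'" "i' \<le> i" "1 \<le> j'" "j' \<le> j" using z z' by auto
    have a: "(i', j') \<in> lm" by (rule young_diagramD[OF lm m(1) le])
    have b: "(i, j') \<in> lm" using young_diagramD[OF lm m(1), of i j'] le by simp
    have "the (U (i', j')) \<le> the (U (i, j'))" using col[OF a b] le by (cases "i' = i") auto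
    also have "\<dots> \<le> the (U (i, j))" using row[OF b m(1)] le by (cases "j' = j") auto
    finally show "z \<in> {x \<in> lm. the (U x) \<le> s}" using a m(2) z' by simp
  qed
  moreover have "finite {x \<in> lm. the (U x) \<le> s}" using lm unfolding young_diagram_def by simp
  ultimately show ?thesis unfolding young_diagram_def by blast
qed

context diagonal
begin

abbreviation "start \<equiv> start_filling n b w"

abbreviation "steps \<equiv> (construction_step n lp b)\<^sup>*\<^sup>*"

lemma good_unfilled: "good mu T \<Longrightarrow> lp - dom T = mu"
  using goodD(2,3)[of mu T] sub by auto

lemma good_construction_step:
  assumes "good mu T" "is_corner mu x"
  shows "construction_step n lp b T (slide_refill n b T x)"
proof (rule construction_step.intros)
  have "x \<in> mu" using assms(2) unfolding is_corner_def by blast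
  then show "dom T \<noteq> lp" using good_unfilled[OF assms(1)] by blast
  show "is_corner (lp - dom T) x" using good_unfilled[OF assms(1)] assms(2) by simp
qed

lemma reachable_good:
  assumes "steps start T"
  shows "\<exists>mu. good mu T"
  using assms
proof (induction rule: rtranclp_induct)
  case base
  show ?case using good_start by blast
next
  case (step T T')
  then obtain mu where g: "good mu T" by blast
  from step(2) obtain x where x: "is_corner (lp - dom T) x" "T' = slide_refill n b T x"
    by (cases rule: construction_step.cases) blast
  have "is_corner mu x" using x(1) good_unfilled[OF g] by simp
  from good_step[OF g this] x(2) show ?case by blast
qed

lemma completion_exists:
  assumes "good mu T"
  shows "\<exists>T'. steps T T' \<and> good {} T'"
  using assms
proof (induction "card mu" arbitrary: mu T)
  case 0
  have "finite mu" using goodD(1)[OF 0(2)] unfolding young_diagram_def by blast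
  then have "mu = {}" using 0(1) by simp
  then show ?case using 0(2) by blast
next
  case (Suc k)
  have fin: "finite mu" using goodD(1)[OF Suc(3)] unfolding young_diagram_def by blast
  have "mu \<noteq> {}" using Suc(2) by auto
  then obtain x where x: "is_corner mu x" using corner_exists[OF goodD(1)[OF Suc(3)]] by blast
  have "x \<in> mu" using x unfolding is_corner_def by blast
  then have "k = card (mu - {x})" using Suc(2) fin by simp
  from Suc(1)[OF this good_step[OF Suc(3) x]] obtain T' where
    "steps (slide_refill n b T x) T'" "good {} T'" by blast
  then show ?case 
    using rtranclp_trans[of "construction_step n lp b",
        OF r_into_rtranclp[of "construction_step n lp b", OF good_construction_step[OF Suc(3) x]]] by blast
qed

text \<open>The largest remaining label of \<open>U\<close> always sits at a corner, because the
  boxes with labels up to a given bound form a Young diagram.\<close>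

lemma choices_reachable:
  assumes U: "U \<in> SYT lm" and k: "k \<le> card lm"
  shows "steps start
      (fold (\<lambda>k T. slide_refill n b T (chosen_box lm U k)) [1..<k + 1] start) \<and>
    good {x \<in> lm. the (U x) \<le> card lm - k}
      (fold (\<lambda>k T. slide_refill n b T (chosen_box lm U k)) [1..<k + 1] start)"
  using k
proof (induction k)
  case 0
  have bU: "bij_betw (\<lambda>x. the (U x)) lm {1..card lm}" using U unfolding SYT_def by blast
  have "{x \<in> lm. the (U x) \<le> card lm} = lm" using bij_betwE[OF bU] by auto
  then show ?case using good_start by simp
next
  case (Suc k)
  let ?F = "\<lambda>k T. slide_refill n b T (chosen_box lm U k)"
  let ?T = "fold ?F [1..<k + 1] start"
  let ?mu = "{x \<in> lm. the (U x) \<le> card lm - k}"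
  define V where "V = ?T"
  have "k \<le> card lm" using Suc(2) by simp
  from Suc(1)[OF this] have IH: "steps start V" "good ?mu V"
    unfolding V_def by (rule conjunct1, rule conjunct2)
  have bU: "bij_betw (\<lambda>x. the (U x)) lm {1..card lm}" and dU: "dom U = lm" using U unfolding SYT_def by blast+
  have s: "card lm + 1 - Suc k = card lm - k" "card lm - k \<in> {1..card lm}" using Suc(2) by auto
  then obtain x where x: "x \<in> lm" "the (U x) = card lm - k" using bU unfolding bij_betw_def by (metis imageE)
  have Ux: "U x = Some (card lm - k)"
  proof -
    obtain u where "U x = Some u" using x(1) dU by blast
    then show ?thesis using x(2) by simp
  qed
  have uniq: "y = x" if "y \<in> lm" "the (U y) = card lm - k" for y
    using bij_betw_imp_inj_on[OF bU] that x unfolding inj_on_def by metis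
  have cb: "chosen_box lm U (Suc k) = x"
    unfolding chosen_box_def s(1)
  proof (rule the_equality)
    show "x \<in> lm \<and> U x = Some (card lm - k)" using x(1) Ux by simp
    show "y = x" if "y \<in> lm \<and> U y = Some (card lm - k)" for y using uniq[of y] that by simp
  qed
  have mu': "?mu - {x} = {x \<in> lm. the (U x) \<le> card lm - Suc k}"
  proof (rule set_eqI)
    fix y
    have "the (U y) \<le> card lm - k \<and> y \<noteq> x \<longleftrightarrow> the (U y) \<le> card lm - Suc k" if "y \<in> lm"
    proof -
      have "the (U y) = card lm - k \<longleftrightarrow> y = x" using uniq[OF that] x(2) by blast
      then show ?thesis using Suc(2) by auto
    qed
    then show "y \<in> ?mu - {x} \<longleftrightarrow> y \<in> {x \<in> lm. the (U x) \<le> card lm - Suc k}" by blast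
  qed
  have c: "is_corner ?mu x"
    unfolding is_corner_def mu' using SYT_sublevel_young[OF lm U] x by simp
  have e: "fold ?F [1..<Suc k + 1] start = slide_refill n b V x"
  proof -
    have "[1..<Suc k + 1] = [1..<k + 1] @ [Suc k]" by simp
    then have "fold ?F [1..<Suc k + 1] start = ?F (Suc k) V" unfolding V_def by (simp only: fold_append fold_simps comp_apply)
    then show ?thesis unfolding cb .
  qed
  have st: "construction_step n lp b V (slide_refill n b V x)" by (rule good_construction_step[OF IH(2) c])
  have "steps start (slide_refill n b V x)"
    using IH(1) r_into_rtranclp[of "construction_step n lp b", OF st]
    by (rule rtranclp_trans[of "construction_step n lp b"])
  moreover have "good {x \<in> lm. the (U x) \<le> card lm - Suc k} (slide_refill n b V x)"
    using good_step[OF IH(2) c] unfolding mu' .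
  ultimately show ?case unfolding e by (rule conjI)
qed

lemma filling_of_choices_good:
  assumes U: "U \<in> SYT lm"
  shows "good {} (filling_of_choices n lm b w U)"
proof -
  have bU: "bij_betw (\<lambda>x. the (U x)) lm {1..card lm}" using U unfolding SYT_def by blast
  have e: "{x \<in> lm. the (U x) \<le> card lm - card lm} = {}" using bij_betwE[OF bU] by fastforce
  show ?thesis using conjunct2[OF choices_reachable[OF U order_refl]] unfolding filling_of_choices_def e .
qed

text \<open>Particles resting on \<open>{1..r}\<close> count the values in the first
  \<open>r\<close> rows, and likewise for columns; \<open>transfers\<close> carries these counts
  over to the initial words.\<close>

lemma good_row_column_bound:
  assumes g: "good {} V" "good {} V'" and rk: "r + k \<le> n" and t: "t \<le> v" "t' \<le> v"
  shows "cnt (fst \<circ> posn bb V) {1..r} t + cnt cl {Suc n - r..n} v + cnt (snd \<circ> posn bb V') {1..k} t' + cnt cl {1..k} v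
    \<le> v + r * k + cnt cl {Suc n - r..n} t + cnt cl {1..k} t'"
proof -
  have static: "\<exists>Y a. down_run W0 L i s Y a \<and> cnt W {1..i} s \<le> a" if "transfers L W W0" "i \<le> n" for W W0 i s
  proof -
    have "down_run W L i 0 {1..i} 0" using that(2) nL by (intro run.run_start) auto
    from run_extend[OF this, of s] obtain a where a: "down_run W L i s {1..i} a" "a = cnt W {1..i} s" by auto
    from that(1) a(1) obtain Y a' where "down_run W0 L i s Y a'" "a \<le> a'" unfolding transfers_def by blast
    then show ?thesis using a(2) by blast
  qed
  have "r \<le> n" "k \<le> n" using rk by auto
  from static[OF goodD(9)[OF g(1)] this(1), of t] obtain X a where
    R: "down_run (\<lambda>u. fst (bb u)) L r t X a" "cnt (fst \<circ> posn bb V) {1..r} t \<le> a" by blast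
  from static[OF goodD(10)[OF g(2)] \<open>k \<le> n\<close>, of t'] obtain Y a' where
    C: "down_run (\<lambda>u. snd (bb u)) L k t' Y a'" "cnt (snd \<circ> posn bb V') {1..k} t' \<le> a'" by blast
  have "a + cnt cl {Suc n - r..n} v + a' + cnt cl {1..k} v \<le> v + r * k + cnt cl {Suc n - r..n} t + cnt cl {1..k} t'"
    by (rule row_column_bound[OF n1 w _ _ R(1) C(1) rk t]) (use b_strict in blast)+
  then show ?thesis using R(2) C(2) by linarith
qed

end

section \<open>Uniqueness of complete fillings\<close>

text \<open>Values beyond the last entry of a class still wait at its diagonal box, so
  \<open>posn\<close> places all values, and two fillings can be compared through it.\<close>

definition complete_filling :: "box set \<Rightarrow> (nat \<Rightarrow> box) \<Rightarrow> filling \<Rightarrow> bool" where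
  "complete_filling lp bb T \<longleftrightarrow> dom T = lp \<and> increasing T \<and> entries_distinct T \<and>
     (\<forall>u. u \<in> ran T \<longleftrightarrow> 1 \<le> u \<and> (\<exists>u0. T (bb u) = Some u0 \<and> u \<le> u0)) \<and>
     (\<forall>z u. T z = Some u \<longrightarrow> northwest z (bb u)) \<and> (\<forall>u. bb u \<in> lp)"

definition rc_bounded :: "nat \<Rightarrow> (nat \<Rightarrow> nat) \<Rightarrow> (nat \<Rightarrow> nat) \<Rightarrow> (nat \<Rightarrow> nat) \<Rightarrow> bool" where
  "rc_bounded n cl rw cw \<longleftrightarrow> (\<forall>r k t t' v. r + k \<le> n \<longrightarrow> t \<le> v \<longrightarrow> t' \<le> v \<longrightarrow>
     cnt rw {1..r} t + cnt cl {Suc n - r..n} v + cnt cw {1..k} t' + cnt cl {1..k} v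
       \<le> v + r * k + cnt cl {Suc n - r..n} t + cnt cl {1..k} t')"

lemma complete_fillingD:
  assumes "complete_filling lp bb T"
  shows "dom T = lp" "increasing T" "entries_distinct T"
    and "\<forall>u. u \<in> ran T \<longleftrightarrow> 1 \<le> u \<and> (\<exists>u0. T (bb u) = Some u0 \<and> u \<le> u0)"
    and "\<forall>z u. T z = Some u \<longrightarrow> northwest z (bb u)" and "\<forall>u. bb u \<in> lp"
  using assms unfolding complete_filling_def by - (elim conjE, assumption)+

lemma increasing_weak:
  assumes T: "increasing T" "dom T = lp" and lp: "young_diagram lp"
    and z: "T (i, j) = Some u" "T (i', j') = Some u'" and le: "i \<le> i'" "j \<le> j'"
  shows "u \<le> u'" and "(i, j) \<noteq> (i', j') \<Longrightarrow> u < u'"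
proof -
  have m: "(i, j) \<in> lp" "(i', j') \<in> lp" using z T(2) by blast+
  have p: "1 \<le> i" "1 \<le> j" using young_diagram_pos[OF lp m(1)] by auto
  have "(i, j') \<in> lp" using young_diagramD[OF lp m(2), of i j'] le p by simp
  then obtain x where x: "T (i, j') = Some x" using T(2) by blast
  have row: "j < j' \<Longrightarrow> u < x" and col: "i < i' \<Longrightarrow> x < u'"
    using T(1) z x unfolding increasing_def by blast+
  have e: "j = j' \<Longrightarrow> u = x" "i = i' \<Longrightarrow> x = u'" using z x by auto
  show "u \<le> u'" using row col e le by (cases "j = j'"; cases "i = i'") auto
  show "u < u'" if "(i, j) \<noteq> (i', j')" using row col e le that by (cases "j = j'"; cases "i = i'") auto
qed

lemma posn_entry:
  assumes "complete_filling lp bb T" "1 \<le> u"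
  shows "\<exists>u'. T (posn bb T u) = Some u' \<and> u' \<le> u" and "northwest (posn bb T u) (bb u)"
proof -
  note T = complete_fillingD[OF assms(1)]
  have "(\<exists>u'. T (posn bb T u) = Some u' \<and> u' \<le> u) \<and> northwest (posn bb T u) (bb u)"
  proof (cases "u \<in> ran T")
    case True
    then obtain z where z: "T z = Some u" unfolding ran_def by blast
    have "posn bb T u = z" by (rule posn_real[OF T(3) z])
    then show ?thesis using z T(5) by simp
  next
    case False
    have e: "posn bb T u = bb u" using False by (rule posn_ghost)
    obtain u0 where "T (bb u) = Some u0" using T(1,6) by blast
    moreover have "u0 \<le> u" using T(4) False assms(2) calculation by (meson nat_le_linear)
    ultimately show ?thesis unfolding e by (simp add: northwest_def)
  qed
  then show "\<exists>u'. T (posn bb T u) = Some u' \<and> u' \<le> u" "northwest (posn bb T u) (bb u)" by blast+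
qed

text \<open>Equal positions do not give equal entries at once: \<open>u\<close> could be an entry of
  \<open>T\<close> and be waiting at the same box in \<open>T'\<close>. Then a smaller entry
  occupies that box in \<open>T'\<close>; by agreement its position in \<open>T\<close> is this box
  too, which forces the entry \<open>u\<close> of \<open>T\<close> to be smaller than
  itself.\<close>

lemma agree_entry:
  assumes T: "complete_filling lp bb T" and T': "complete_filling lp bb T'"
    and ag: "\<And>u. 1 \<le> u \<Longrightarrow> u < v \<Longrightarrow> posn bb T u = posn bb T' u"
    and z: "T z = Some u" "u < v"
  shows "T' z = Some u"
proof -
  note D = complete_fillingD[OF T] and D' = complete_fillingD[OF T']
  have "u \<in> ran T" using z(1) unfolding ran_def by blast
  then have u1: "1 \<le> u" using D(4) by blast
  have pz: "posn bb T' u = z" using ag[OF u1 z(2)] posn_real[OF D(3) z(1), of bb] by simp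
  show ?thesis
  proof (cases "u \<in> ran T'")
    case True
    then obtain y where y: "T' y = Some u" unfolding ran_def by blast
    then show ?thesis using posn_real[OF D'(3) y, of bb] pz by simp
  next
    case False
    obtain u1 where u1': "T' z = Some u1" "u1 \<le> u" using posn_entry(1)[OF T' u1] pz by auto
    have "u1 \<in> ran T'" using u1'(1) unfolding ran_def by blast
    then have ne: "u1 \<noteq> u" "1 \<le> u1" using False D'(4) by blast+
    have "posn bb T u1 = z" using ag[of u1] ne u1'(2) z(2) posn_real[OF D'(3) u1'(1), of bb] by simp
    then obtain u2 where "T z = Some u2" "u2 \<le> u1" using posn_entry(1)[OF T ne(2)] by auto
    then show ?thesis using z(1) ne u1'(2) by simp
  qed
qed

lemma card_cover:
  fixes t :: nat
  assumes "\<And>u. u \<in> {1..t} \<Longrightarrow> P u \<or> Q u"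
  shows "t + card {u \<in> {1..t}. P u \<and> Q u} = card {u \<in> {1..t}. P u} + card {u \<in> {1..t}. Q u}"
proof -
  have "{u \<in> {1..t}. P u} \<union> {u \<in> {1..t}. Q u} = {1..t}" using assms by blast
  moreover have "{u \<in> {1..t}. P u} \<inter> {u \<in> {1..t}. Q u} = {u \<in> {1..t}. P u \<and> Q u}" by auto
  ultimately show ?thesis using card_Un_Int[of "{u \<in> {1..t}. P u}" "{u \<in> {1..t}. Q u}"] by simp
qed

text \<open>Inclusion and exclusion: every value up to \<open>t\<close> is covered by the rows or
  the columns, and the \<open>r * k\<close> entries of the rectangle are covered twice.\<close>

lemma rectangle_count:
  assumes T: "complete_filling lp bb T" and lp: "young_diagram lp"
    and ag: "\<And>u. u \<in> {1..t} \<Longrightarrow> posn bb T' u = posn bb T u"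
    and cover: "\<And>u. u \<in> {1..t} \<Longrightarrow> fst (posn bb T u) \<le> r \<or> snd (posn bb T u) \<le> k"
    and e: "T (r, k) = Some e" "e \<le> t"
  shows "t + r * k \<le> cnt (fst \<circ> posn bb T') {1..r} t + cnt (snd \<circ> posn bb T) {1..k} t"
proof -
  note D = complete_fillingD[OF T]
  let ?P = "\<lambda>u. fst (posn bb T u) \<in> {1..r}" and ?Q = "\<lambda>u. snd (posn bb T u) \<in> {1..k}"
  have pos: "1 \<le> fst (posn bb T u)" "1 \<le> snd (posn bb T u)" if "u \<in> {1..t}" for u
  proof -
    have "1 \<le> u" using that by simp
    then obtain u' where "T (posn bb T u) = Some u'" using posn_entry(1)[OF T] by blast
    then have "(fst (posn bb T u), snd (posn bb T u)) \<in> lp" using D(1) by auto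
    from young_diagram_pos[OF lp this] show "1 \<le> fst (posn bb T u)" "1 \<le> snd (posn bb T u)" by auto
  qed
  have "\<And>u. u \<in> {1..t} \<Longrightarrow> ?P u \<or> ?Q u" using cover pos by fastforce
  from card_cover[of t ?P ?Q, OF this]
  have c: "t + card {u \<in> {1..t}. ?P u \<and> ?Q u} = card {u \<in> {1..t}. ?P u} + card {u \<in> {1..t}. ?Q u}" .
  have rk: "(r, k) \<in> lp" using e(1) D(1) by blast
  let ?g = "\<lambda>z. the (T z)"
  have g: "\<exists>u. T z = Some u \<and> 1 \<le> u \<and> u \<le> t" if z: "z \<in> {1..r} \<times> {1..k}" for z
  proof -
    obtain i j where ij: "z = (i, j)" by (cases z)
    then have le: "1 \<le> i" "i \<le> r" "1 \<le> j" "j \<le> k" using z by auto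
    have "z \<in> lp" unfolding ij by (rule young_diagramD[OF lp rk le])
    then obtain u where u: "T z = Some u" using D(1) by blast
    then have "u \<le> e" using increasing_weak(1)[OF D(2,1) lp _ e(1) le(2,4)] ij by simp
    moreover have "u \<in> ran T" using u unfolding ran_def by blast
    then have "1 \<le> u" using D(4) by blast
    ultimately show ?thesis using u e(2) by auto
  qed
  have "inj_on ?g ({1..r} \<times> {1..k})"
  proof (rule inj_onI)
    fix z z' assume z: "z \<in> {1..r} \<times> {1..k}" "z' \<in> {1..r} \<times> {1..k}" "?g z = ?g z'"
    obtain u u' where "T z = Some u" "T z' = Some u'" using g[OF z(1)] g[OF z(2)] by blast
    then show "z = z'" using z(3) D(3) unfolding entries_distinct_def by (metis option.sel)
  qed
  moreover have "?g ` ({1..r} \<times> {1..k}) \<subseteq> {u \<in> {1..t}. ?P u \<and> ?Q u}"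
  proof
    fix y assume "y \<in> ?g ` ({1..r} \<times> {1..k})"
    then obtain z where z: "z \<in> {1..r} \<times> {1..k}" "y = ?g z" by blast
    obtain u where u: "T z = Some u" "1 \<le> u" "u \<le> t" using g[OF z(1)] by blast
    have "posn bb T u = z" by (rule posn_real[OF D(3) u(1)])
    then show "y \<in> {u \<in> {1..t}. ?P u \<and> ?Q u}" using z u by auto
  qed
  ultimately have "card ({1..r} \<times> {1..k}) \<le> card {u \<in> {1..t}. ?P u \<and> ?Q u}" by (intro card_inj_on_le) auto
  then have "r * k \<le> card {u \<in> {1..t}. ?P u \<and> ?Q u}" by simp
  moreover have "cnt (fst \<circ> posn bb T') {1..r} t = card {u \<in> {1..t}. ?P u}"
    unfolding cnt_card using ag by (intro arg_cong[where f = card]) auto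
  moreover have "cnt (snd \<circ> posn bb T) {1..k} t = card {u \<in> {1..t}. ?Q u}" unfolding cnt_card by simp
  ultimately show ?thesis using c by linarith
qed

text \<open>The first value placed differently sits at \<open>(h, c)\<close> in \<open>T\<close> and higher up in \<open>T'\<close>. Rows above \<open>h\<close> of \<open>T'\<close>
  and the first \<open>min c (Suc n - h)\<close> columns of \<open>T\<close> then contain one value too many.\<close>

lemma no_conflict:
  assumes T: "complete_filling lp bb T" and T': "complete_filling lp bb T'" and lp: "young_diagram lp"
    and cl: "\<And>u. cl u \<in> {1..n}" and row: "\<And>u. fst (bb u) = Suc n - cl u"
    and bd: "rc_bounded n cl (fst \<circ> posn bb T') (snd \<circ> posn bb T)"
    and ag: "\<And>u. 1 \<le> u \<Longrightarrow> u < v \<Longrightarrow> posn bb T u = posn bb T' u"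
    and x: "T (h, c) = Some v" and B: "T' (h', c') = Some v" and hh: "h' < h"
  shows False
proof -
  let ?rw = "fst \<circ> posn bb T'" and ?cw = "snd \<circ> posn bb T"
  note D = complete_fillingD[OF T] and D' = complete_fillingD[OF T']
  have xl: "(h, c) \<in> lp" and Bl: "(h', c') \<in> lp" using x B D(1) D'(1) by blast+
  have p: "1 \<le> h" "1 \<le> c" "1 \<le> h'" "1 \<le> c'" using young_diagram_pos[OF lp xl] young_diagram_pos[OF lp Bl] by auto
  have v1: "1 \<le> v" using x D(4) unfolding ran_def by blast
  define r where "r = h - 1"
  have r: "1 \<le> r" "h' \<le> r" "Suc r = h" using hh p unfolding r_def by auto
  have pv: "posn bb T v = (h, c)" "posn bb T' v = (h', c')"
    using posn_real[OF D(3) x] posn_real[OF D'(3) B] by blast+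
  have "h \<le> fst (bb v)" using D(5) x unfolding northwest_def by fastforce
  then have hc: "h \<le> Suc n - cl v" using row by simp
  have hn: "h \<le> n" using hc cl[of v] by auto
  \<comment> \<open>The largest number of columns that the bound admits for \<open>r\<close> rows.
    The class of \<open>v\<close> is at most \<open>i\<close>, because \<open>v\<close> lies
    northwest of its diagonal box.\<close>
  define i where "i = n - r"
  have ri: "r + i = n" "1 \<le> i" using hn r(3) unfolding i_def by auto
  have ci: "cl v \<le> i" using hc cl[of v] ri r(3) by auto
  show False
  proof (cases "c \<le> i")
    \<comment> \<open>Before \<open>v\<close> the count already attains the bound; \<open>v\<close>
      itself is then counted both in the rows of \<open>T'\<close> and in the columns of
      \<open>T\<close>.\<close>
    case True
    have "(r, c) \<in> lp" using young_diagramD[OF lp xl, of r c] r p by simp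
    then obtain e where e: "T (r, c) = Some e" using D(1) by blast
    have "e < v" using increasing_weak(2)[OF D(2,1) lp e x] r by simp
    then have "v - 1 + r * c \<le> cnt ?rw {1..r} (v - 1) + cnt ?cw {1..c} (v - 1)"
    proof (intro rectangle_count[OF T lp _ _ e])
      fix u assume u: "u \<in> {1..v - 1}"
      then have u': "1 \<le> u" "u < v" using v1 by auto
      show "posn bb T' u = posn bb T u" using ag[OF u'] by simp
      show "fst (posn bb T u) \<le> r \<or> snd (posn bb T u) \<le> c"
      proof (rule ccontr)
        assume n: "\<not> ?thesis"
        obtain u2 where u2: "T (posn bb T u) = Some u2" "u2 \<le> u" using posn_entry(1)[OF T u'(1)] by blast
        then have e2: "T (fst (posn bb T u), snd (posn bb T u)) = Some u2" by simp
        have "(h, c) \<noteq> (fst (posn bb T u), snd (posn bb T u))" using n by (metis le_refl snd_conv)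
        moreover have "h \<le> fst (posn bb T u)" "c \<le> snd (posn bb T u)" using n r(3) by auto
        ultimately have "v < u2" using increasing_weak(2)[OF D(2,1) lp x e2] by blast
        then show False using u2(2) u'(2) by linarith
      qed
    qed simp
    moreover have "cnt ?rw {1..r} v = cnt ?rw {1..r} (v - 1) + 1"
      using cnt.simps(2)[of ?rw "{1..r}" "v - 1"] v1 pv r p by simp
    moreover have "cnt ?cw {1..c} v = cnt ?cw {1..c} (v - 1) + 1"
      using cnt.simps(2)[of ?cw "{1..c}" "v - 1"] v1 pv p by simp
    moreover have "cnt ?rw {1..r} v + cnt cl {Suc n - r..n} v + cnt ?cw {1..c} v + cnt cl {1..c} v
       \<le> v + r * c + cnt cl {Suc n - r..n} v + cnt cl {1..c} v"
    proof -
      have "r + c \<le> n" using True ri by linarith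
      then show ?thesis using bd unfolding rc_bounded_def by blast
    qed
    ultimately show False using v1 by linarith
  next
    \<comment> \<open>Column \<open>c\<close> is out of reach, so columns are counted only up to the
      entry \<open>v0\<close> in column \<open>i\<close>, rows up to \<open>v\<close>. Values after
      \<open>v0\<close> of class above \<open>i\<close> have their diagonal boxes, hence their
      positions, in the first \<open>r\<close> rows. The value \<open>v\<close> is one more in these
      rows, although its class is at most \<open>i\<close>.\<close>
    case False
    have "(h, i) \<in> lp" using young_diagramD[OF lp xl, of h i] False ri p by simp
    then obtain v0 where v0: "T (h, i) = Some v0" using D(1) by blast
    have v0v: "v0 < v" using increasing_weak(2)[OF D(2,1) lp v0 x] False by simp
    have "(r, i) \<in> lp" using young_diagramD[OF lp \<open>(h, i) \<in> lp\<close>, of r i] r ri by simp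
    then obtain e where e: "T (r, i) = Some e" using D(1) by blast
    have "e < v0" using increasing_weak(2)[OF D(2,1) lp e v0] r by simp
    then have A: "v0 + r * i \<le> cnt ?rw {1..r} v0 + cnt ?cw {1..i} v0"
    proof (intro rectangle_count[OF T lp _ _ e])
      fix u assume u: "u \<in> {1..v0}"
      then have u': "1 \<le> u" "u < v" "u \<le> v0" using v0v by auto
      show "posn bb T' u = posn bb T u" using ag[OF u'(1,2)] by simp
      show "fst (posn bb T u) \<le> r \<or> snd (posn bb T u) \<le> i"
      proof (rule ccontr)
        assume n: "\<not> ?thesis"
        obtain u2 where u2: "T (posn bb T u) = Some u2" "u2 \<le> u" using posn_entry(1)[OF T u'(1)] by blast
        then have e2: "T (fst (posn bb T u), snd (posn bb T u)) = Some u2" by simp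
        have "(h, i) \<noteq> (fst (posn bb T u), snd (posn bb T u))" using n by (metis le_refl snd_conv)
        moreover have "h \<le> fst (posn bb T u)" "i \<le> snd (posn bb T u)" using n r(3) by auto
        ultimately have "v0 < u2" using increasing_weak(2)[OF D(2,1) lp v0 e2] by blast
        then show False using u2(2) u'(3) by linarith
      qed
    qed simp
    let ?A = "{u \<in> {v0<..v}. ?rw u \<in> {1..r}}"
    let ?J = "{u \<in> {v0<..v}. cl u \<in> {1..i}}" and ?K = "{u \<in> {v0<..v}. cl u \<notin> {1..i}}"
    have JK: "card ?J + card ?K = v - v0"
    proof -
      have "?J \<union> ?K = {v0<..v}" "?J \<inter> ?K = {}" by auto
      then show ?thesis using card_Un_disjoint[of ?J ?K] by simp
    qed
    have "insert v ?K \<subseteq> ?A"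
    proof
      fix u assume u: "u \<in> insert v ?K"
      show "u \<in> ?A"
      proof (cases "u = v")
        case True
        then show ?thesis using v0v pv r p by simp
      next
        case False
        then have k: "v0 < u" "u \<le> v" "cl u \<notin> {1..i}" using u by auto
        have u1: "1 \<le> u" using k(1) by simp
        have "fst (posn bb T' u) \<le> Suc n - cl u" using posn_entry(2)[OF T' u1] row unfolding northwest_def by simp
        also have "\<dots> \<le> r" using k(3) cl[of u] ri by auto
        finally have le: "fst (posn bb T' u) \<le> r" .
        obtain u' where "T' (posn bb T' u) = Some u'" using posn_entry(1)[OF T' u1] by blast
        then have "(fst (posn bb T' u), snd (posn bb T' u)) \<in> lp" using D'(1) by auto
        from young_diagram_pos[OF lp this] show ?thesis using k le by simp
      qed
    qed
    then have "card (insert v ?K) \<le> card ?A" by (intro card_mono) auto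
    moreover have "v \<notin> ?K" using ci cl[of v] by auto
    ultimately have K: "Suc (card ?K) \<le> card ?A" by simp
    have "v0 \<le> v" using v0v by simp
    have s1: "cnt ?rw {1..r} v = cnt ?rw {1..r} v0 + card ?A"
      by (rule cnt_split[OF \<open>v0 \<le> v\<close>])
    have s2: "cnt cl {1..i} v = cnt cl {1..i} v0 + card ?J" by (rule cnt_split[OF \<open>v0 \<le> v\<close>])
    have "cnt ?rw {1..r} v + cnt cl {Suc n - r..n} v + cnt ?cw {1..i} v0 + cnt cl {1..i} v
       \<le> v + r * i + cnt cl {Suc n - r..n} v + cnt cl {1..i} v0"
    proof -
      have "r + i \<le> n" using ri by simp
      then show ?thesis using bd \<open>v0 \<le> v\<close> unfolding rc_bounded_def by blast
    qed
    then show False using A K s1 s2 JK v0v by linarith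
  qed
qed

lemma posn_determines:
  assumes T: "complete_filling lp bb T" and T': "complete_filling lp bb T'"
    and ag: "\<And>u. 1 \<le> u \<Longrightarrow> posn bb T u = posn bb T' u"
  shows "T = T'"
proof
  fix z
  show "T z = T' z"
  proof (cases "T z")
    case None
    then have "z \<notin> dom T'" using complete_fillingD(1)[OF T] complete_fillingD(1)[OF T'] by blast
    then show ?thesis using None by (simp add: domIff)
  next
    case (Some u)
    then show ?thesis using agree_entry[OF T T', of "Suc u"] ag by simp
  qed
qed

lemma unique_filling:
  assumes T: "complete_filling lp bb T" and T': "complete_filling lp bb T'" and lp: "young_diagram lp"
    and cl: "\<And>u. cl u \<in> {1..n}" and row: "\<And>u. fst (bb u) = Suc n - cl u"
    and bd: "rc_bounded n cl (fst \<circ> posn bb T') (snd \<circ> posn bb T)" "rc_bounded n cl (fst \<circ> posn bb T) (snd \<circ> posn bb T')"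
  shows "T = T'"
proof (rule posn_determines[OF T T'], rule ccontr)
  note D = complete_fillingD[OF T] and D' = complete_fillingD[OF T']
  fix u0 assume u0: "1 \<le> u0" "posn bb T u0 \<noteq> posn bb T' u0"
  define v where "v = (LEAST u. 1 \<le> u \<and> posn bb T u \<noteq> posn bb T' u)"
  have v: "1 \<le> v" "posn bb T v \<noteq> posn bb T' v"
    using LeastI[of "\<lambda>u. 1 \<le> u \<and> posn bb T u \<noteq> posn bb T' u" u0] u0 unfolding v_def by auto
  have ag: "posn bb T u = posn bb T' u" if "1 \<le> u" "u < v" for u
    using not_less_Least[of u "\<lambda>u. 1 \<le> u \<and> posn bb T u \<noteq> posn bb T' u"] that unfolding v_def by blast
  have ag': "posn bb T' u = posn bb T u" if "1 \<le> u" "u < v" for u using ag[OF that] by simp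
  \<comment> \<open>If \<open>v\<close> were waiting in \<open>V\<close>, its diagonal box would
    hold a smaller entry, which \<open>V'\<close> shares; then \<open>v\<close> would be waiting in
    \<open>V'\<close> as well.\<close>
  have ghost: "v \<in> ran V" if V: "complete_filling lp bb V" "complete_filling lp bb V'"
    and agV: "\<And>u. 1 \<le> u \<Longrightarrow> u < v \<Longrightarrow> posn bb V' u = posn bb V u" and vr: "v \<in> ran V'" for V V'
  proof (rule ccontr)
    assume n: "v \<notin> ran V"
    note E = complete_fillingD[OF V(1)] and E' = complete_fillingD[OF V(2)]
    obtain u1 where u1: "V (bb v) = Some u1" using E(1,6) by blast
    then have lt: "u1 < v" using E(4) n v(1) by (meson not_le)
    have "V' (bb v) = Some u1" by (rule agree_entry[OF V _ u1 lt]) (use agV in simp)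
    then show False using E'(4) vr lt by fastforce
  qed
  have "v \<in> ran T \<or> v \<in> ran T'" using v(2) posn_ghost[of v T bb] posn_ghost[of v T' bb] by metis
  then have "v \<in> ran T" "v \<in> ran T'" using ghost[OF T T' ag'] ghost[OF T' T ag] by blast+
  then obtain x y where x: "T x = Some v" and y: "T' y = Some v" unfolding ran_def by blast
  obtain h c h' c' where xy: "x = (h, c)" "y = (h', c')" by (cases x; cases y)
  have ne: "(h, c) \<noteq> (h', c')" using v(2) posn_real[OF D(3) x, of bb] posn_real[OF D'(3) y, of bb] xy by auto
  have x': "T (h, c) = Some v" and y': "T' (h', c') = Some v" using x y xy by auto
  have "h \<noteq> h'"
  proof
    assume hh: "h = h'"
    \<comment> \<open>Within one row, the left one of the two boxes holds an entry below
      \<open>v\<close> in the other filling, and such entries are common to both.\<close>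
    have left: "False" if V: "complete_filling lp bb V" "complete_filling lp bb V'" "V (h, j) = Some v" "V' (h, j') = Some v" "j < j'"
      and agV: "\<And>u. 1 \<le> u \<Longrightarrow> u < v \<Longrightarrow> posn bb V' u = posn bb V u" for V V' j j'
    proof -
      note E = complete_fillingD[OF V(1)] and E' = complete_fillingD[OF V(2)]
      have "(h, j) \<in> dom V'" using V(3) E(1) E'(1) by blast
      then obtain u where u: "V' (h, j) = Some u" by blast
      have "u < v" using increasing_weak(2)[OF E'(2,1) lp u V(4)] V(5) by simp
      from agree_entry[OF V(2,1) agV u this] V(3) \<open>u < v\<close> show False by simp
    qed
    show False
    proof (cases "c < c'")
      case True
      then show ?thesis using left[OF T T' x' _ True ag'] y' hh by simp
    next
      case False
      then have "c' < c" using ne hh by auto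
      then show ?thesis using left[OF T' T _ x' _ ag] y' hh by simp
    qed
  qed
  then consider "h' < h" | "h < h'" by linarith
  then show False
  proof cases
    case 1
    show ?thesis by (rule no_conflict[OF T T' lp cl row bd(1) ag x' y' 1])
  next
    case 2
    show ?thesis by (rule no_conflict[OF T' T lp cl row bd(2) ag' y' x' 2])
  qed
qed

section \<open>Independence of the choices\<close>

context diagonal
begin

lemma good_complete: "good {} T \<Longrightarrow> complete_filling lp bb T"
  unfolding complete_filling_def using goodD(3-6,8)[of "{}" T] b_in[OF cl_in] by simp

lemma good_rc_bounded:
  "good {} V \<Longrightarrow> good {} V' \<Longrightarrow> rc_bounded n cl (fst \<circ> posn bb V) (snd \<circ> posn bb V')"
  unfolding rc_bounded_def by (intro allI impI) (rule good_row_column_bound)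

lemma good_unique_rows:
  assumes "good {} T" "good {} T'" and "\<And>j. 1 \<le> j \<Longrightarrow> j \<le> n \<Longrightarrow> fst (b j) = Suc n - j"
  shows "T = T'"
  by (rule unique_filling[where cl = cl and bb = bb and n = n, OF good_complete[OF assms(1)] good_complete[OF assms(2)] lp(1)])
    (use assms cl_in good_rc_bounded in auto)

text \<open>After transposition the diagonal box of \<open>u\<close> lies in row
  \<open>cl u\<close>, so \<open>unique_filling\<close> requires the reflected class index. The
  bound is symmetric under this reflection together with the exchange of rows and columns.\<close>

lemma good_unique_columns:
  assumes g: "good {} T" "good {} T'" and col: "\<And>j. 1 \<le> j \<Longrightarrow> j \<le> n \<Longrightarrow> snd (b j) = j"
  shows "T = T'"
proof -
  let ?bb = "prod.swap \<circ> bb" and ?cl = "\<lambda>u. Suc n - cl u"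
  have comp: "complete_filling (prod.swap ` lp) ?bb (transposed V)" if "good {} V" for V
  proof -
    note D = complete_fillingD[OF good_complete[OF that]]
    have "northwest z (?bb u)" if "transposed V z = Some u" for z u
      using D(5) that northwest_swap[of "prod.swap z" "bb u"] unfolding transposed_def by simp
    moreover have "transposed V (?bb u) = V (bb u)" for u by (simp add: transposed_def)
    ultimately show ?thesis
      unfolding complete_filling_def using D dom_tr[of V] increasing_tr[OF D(2)] entries_distinct_tr[OF D(3)] by simp
  qed
  have refl: "Suc n - cl u \<in> {Suc n - i..n} \<longleftrightarrow> cl u \<in> {1..i}" "Suc n - cl u \<in> {1..i} \<longleftrightarrow> cl u \<in> {Suc n - i..n}"
    if "i \<le> n" for i u
    using cl_in[of u] that by auto
  have cnt_cong: "cnt f A t = cnt g B t" if "\<And>u. f u \<in> A \<longleftrightarrow> g u \<in> B" for f g :: "nat \<Rightarrow> nat" and A B t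
    using that by (induction t) auto
  have bounded: "rc_bounded n ?cl (fst \<circ> posn ?bb (transposed V)) (snd \<circ> posn ?bb (transposed V'))" if "good {} V" "good {} V'" for V V'
  proof -
    have w: "fst \<circ> posn ?bb (transposed V) = snd \<circ> posn bb V" "snd \<circ> posn ?bb (transposed V') = fst \<circ> posn bb V'"
      using posn_tr[OF goodD(5)[OF that(1)]] posn_tr[OF goodD(5)[OF that(2)]] by (simp_all add: fun_eq_iff)
    show ?thesis
      unfolding rc_bounded_def w
    proof (intro allI impI)
      fix r k t t' v :: nat assume h: "r + k \<le> n" "t \<le> v" "t' \<le> v"
      have "r \<le> n" "k \<le> n" using h by auto
      then have c: "cnt ?cl {Suc n - r..n} s = cnt cl {1..r} s" "cnt ?cl {1..k} s = cnt cl {Suc n - k..n} s" for s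
        using cnt_cong[of ?cl "{Suc n - r..n}" cl "{1..r}"] cnt_cong[of ?cl "{1..k}" cl "{Suc n - k..n}"] refl by blast+
      have "cnt (fst \<circ> posn bb V') {1..k} t' + cnt cl {Suc n - k..n} v + cnt (snd \<circ> posn bb V) {1..r} t + cnt cl {1..r} v
          \<le> v + k * r + cnt cl {Suc n - k..n} t' + cnt cl {1..r} t"
        by (rule good_row_column_bound[OF that(2,1)]) (use h in auto)
      then show "cnt (snd \<circ> posn bb V) {1..r} t + cnt ?cl {Suc n - r..n} v + cnt (fst \<circ> posn bb V') {1..k} t' + cnt ?cl {1..k} v
          \<le> v + r * k + cnt ?cl {Suc n - r..n} t + cnt ?cl {1..k} t'"
        unfolding c by (simp add: mult.commute)
    qed
  qed
  have "transposed T = transposed T'"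
  proof (rule unique_filling[OF comp[OF g(1)] comp[OF g(2)] young_diagram_swap[OF lp(1)] _ _ bounded[OF g(2,1)] bounded[OF g]])
    show "Suc n - cl u \<in> {1..n}" for u using cl_in[of u] by auto
    show "fst (?bb u) = Suc n - (Suc n - cl u)" for u using cl_in[of u] col[OF cl_in] by simp
  qed
  then have "transposed (transposed T) = transposed (transposed T')" by simp
  then show ?thesis by simp
qed

lemma construction_unique:
  assumes "\<And>T T'. good {} T \<Longrightarrow> good {} T' \<Longrightarrow> T = T'"
  shows "\<exists>T. (\<forall>T'. construction_output n lp b w T' \<longleftrightarrow> T' = T) \<and> (\<forall>U\<in>SYT lm. filling_of_choices n lm b w U = T)"
proof -
  obtain T where T: "steps start T" "good {} T" using completion_exists[OF good_start] by blast
  have out: "good {} T'" if "construction_output n lp b w T'" for T'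
  proof -
    have r: "steps start T'" and d: "dom T' = lp" using that unfolding construction_output_def by blast+
    obtain mu where g: "good mu T'" using reachable_good[OF r] by blast
    then have "mu = {}" using good_unfilled[OF g] d by simp
    then show ?thesis using g by simp
  qed
  have "construction_output n lp b w T" unfolding construction_output_def using T goodD(3)[OF T(2)] by simp
  then have "construction_output n lp b w T' \<longleftrightarrow> T' = T" for T' using out assms T(2) by blast
  moreover have "filling_of_choices n lm b w U = T" if "U \<in> SYT lm" for U
    using assms[OF filling_of_choices_good[OF that] T(2)] .
  ultimately show ?thesis by blast
qed

end

lemma strictly_decreasing_rows:
  fixes g :: "nat \<Rightarrow> nat"
  assumes "\<And>i j. 1 \<le> i \<Longrightarrow> i < j \<Longrightarrow> j \<le> n \<Longrightarrow> g j < g i" "\<And>i. 1 \<le> i \<Longrightarrow> i \<le> n \<Longrightarrow> g i \<in> {1..n}"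
    and "1 \<le> j" "j \<le> n"
  shows "g j = Suc n - j"
proof -
  have step: "g j + (j - i) \<le> g i" if "1 \<le> i" "i \<le> j" "j \<le> n" for i j
    using that(2,3)
  proof (induction j rule: dec_induct)
    case (step j)
    have "g (Suc j) < g j" using assms(1)[of j "Suc j"] that(1) step by simp
    then show ?case using step by simp
  qed simp
  have "g j + (j - 1) \<le> g 1" "g n + (n - j) \<le> g j" using step[of 1 j] step[of j n] assms(3,4) by auto
  moreover have "g 1 \<le> n" "1 \<le> g n" using assms(2)[of 1] assms(2)[of n] assms(3,4) by auto
  ultimately show ?thesis using assms(3,4) by linarith
qed

lemma strictly_increasing_columns:
  fixes g :: "nat \<Rightarrow> nat"
  assumes "\<And>i j. 1 \<le> i \<Longrightarrow> i < j \<Longrightarrow> j \<le> n \<Longrightarrow> g i < g j" "\<And>i. 1 \<le> i \<Longrightarrow> i \<le> n \<Longrightarrow> g i \<in> {1..n}"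
    and "1 \<le> j" "j \<le> n"
  shows "g j = j"
proof -
  have "Suc n - g j = Suc n - j"
  proof (rule strictly_decreasing_rows[of n "\<lambda>j. Suc n - g j", OF _ _ assms(3,4)])
    show "Suc n - g j < Suc n - g i" if "1 \<le> i" "i < j" "j \<le> n" for i j
      using assms(1)[OF that] assms(2)[of j] that by auto
    show "Suc n - g i \<in> {1..n}" if "1 \<le> i" "i \<le> n" for i using assms(2)[OF that] by auto
  qed
  moreover have "g j \<le> n" using assms(2)[OF assms(3,4)] by simp
  ultimately show ?thesis using assms(4) by linarith
qed

theorem theorem1p1:
  fixes m n :: nat and R lp lm :: "box set" and b :: "nat \<Rightarrow> box" and w :: "nat \<Rightarrow> nat"
  assumes "1 \<le> n" and "n \<le> m"
    and "R = rectangle n m \<or> R = rectangle m n"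
    and "is_diagonal n R lp lm b"
    and "w permutes {1..n}"
  shows "\<exists>T. (\<forall>T'. construction_output n lp b w T' \<longleftrightarrow> T' = T)
           \<and> (\<forall>U\<in>SYT lm. filling_of_choices n lm b w U = T)"
proof -
  from assms(4) have lm: "young_diagram lm" and lp: "young_diagram lp" and sub: "lm \<subseteq> lp" and lpR: "lp \<subseteq> R"
    and bij: "bij_betw b {1..n} (lp - lm)"
    and anti: "\<And>i. 1 \<le> i \<Longrightarrow> i < n \<Longrightarrow> fst (b (Suc i)) < fst (b i) \<and> snd (b i) < snd (b (Suc i))"
    unfolding is_diagonal_def by simp_all
  have lpm: "lp \<subseteq> {1..m} \<times> {1..m}" using lpR assms(2,3) unfolding rectangle_def by auto
  interpret A: antidiagonal n m lp lm b w
    by unfold_locales (use assms lm lp lpm sub bij anti in auto)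
  show ?thesis
    using assms(3)
  proof
    assume R: "R = rectangle n m"
    have in_n: "fst y \<in> {1..n}" if "y \<in> lp" for y using that lpR R unfolding rectangle_def by auto
    \<comment> \<open>There are \<open>n\<close> strictly decreasing row numbers in
      \<open>{1..n}\<close>, which leaves no choice.\<close>
    have rows: "fst (b j) = Suc n - j" if "1 \<le> j" "j \<le> n" for j
      using that in_n A.b_in A.b_strict by (intro strictly_decreasing_rows[of n "\<lambda>j. fst (b j)"]) blast+
    interpret D: diagonal n m lp lm b w
    proof unfold_locales
      fix y assume y: "corner_of lp y"
      then have "fst y \<in> {1..n}" using in_n unfolding corner_of_def by blast
      then have "1 \<le> Suc n - fst y" "Suc n - fst y \<le> n" "fst (b (Suc n - fst y)) = fst y"
        using rows[of "Suc n - fst y"] by auto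
      then show "y \<in> b ` {1..n}" by (rule A.corner_in_row[OF y])
    qed
    show ?thesis by (rule D.construction_unique[OF D.good_unique_rows]) (use rows in blast)+
  next
    assume R: "R = rectangle m n"
    have in_n: "snd y \<in> {1..n}" if "y \<in> lp" for y using that lpR R unfolding rectangle_def by auto
    have columns: "snd (b j) = j" if "1 \<le> j" "j \<le> n" for j
      using that in_n A.b_in A.b_strict by (intro strictly_increasing_columns[of n "\<lambda>j. snd (b j)"]) blast+
    interpret D: diagonal n m lp lm b w
    proof unfold_locales
      fix y assume y: "corner_of lp y"
      then have "snd y \<in> {1..n}" using in_n unfolding corner_of_def by blast
      then have "1 \<le> snd y" "snd y \<le> n" "snd (b (snd y)) = snd y" using columns[of "snd y"] by auto
      then show "y \<in> b ` {1..n}" by (rule A.corner_in_column[OF y])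
    qed
    show ?thesis by (rule D.construction_unique[OF D.good_unique_columns]) (use columns in blast)+
  qed
qed

end
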